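(* Let $(\Phi,K,\mu,T)$ be a self-conformal system on $\mathbb{R}^d$ with $\mu$ a Gibbs measure equivalent to $\mathcal{H}^{\tau}|_K$, where $\tau:=\dim_{\mathrm H}K$. Let $\psi:\mathbb{R}\to[0,\infty)$ be a function and let $R(\psi):=\{x\in K:\ T^nx\in B(x,\psi(n))\text{ for infinitely many }n\in\mathbb{N}\}$. Then $$\mu\big(R(\psi)\big)=\begin{cases}0&\text{if }\sum_{n=1}^\infty\psi(n)^\tau<\infty,\\[1ex]1&\text{if }\sum_{n=1}^\infty\psi(n)^\tau=\infty.\end{cases}$$
   Context: Self-conformal system. $|\cdot|$ is the Euclidean norm on $\mathbb{R}^d$; for a $d\times d$ matrix $A$, $|A|=\sup\{|Ax|:|x|=1\}$; $f'(x)$ is the Jacobian matrix. A $C^1$ map $f:\Omega\to\mathbb{R}^d$ on an open set $\Omega\subseteq\mathbb{R}^d$ is conformal if it is injective, $f'(x)\ne0$ and $|f'(x)y|=|f'(x)|\,|y|$ for all $x\in\Omega$, $y\in\mathbb{R}^d$. A $C^{1+\alpha}$ conformal IFS ($\alpha>0$) is a finite family $\Phi=\{\varphi_j\}_{1\le j\le m}$, $m\ge2$, for which there is a bounded connected open set $\Omega\subseteq\mathbb{R}^d$ such that each $\varphi_j:\Omega\to\Omega$ is an injective contractive conformal map with $\overline{\varphi_j(\Omega)}\subseteq\Omega$, $0<\inf_\Omega|\varphi_j'|\le\sup_\Omega|\varphi_j'|<1$, and $\big||\varphi_j'(x)|-|\varphi_j'(y)|\big|\le C|x-y|^\alpha$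 on $\Omega$ for some constant $C$. $K\subseteq\Omega$ is the unique nonempty compact set with $K=\bigcup_{j}\varphi_j(K)$ (the self-conformal set). The open set condition (OSC): there is a nonempty open $V\subseteq\Omega$ with $\varphi_j(V)\subseteq V$ for all $j$ and $\varphi_i(V)\cap\varphi_j(V)=\emptyset$ for $i\ne j$. Gibbs measure on $K$: given $\alpha'>0$ and positive $\alpha'$-Hölder functions $g_j:\varphi_j(\Omega)\to(0,\infty)$ ($1\le j\le m$), let $\mathcal{L}:C(K)\to C(K)$, $(\mathcal{L}f)(x)=\sum_{j=1}^m g_j(\varphi_j(x))f(\varphi_j(x))$, with spectral radius $R$ and dual $\mathcal{L}^*$ acting on finite signed Borel measures on $K$. There are a unique positive $h\in C(K)$ and a unique Borel probability measure $\nu$ on $K$ with $\mathcal{L}h=Rh$, $\mathcal{L}^*\nu=R\nu$, $\int_K h\,d\nu=1$. The Gibbs measure is $d\mu=h\,d\nu$. The map $T$: let $\pi:\{1,\dots,m\}^{\mathbb{N}}\to K$, $\pi(i_1i_2\cdots)=\lim_{n}\varphi_{i_1}\circ\cdots\circ\varphi_{i_n}(x_0)$ (any $x_0\in K$), let $\sigma$ be the left shift and $\widetilde K=\{x\in K:\#\pi^{-1}(x)=1\}$. Define $T:\mathbb{R}^d\to\mathbb{R}^d$ by $T(x)=\pi(\sigma(\pi^{-1}(x)))$ if $x\in\widetilde K$ and $T(x)=x$ otherwise. A self-conformal system on $\mathbb{R}^d$ is a quadruple $(\Phi,K,\mu,T)$ with $\Phi$ a $C^{1+\alpha}$ conformal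 IFS (some $\alpha>0$) satisfying the OSC, $K$ its self-conformal set, $\mu$ a Gibbs measure on $K$ (with respect to some such potentials; viewed as a measure on $\mathbb{R}^d$; it is $T$-invariant), and $T:\mathbb{R}^d\to\mathbb{R}^d$ the map given by $T(x)=\pi(\sigma(\pi^{-1}(x)))$ for $x\in\widetilde K$ and $T(x)=x$ for $x\notin\widetilde K$. $\mathcal{H}^\tau|_K$ is $\tau$-dimensional Hausdorff measure restricted to $K$ and $\dim_{\mathrm H}$ is Hausdorff dimension. Two Borel measures $\mu,\nu$ on a metric space are equivalent if there is $C\ge1$ with $C^{-1}\nu(E)\le\mu(E)\le C\nu(E)$ for all Borel $E$. $B(x,r)$ is the open Euclidean ball with centre $x$ and radius $r$ (empty if $r=0$). *)

theory Defs
  imports "HOL-Analysis.Analysis"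
begin

section \<open>Hausdorff measure and dimension\<close>

text \<open>The weight \<open>diam(U) ^ s\<close> with the conventions \<open>diam({}) ^ s = 0\<close> and \<open>0 ^ 0 = 1\<close>;
  plain \<open>powr\<close> would give \<open>0 powr 0 = 0\<close>, so that singletons would have no
  zero-dimensional mass.\<close>

definition hausdorff_weight :: "real \<Rightarrow> 'a::metric_space set \<Rightarrow> ennreal" where
  "hausdorff_weight s U =
     (if U = {} then 0 else if s = 0 then 1 else ennreal (diameter U powr s))"

text \<open>Boundedness of the covering sets is required because \<open>diameter\<close> is a conditionally
  complete supremum, hence unspecified on unbounded sets.\<close>

definition hausdorff_premeasure :: "real \<Rightarrow> real \<Rightarrow> 'a::metric_space set \<Rightarrow> ennreal" where
  "hausdorff_premeasure s \<delta> A =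
     Inf {(\<Sum>k. hausdorff_weight s (U k)) | U :: nat \<Rightarrow> 'a set.
            A \<subseteq> (\<Union>k. U k) \<and> (\<forall>k. bounded (U k) \<and> diameter (U k) \<le> \<delta>)}"

definition hausdorff_measure :: "real \<Rightarrow> 'a::metric_space set \<Rightarrow> ennreal" where
  "hausdorff_measure s A = (SUP \<delta>\<in>{0<..}. hausdorff_premeasure s \<delta> A)"

text \<open>In a Euclidean space the set below is never empty (it contains every \<open>s\<close> larger than the
  dimension of the space), so the infimum may be taken in the reals.\<close>

definition hausdorff_dim :: "'a::euclidean_space set \<Rightarrow> real" where
  "hausdorff_dim A = Inf {s. 0 \<le> s \<and> hausdorff_measure s A = 0}"

text \<open>Measures enter as set functions that are only evaluated on Borel sets, so that the
  Hausdorff (outer) measure can be used directly.\<close>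

definition equivalent_measures ::
    "('a::topological_space set \<Rightarrow> ennreal) \<Rightarrow> ('a set \<Rightarrow> ennreal) \<Rightarrow> bool" where
  "equivalent_measures \<mu> \<nu> \<longleftrightarrow>
     (\<exists>C::real. C \<ge> 1 \<and>
        (\<forall>E\<in>sets borel. ennreal (inverse C) * \<nu> E \<le> \<mu> E \<and> \<mu> E \<le> ennreal C * \<nu> E))"


section \<open>Conformal iterated function systems\<close>

abbreviation jacobian_norm :: "(real^'n \<Rightarrow> real^'n) \<Rightarrow> real^'n \<Rightarrow> real" where
  "jacobian_norm f x \<equiv> onorm ((*v) (jacobian f (at x)))"

definition conformal_on :: "(real^'n) set \<Rightarrow> (real^'n \<Rightarrow> real^'n) \<Rightarrow> bool" where
  "conformal_on \<Omega> f \<longleftrightarrow>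
     open \<Omega> \<and> inj_on f \<Omega> \<and>
     (\<forall>x\<in>\<Omega>. f differentiable (at x)) \<and> continuous_on \<Omega> (\<lambda>x. jacobian f (at x)) \<and>
     (\<forall>x\<in>\<Omega>. jacobian f (at x) \<noteq> 0 \<and>
        (\<forall>y. norm (jacobian f (at x) *v y) = jacobian_norm f x * norm y))"

text \<open>The maps are indexed by \<open>{1..m}\<close>; only their values on \<open>\<Omega>\<close> matter.\<close>

definition conformal_ifs ::
    "real \<Rightarrow> (real^'n) set \<Rightarrow> nat \<Rightarrow> (nat \<Rightarrow> real^'n \<Rightarrow> real^'n) \<Rightarrow> bool" where
  "conformal_ifs \<alpha> \<Omega> m \<phi> \<longleftrightarrow>
     \<alpha> > 0 \<and> m \<ge> 2 \<and>
     open \<Omega> \<and> bounded \<Omega> \<and> connected \<Omega> \<and> \<Omega> \<noteq> {} \<and>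
     (\<forall>j\<in>{1..m}.
        conformal_on \<Omega> (\<phi> j) \<and>
        (\<exists>c<1. c-lipschitz_on \<Omega> (\<phi> j)) \<and>
        \<phi> j ` \<Omega> \<subseteq> \<Omega> \<and> closure (\<phi> j ` \<Omega>) \<subseteq> \<Omega> \<and>
        0 < (INF x\<in>\<Omega>. jacobian_norm (\<phi> j) x) \<and>
        bdd_above (jacobian_norm (\<phi> j) ` \<Omega>) \<and> (SUP x\<in>\<Omega>. jacobian_norm (\<phi> j) x) < 1 \<and>
        (\<exists>C. \<forall>x\<in>\<Omega>. \<forall>y\<in>\<Omega>.
           \<bar>jacobian_norm (\<phi> j) x - jacobian_norm (\<phi> j) y\<bar> \<le> C * norm (x - y) powr \<alpha>))"

definition open_set_condition ::
    "(real^'n) set \<Rightarrow> nat \<Rightarrow> (nat \<Rightarrow> real^'n \<Rightarrow> real^'n) \<Rightarrow> bool" where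
  "open_set_condition \<Omega> m \<phi> \<longleftrightarrow>
     (\<exists>V. V \<noteq> {} \<and> open V \<and> V \<subseteq> \<Omega> \<and>
        (\<forall>j\<in>{1..m}. \<phi> j ` V \<subseteq> V) \<and>
        (\<forall>i\<in>{1..m}. \<forall>j\<in>{1..m}. i \<noteq> j \<longrightarrow> \<phi> i ` V \<inter> \<phi> j ` V = {}))"

definition self_conformal_set ::
    "(real^'n) set \<Rightarrow> nat \<Rightarrow> (nat \<Rightarrow> real^'n \<Rightarrow> real^'n) \<Rightarrow> (real^'n) set \<Rightarrow> bool" where
  "self_conformal_set \<Omega> m \<phi> K \<longleftrightarrow>
     K \<noteq> {} \<and> compact K \<and> K \<subseteq> \<Omega> \<and> K = (\<Union>j\<in>{1..m}. \<phi> j ` K)"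


section \<open>Transfer operators and Gibbs measures\<close>

text \<open>The transfer operator acts on real- and on complex-valued functions.\<close>

definition transfer_operator ::
    "nat \<Rightarrow> (nat \<Rightarrow> 'a \<Rightarrow> 'a) \<Rightarrow> (nat \<Rightarrow> 'a \<Rightarrow> real) \<Rightarrow> ('a \<Rightarrow> 'b::real_vector) \<Rightarrow> 'a \<Rightarrow> 'b" where
  "transfer_operator m \<phi> g f x = (\<Sum>j=1..m. g j (\<phi> j x) *\<^sub>R f (\<phi> j x))"

text \<open>The complex Banach space \<open>C(K)\<close>: extensional functions, so that equality of functions is
  equality on \<open>K\<close>.\<close>

definition continuous_functions :: "'a::topological_space set \<Rightarrow> ('a \<Rightarrow> complex) set" where
  "continuous_functions K = {f. continuous_on K f} \<inter> extensional K"

text \<open>The spectrum of an operator on the complex space \<open>C(K)\<close>, \<open>K\<close> compact: for a bounded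
  operator, the inverse of a bijective \<open>z - L\<close> is bounded by the open mapping theorem.\<close>

definition operator_spectrum ::
    "'a::topological_space set \<Rightarrow> (('a \<Rightarrow> complex) \<Rightarrow> 'a \<Rightarrow> complex) \<Rightarrow> complex set" where
  "operator_spectrum K L =
     {z. \<not> bij_betw (\<lambda>f. restrict (\<lambda>x. z * f x - L f x) K)
             (continuous_functions K) (continuous_functions K)}"

definition operator_spectral_radius ::
    "'a::topological_space set \<Rightarrow> (('a \<Rightarrow> complex) \<Rightarrow> 'a \<Rightarrow> complex) \<Rightarrow> real" where
  "operator_spectral_radius K L = (SUP z\<in>operator_spectrum K L. cmod z)"

definition holder_potentials ::
    "(real^'n) set \<Rightarrow> nat \<Rightarrow> (nat \<Rightarrow> real^'n \<Rightarrow> real^'n) \<Rightarrow> (nat \<Rightarrow> real^'n \<Rightarrow> real) \<Rightarrow> bool" where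
  "holder_potentials \<Omega> m \<phi> g \<longleftrightarrow>
     (\<exists>\<alpha>>0. \<forall>j\<in>{1..m}.
        (\<forall>x\<in>\<phi> j ` \<Omega>. 0 < g j x) \<and>
        (\<exists>C. \<forall>x\<in>\<phi> j ` \<Omega>. \<forall>y\<in>\<phi> j ` \<Omega>. \<bar>g j x - g j y\<bar> \<le> C * norm (x - y) powr \<alpha>))"

text \<open>Borel measures on \<open>K\<close> are viewed as Borel measures on the whole space that are concentrated
  on \<open>K\<close>. The equation \<open>L\<^sup>* \<nu> = R \<nu>\<close> is tested against continuous functions.\<close>

definition gibbs_measure ::
    "(real^'n) set \<Rightarrow> nat \<Rightarrow> (nat \<Rightarrow> real^'n \<Rightarrow> real^'n) \<Rightarrow> (real^'n) set \<Rightarrow>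
     (real^'n) measure \<Rightarrow> bool" where
  "gibbs_measure \<Omega> m \<phi> K \<mu> \<longleftrightarrow>
     (\<exists>g R h \<nu>.
        holder_potentials \<Omega> m \<phi> g \<and>
        R = operator_spectral_radius K (transfer_operator m \<phi> g) \<and>
        continuous_on K h \<and> (\<forall>x\<in>K. 0 < h x) \<and>
        (\<forall>x\<in>K. transfer_operator m \<phi> g h x = R * h x) \<and>
        sets \<nu> = sets borel \<and> emeasure \<nu> UNIV = 1 \<and> emeasure \<nu> (- K) = 0 \<and>
        (\<forall>f :: real^'n \<Rightarrow> real. continuous_on K f \<longrightarrow>
           (LINT x:K|\<nu>. transfer_operator m \<phi> g f x) = R * (LINT x:K|\<nu>. f x)) \<and>
        (LINT x:K|\<nu>. h x) = 1 \<and>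
        \<mu> = density \<nu> (\<lambda>x. ennreal (indicator K x * h x)))"


section \<open>Coding map and self-conformal systems\<close>

text \<open>Sequences start at index \<open>0\<close>: the symbol \<open>i\<^sub>n\<close> is \<open>i (n - 1)\<close>.\<close>

definition code_space :: "nat \<Rightarrow> (nat \<Rightarrow> nat) set" where
  "code_space m = {i. \<forall>n. i n \<in> {1..m}}"

primrec word_map :: "(nat \<Rightarrow> 'a \<Rightarrow> 'a) \<Rightarrow> (nat \<Rightarrow> nat) \<Rightarrow> nat \<Rightarrow> 'a \<Rightarrow> 'a" where
  "word_map \<phi> i 0 = id"
| "word_map \<phi> i (Suc n) = word_map \<phi> i n \<circ> \<phi> (i n)"

definition coding_map ::
    "(nat \<Rightarrow> 'a \<Rightarrow> 'a::topological_space) \<Rightarrow> 'a set \<Rightarrow> (nat \<Rightarrow> nat) \<Rightarrow> 'a" where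
  "coding_map \<phi> K i = (THE x. \<forall>x0\<in>K. (\<lambda>n. word_map \<phi> i n x0) \<longlonglongrightarrow> x)"

definition left_shift :: "(nat \<Rightarrow> nat) \<Rightarrow> nat \<Rightarrow> nat" where
  "left_shift i = (\<lambda>n. i (Suc n))"

definition codes_of ::
    "nat \<Rightarrow> (nat \<Rightarrow> 'a \<Rightarrow> 'a::topological_space) \<Rightarrow> 'a set \<Rightarrow> 'a \<Rightarrow> (nat \<Rightarrow> nat) set" where
  "codes_of m \<phi> K x = {i \<in> code_space m. coding_map \<phi> K i = x}"

definition uniquely_coded ::
    "nat \<Rightarrow> (nat \<Rightarrow> 'a \<Rightarrow> 'a::topological_space) \<Rightarrow> 'a set \<Rightarrow> 'a set" where
  "uniquely_coded m \<phi> K = {x \<in> K. card (codes_of m \<phi> K x) = 1}"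

definition induced_map ::
    "nat \<Rightarrow> (nat \<Rightarrow> 'a \<Rightarrow> 'a::topological_space) \<Rightarrow> 'a set \<Rightarrow> 'a \<Rightarrow> 'a" where
  "induced_map m \<phi> K x =
     (if x \<in> uniquely_coded m \<phi> K
      then coding_map \<phi> K (left_shift (the_elem (codes_of m \<phi> K x)))
      else x)"

definition self_conformal_system ::
    "nat \<Rightarrow> (nat \<Rightarrow> real^'n \<Rightarrow> real^'n) \<Rightarrow> (real^'n) set \<Rightarrow> (real^'n) measure \<Rightarrow>
     (real^'n \<Rightarrow> real^'n) \<Rightarrow> bool" where
  "self_conformal_system m \<phi> K \<mu> T \<longleftrightarrow>
     (\<exists>\<alpha> \<Omega>. conformal_ifs \<alpha> \<Omega> m \<phi> \<and> open_set_condition \<Omega> m \<phi> \<and>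
        self_conformal_set \<Omega> m \<phi> K \<and> gibbs_measure \<Omega> m \<phi> K \<mu>) \<and>
     T = induced_map m \<phi> K"

definition recurrence_set ::
    "'a::metric_space set \<Rightarrow> ('a \<Rightarrow> 'a) \<Rightarrow> (real \<Rightarrow> real) \<Rightarrow> 'a set" where
  "recurrence_set K T \<psi> = {x \<in> K. \<exists>\<^sub>\<infinity>n. (T ^^ n) x \<in> ball x (\<psi> (real n))}"

end

theory Submission
  imports Defs "HOL-Library.Sublist"
begin

text \<open>
  For a word \<open>w\<close> of length \<open>n\<close> let \<open>\<phi>\<^sub>w\<close> be the composition of the maps along \<open>w\<close>, call
  \<open>\<phi>\<^sub>w(K)\<close> the cylinder of \<open>w\<close>, and let \<open>L(w)\<close> be the factor by which \<open>\<phi>\<^sub>w\<close> changes the distance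
  of a chosen pair of points. The proof rests on three facts.

  Bounded distortion: on a compact invariant neighbourhood of the attractor, \<open>\<phi>\<^sub>w\<close> changes every
  distance by the factor \<open>L(w)\<close>, up to a constant that does not depend on \<open>w\<close>. For one map, the
  logarithm of the distance ratio of a pair differs from \<open>ln |\<phi>'|\<close> by at most a constant times a
  power of the distance of the pair (\<open>conformal_ratio_bound\<close>); along a word these errors form a
  geometric series (\<open>bounded_distortion_words\<close>).

  Quasi-invariance: Hausdorff measure scales under Lipschitz maps and \<open>\<mu>\<close> is comparable with it, so
  \<open>\<mu>(\<phi>\<^sub>w(A))\<close> is comparable with \<open>L(w)\<^sup>\<tau> \<mu>(A)\<close>. By the open set condition only boundedly many
  cylinders of size about \<open>r\<close> meet a ball of radius \<open>r\<close>. Hence balls centred on \<open>K\<close> have measure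
  comparable with \<open>r\<^sup>\<tau>\<close> (\<open>ball_lower\<close>, \<open>ball_upper\<close>). The same counting shows that cylinders of
  equal length overlap in null sets (\<open>P_overlap\<close>): each overlap increases the number of words
  through a point, and this number is bounded. So almost every point has exactly one code.

  Returns are shrinking targets: on the cylinder of \<open>w\<close> the iterate \<open>T\<^sup>n\<close> inverts \<open>\<phi>\<^sub>w\<close>, so
  \<open>x = \<phi>\<^sub>w(y)\<close> returns to its \<open>r\<close>-ball at time \<open>n\<close> if and only if \<open>|y - \<phi>\<^sub>w(y)| < r\<close>. As \<open>\<phi>\<^sub>w\<close> is
  a contraction, this confines \<open>y\<close> to a ball of radius comparable with \<open>r\<close>, and a smaller ball about
  the fixed point of \<open>\<phi>\<^sub>w\<close> consists of such points. Therefore the return has conditional measure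
  comparable with \<open>r\<^sup>\<tau>\<close> in every cylinder of length at most \<open>n\<close> (\<open>returning_upper\<close>,
  \<open>returning_lower\<close>).

  If the series converges, the Borel-Cantelli lemma finishes the proof. If it diverges, returns at
  times \<open>n < l\<close> are independent up to a constant and an error that decays geometrically in \<open>l - n\<close>
  (\<open>returning_pair_upper\<close>). A second moment estimate then shows that infinitely many returns occur
  on a fixed proportion of each cylinder (\<open>recurrent_cylinder_lower\<close>), and a set with this property
  has full measure (\<open>full_measure_if_dense_in_cylinders\<close>).

  These arguments need \<open>\<tau> > 0\<close>. A negative \<open>\<tau>\<close> would make the Hausdorff measure of \<open>K\<close> zero or
  infinite, and for \<open>\<tau> = 0\<close> the attractor is a single point, which \<open>T\<close> fixes.
\<close>

section \<open>Hausdorff measure of Lipschitz images and separated sets\<close>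

text \<open>A cover \<open>U\<^sub>k\<close> of \<open>A\<close> yields the cover \<open>f(U\<^sub>k \<inter> A)\<close> of the image; the intersection is taken
  because \<open>f\<close> is controlled on \<open>A\<close> only.\<close>

lemma hausdorff_premeasure_lipschitz_image:
  fixes f :: "'a::metric_space \<Rightarrow> 'b::metric_space"
  assumes s: "0 < s" and l: "0 < l"
    and lip: "\<And>x y. x \<in> A \<Longrightarrow> y \<in> A \<Longrightarrow> dist (f x) (f y) \<le> l * dist x y"
  shows "hausdorff_premeasure s (l * \<delta>) (f ` A) \<le> ennreal (l powr s) * hausdorff_premeasure s \<delta> A"
proof -
  let ?P = "hausdorff_premeasure s (l * \<delta>) (f ` A)"
  have "ennreal (l powr (- s)) * ?P \<le> hausdorff_premeasure s \<delta> A"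
    unfolding hausdorff_premeasure_def[of s \<delta> A]
  proof (rule Inf_greatest, clarify)
    fix U :: "nat \<Rightarrow> 'a set"
    assume cover: "A \<subseteq> (\<Union>k. U k)" and U: "\<forall>k. bounded (U k) \<and> diameter (U k) \<le> \<delta>"
    define W where "W k = f ` (U k \<inter> A)" for k
    have bdd: "bounded (U k)" for k using U by auto
    have dist_W: "dist p q \<le> l * diameter (U k)" if "p \<in> W k" "q \<in> W k" for p q k
    proof -
      obtain x y where xy: "p = f x" "q = f y" "x \<in> U k" "y \<in> U k" "x \<in> A" "y \<in> A"
        using \<open>p \<in> W k\<close> \<open>q \<in> W k\<close> unfolding W_def by auto
      have "dist p q \<le> l * dist x y" using lip xy by auto
      also have "\<dots> \<le> l * diameter (U k)"
        using diameter_bounded_bound[OF bdd xy(3,4)] l by auto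
      finally show ?thesis .
    qed
    have bdd_W: "bounded (W k)" for k
      unfolding bounded_two_points using dist_W by blast
    have diam_W: "diameter (W k) \<le> l * diameter (U k)" for k
    proof (cases "W k = {}")
      case True
      then show ?thesis using diameter_ge_0[OF bdd[of k]] l by (simp add: diameter_empty)
    next
      case False
      then have "(SUP (x, y)\<in>W k \<times> W k. dist x y) \<le> l * diameter (U k)"
        using dist_W by (intro cSUP_least) auto
      then show ?thesis using False by (simp add: diameter_def[of "W k"])
    qed
    have weight: "hausdorff_weight s (W k) \<le> ennreal (l powr s) * hausdorff_weight s (U k)" for k
    proof (cases "W k = {}")
      case True
      then show ?thesis by (simp add: hausdorff_weight_def)
    next
      case False
      then have ne: "U k \<noteq> {}" by (auto simp: W_def)
      have "diameter (W k) powr s \<le> (l * diameter (U k)) powr s"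
        using diam_W[of k] s diameter_ge_0[OF bdd_W[of k]] by (intro powr_mono2) auto
      also have "\<dots> = l powr s * diameter (U k) powr s"
        using l diameter_ge_0[OF bdd[of k]] by (intro powr_mult)
      finally show ?thesis
        using s False ne by (simp add: hausdorff_weight_def ennreal_mult[symmetric])
    qed
    have "f ` A \<subseteq> (\<Union>k. W k)" using cover by (fastforce simp: W_def)
    moreover have "bounded (W k) \<and> diameter (W k) \<le> l * \<delta>" for k
      using bdd_W diam_W[of k] U l by (meson mult_left_mono less_imp_le order_trans)
    ultimately have "?P \<le> (\<Sum>k. hausdorff_weight s (W k))"
      unfolding hausdorff_premeasure_def by (intro Inf_lower) blast
    also have "\<dots> \<le> (\<Sum>k. ennreal (l powr s) * hausdorff_weight s (U k))"
      by (intro suminf_le weight) auto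
    finally have le: "?P \<le> ennreal (l powr s) * (\<Sum>k. hausdorff_weight s (U k))"
      by simp
    have "ennreal (l powr (- s)) * ?P
        \<le> ennreal (l powr (- s)) * (ennreal (l powr s) * (\<Sum>k. hausdorff_weight s (U k)))"
      by (intro mult_left_mono le) simp
    also have "\<dots> = (\<Sum>k. hausdorff_weight s (U k))"
      using l by (simp add: mult.assoc[symmetric] ennreal_mult[symmetric] powr_add[symmetric]
          del: ennreal_suminf_cmult)
    finally show "ennreal (l powr (- s)) * ?P \<le> (\<Sum>k. hausdorff_weight s (U k))" .
  qed
  then have "ennreal (l powr s) * (ennreal (l powr (- s)) * ?P)
      \<le> ennreal (l powr s) * hausdorff_premeasure s \<delta> A"
    by (intro mult_left_mono) auto
  moreover have "ennreal (l powr s) * (ennreal (l powr (- s)) * ?P) = ?P"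
    using l by (simp add: mult.assoc[symmetric] ennreal_mult[symmetric] powr_add[symmetric])
  ultimately show ?thesis by simp
qed

lemma hausdorff_measure_lipschitz_image:
  fixes f :: "'a::metric_space \<Rightarrow> 'b::metric_space"
  assumes s: "0 < s" and l: "0 < l"
    and lip: "\<And>x y. x \<in> A \<Longrightarrow> y \<in> A \<Longrightarrow> dist (f x) (f y) \<le> l * dist x y"
  shows "hausdorff_measure s (f ` A) \<le> ennreal (l powr s) * hausdorff_measure s A"
  unfolding hausdorff_measure_def[of s "f ` A"]
proof (rule SUP_least)
  fix \<delta> :: real assume "\<delta> \<in> {0<..}"
  then have pos: "\<delta> / l \<in> {0<..}" using l by simp
  have "hausdorff_premeasure s \<delta> (f ` A) = hausdorff_premeasure s (l * (\<delta> / l)) (f ` A)"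
    using l by simp
  also have "\<dots> \<le> ennreal (l powr s) * hausdorff_premeasure s (\<delta> / l) A"
    by (rule hausdorff_premeasure_lipschitz_image[OF s l lip])
  also have "\<dots> \<le> ennreal (l powr s) * hausdorff_measure s A"
    unfolding hausdorff_measure_def by (intro mult_left_mono SUP_upper pos) simp
  finally show "hausdorff_premeasure s \<delta> (f ` A) \<le> ennreal (l powr s) * hausdorff_measure s A" .
qed

lemma hausdorff_measure_0_singleton: "1 \<le> hausdorff_measure 0 {x}"
proof -
  have "1 \<le> hausdorff_premeasure 0 1 {x}"
    unfolding hausdorff_premeasure_def
  proof (rule Inf_greatest, clarify)
    fix U :: "nat \<Rightarrow> 'a set" assume "{x} \<subseteq> (\<Union>k. U k)"
    then obtain k where "x \<in> U k" by auto
    then have "1 = hausdorff_weight 0 (U k)" by (auto simp: hausdorff_weight_def)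
    also have "\<dots> \<le> (\<Sum>k. hausdorff_weight 0 (U k))"
      using sum_le_suminf[of "\<lambda>k. hausdorff_weight 0 (U k)" "{k}"] by simp
    finally show "1 \<le> (\<Sum>k. hausdorff_weight 0 (U k))" .
  qed
  also have "\<dots> \<le> hausdorff_measure 0 {x}"
    unfolding hausdorff_measure_def by (rule SUP_upper) simp
  finally show ?thesis .
qed

text \<open>For a negative exponent a set of diameter at most \<open>\<delta>\<close> is either a point, which costs nothing, or
  costs at least \<open>\<delta>\<^sup>s\<close>, which is unbounded as \<open>\<delta>\<close> tends to zero. So the measure is finite only
  on countable sets, and zero on points.\<close>

lemma hausdorff_measure_negative_singleton:
  assumes "s < 0" shows "hausdorff_measure s {x} = 0"
proof -
  have "hausdorff_premeasure s \<delta> {x} = 0" if "0 < \<delta>" for \<delta>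
  proof -
    have "hausdorff_premeasure s \<delta> {x} \<le> (\<Sum>k::nat. hausdorff_weight s {x})"
      unfolding hausdorff_premeasure_def using that by (intro Inf_lower) fastforce
    also have "\<dots> = 0" using assms by (simp add: hausdorff_weight_def)
    finally show ?thesis by simp
  qed
  then show ?thesis unfolding hausdorff_measure_def by (simp add: SUP_eq_const)
qed

lemma countable_if_hausdorff_measure_negative_finite:
  assumes s: "s < 0" and fin: "hausdorff_measure s A < \<infinity>"
  shows "countable A"
proof -
  obtain B where B: "0 < B" "hausdorff_measure s A < ennreal B"
  proof -
    obtain r where "0 \<le> r" "hausdorff_measure s A = ennreal r"
      using fin by (cases "hausdorff_measure s A") auto
    then show ?thesis using that[of "r + 1"] by (simp add: ennreal_less_iff)
  qed
  \<comment> \<open>so that one set of positive diameter at most \<open>\<delta>\<close> already costs \<open>B\<close>\<close>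
  define \<delta> where "\<delta> = B powr (1 / s)"
  have \<delta>: "0 < \<delta>" "\<delta> powr s = B" using B s by (auto simp: \<delta>_def powr_powr)
  have "hausdorff_premeasure s \<delta> A \<le> hausdorff_measure s A"
    unfolding hausdorff_measure_def using \<delta> by (intro SUP_upper) simp
  then have "hausdorff_premeasure s \<delta> A < ennreal B" using B by simp
  then obtain U :: "nat \<Rightarrow> 'a set" where U: "A \<subseteq> (\<Union>k. U k)"
      "\<And>k. bounded (U k)" "\<And>k. diameter (U k) \<le> \<delta>" "(\<Sum>k. hausdorff_weight s (U k)) < ennreal B"
    unfolding hausdorff_premeasure_def Inf_less_iff by auto
  have "countable (U k)" for k
  proof -
    have "diameter (U k) = 0"
    proof (rule ccontr)
      assume "diameter (U k) \<noteq> 0"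
      then have pos: "0 < diameter (U k)" using diameter_ge_0[OF U(2)[of k]] by simp
      then have "U k \<noteq> {}" by auto
      have "B \<le> diameter (U k) powr s"
        unfolding \<delta>(2)[symmetric] using U(3)[of k] pos s by (intro powr_mono2') auto
      then have "ennreal B \<le> hausdorff_weight s (U k)"
        using \<open>U k \<noteq> {}\<close> s by (simp add: hausdorff_weight_def ennreal_leI)
      also have "\<dots> \<le> (\<Sum>k. hausdorff_weight s (U k))"
        using sum_le_suminf[of "\<lambda>k. hausdorff_weight s (U k)" "{k}"] by simp
      finally show False using U(4) by simp
    qed
    then have "x = y" if "x \<in> U k" "y \<in> U k" for x y
      using diameter_bounded_bound[OF U(2) that] by simp
    then have "U k = {} \<or> (\<exists>x. U k = {x})" by blast
    then show ?thesis by auto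
  qed
  then show ?thesis using U(1) by (meson countable_UN countable_subset uncountable_def UNIV_I countableI_type)
qed

text \<open>Rescaled by \<open>1 / r\<close>, this is the total boundedness of the ball of radius \<open>R\<close> about the origin.\<close>

lemma card_separated_le:
  fixes R c :: real
  assumes "0 < c"
  obtains M :: nat where
    "\<And>(x::'a::euclidean_space) r S. 0 < r \<Longrightarrow> S \<subseteq> cball x (R * r) \<Longrightarrow>
      (\<And>p q. p \<in> S \<Longrightarrow> q \<in> S \<Longrightarrow> p \<noteq> q \<Longrightarrow> c * r \<le> dist p q) \<Longrightarrow> finite S \<and> card S \<le> M"
proof -
  have "compact (cball (0::'a) R)" by simp
  then obtain T where T: "finite T" "cball (0::'a) R \<subseteq> (\<Union>t\<in>T. ball t (c / 2))"
    using assms unfolding compact_eq_totally_bounded by (meson half_gt_zero)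
  have "finite S \<and> card S \<le> card T"
    if r: "0 < r" and S: "S \<subseteq> cball x (R * r)"
      and sep: "\<And>p q. p \<in> S \<Longrightarrow> q \<in> S \<Longrightarrow> p \<noteq> q \<Longrightarrow> c * r \<le> dist p q" for x :: 'a and r S
  proof -
    define e where "e p = (1 / r) *\<^sub>R (p - x)" for p
    have e_dist: "dist (e p) (e q) = dist p q / r" for p q
    proof -
      have "e p - e q = (1 / r) *\<^sub>R (p - q)" by (simp add: e_def algebra_simps)
      then show ?thesis using r by (simp add: dist_norm divide_inverse mult.commute)
    qed
    have "\<exists>t\<in>T. e p \<in> ball t (c / 2)" if "p \<in> S" for p
    proof -
      have "dist x p \<le> R * r" using S that by auto
      then have "norm (e p) \<le> R"
        using r by (simp add: e_def dist_norm norm_minus_commute divide_simps mult.commute)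
      then have "e p \<in> cball 0 R" by simp
      then show ?thesis using T(2) by blast
    qed
    then obtain t where t: "\<And>p. p \<in> S \<Longrightarrow> t p \<in> T" "\<And>p. p \<in> S \<Longrightarrow> e p \<in> ball (t p) (c / 2)"
      by metis
    have "inj_on t S"
    proof (rule inj_onI, rule ccontr)
      fix p q assume pq: "p \<in> S" "q \<in> S" "t p = t q" "p \<noteq> q"
      have "dist (e p) (e q) < c"
        using t(2)[OF pq(1)] t(2)[OF pq(2)] pq(3)
        by (metis dist_commute dist_triangle_half_l mem_ball)
      moreover have "c \<le> dist (e p) (e q)"
        using sep[OF pq(1,2,4)] r by (simp add: e_dist divide_simps)
      ultimately show False by simp
    qed
    moreover have "t ` S \<subseteq> T" using t(1) by auto
    ultimately show ?thesis using T(1) by (meson card_inj_on_le inj_on_finite)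
  qed
  then show ?thesis using that by blast
qed

section \<open>Words and codes\<close>

(* Keeps the simplifier from turning {1..m} into {Suc 0..m}. *)
declare One_nat_def [simp del]

text \<open>The recursion peels off the map that is applied last. Inductions on words thus see the
  contraction and the distortion of one more map acting on an already contracted pair.\<close>

primrec compose_word :: "(nat \<Rightarrow> 'a \<Rightarrow> 'a) \<Rightarrow> nat list \<Rightarrow> 'a \<Rightarrow> 'a" where
  "compose_word \<phi> [] = id"
| "compose_word \<phi> (j # w) = \<phi> j \<circ> compose_word \<phi> w"

lemma compose_word_append: "compose_word \<phi> (v @ w) = compose_word \<phi> v \<circ> compose_word \<phi> w"
  by (induction v) (auto simp: comp_assoc)

lemma compose_word_in:
  assumes "\<And>j x. j \<in> J \<Longrightarrow> x \<in> Q \<Longrightarrow> \<phi> j x \<in> Q" and "w \<in> lists J" "x \<in> Q"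
  shows "compose_word \<phi> w x \<in> Q"
  using assms(2) by (induction w rule: list.induct) (use assms(1,3) in auto)

lemma compose_word_inj_on:
  assumes maps: "\<And>j x. j \<in> J \<Longrightarrow> x \<in> Q \<Longrightarrow> \<phi> j x \<in> Q"
    and inj: "\<And>j. j \<in> J \<Longrightarrow> inj_on (\<phi> j) Q" and w: "w \<in> lists J"
  shows "inj_on (compose_word \<phi> w) Q"
  using w
proof (induction w rule: list.induct)
  case (Cons j w)
  then have "inj_on (compose_word \<phi> w) Q" "inj_on (\<phi> j) Q" using inj by auto
  moreover have "compose_word \<phi> w ` Q \<subseteq> Q" using compose_word_in[of J Q \<phi> w, OF maps] Cons.prems by auto
  ultimately show ?case by (simp add: comp_inj_on inj_on_subset del: o_apply)
qed simp

lemma compose_word_contraction: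
  fixes \<phi> :: "nat \<Rightarrow> 'a::metric_space \<Rightarrow> 'a"
  assumes maps: "\<And>j x. j \<in> J \<Longrightarrow> x \<in> Q \<Longrightarrow> \<phi> j x \<in> Q" and c: "0 \<le> c"
    and contr: "\<And>j x y. j \<in> J \<Longrightarrow> x \<in> Q \<Longrightarrow> y \<in> Q \<Longrightarrow> dist (\<phi> j x) (\<phi> j y) \<le> c * dist x y"
    and w: "w \<in> lists J" and xy: "x \<in> Q" "y \<in> Q"
  shows "dist (compose_word \<phi> w x) (compose_word \<phi> w y) \<le> c ^ length w * dist x y"
  using w
proof (induction w rule: list.induct)
  case (Cons j w)
  then have w: "w \<in> lists J" "j \<in> J" by auto
  have "dist (compose_word \<phi> (j # w) x) (compose_word \<phi> (j # w) y)
      \<le> c * dist (compose_word \<phi> w x) (compose_word \<phi> w y)"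
    using contr[OF w(2)] compose_word_in[of J Q \<phi> w, OF maps w(1)] xy by simp
  also have "\<dots> \<le> c * (c ^ length w * dist x y)"
    using Cons.IH[OF w(1)] c by (intro mult_left_mono)
  finally show ?case by simp
qed simp

lemma compose_word_continuous_on:
  fixes \<phi> :: "nat \<Rightarrow> 'a::metric_space \<Rightarrow> 'a"
  assumes maps: "\<And>j x. j \<in> J \<Longrightarrow> x \<in> Q \<Longrightarrow> \<phi> j x \<in> Q" and c: "0 \<le> c"
    and contr: "\<And>j x y. j \<in> J \<Longrightarrow> x \<in> Q \<Longrightarrow> y \<in> Q \<Longrightarrow> dist (\<phi> j x) (\<phi> j y) \<le> c * dist x y"
    and w: "w \<in> lists J"
  shows "continuous_on Q (compose_word \<phi> w)"
  by (rule lipschitz_on_continuous_on[OF lipschitz_onI, where L = "c ^ length w"])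
    (use compose_word_contraction[of J Q \<phi>, OF maps c contr w] c in auto)

definition code_prefix :: "(nat \<Rightarrow> nat) \<Rightarrow> nat \<Rightarrow> nat list" where
  "code_prefix i n = map i [0..<n]"

lemma length_code_prefix [simp]: "length (code_prefix i n) = n"
  by (simp add: code_prefix_def)

lemma code_prefix_0 [simp]: "code_prefix i 0 = []"
  by (simp add: code_prefix_def)

lemma code_prefix_Suc: "code_prefix i (Suc n) = code_prefix i n @ [i n]"
  by (simp add: code_prefix_def)

lemma take_code_prefix: "k \<le> n \<Longrightarrow> take k (code_prefix i n) = code_prefix i k"
  by (simp add: code_prefix_def take_map)

lemma code_prefix_in_lists: "i \<in> code_space m \<Longrightarrow> code_prefix i n \<in> lists {1..m}"
  by (auto simp: code_prefix_def code_space_def)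

lemma word_map_eq_compose_word: "word_map \<phi> i n = compose_word \<phi> (code_prefix i n)"
  by (induction n) (auto simp: code_prefix_Suc compose_word_append)

lemma code_eqI:
  assumes "\<And>n. code_prefix i n = code_prefix i' n"
  shows "i = i'"
proof
  fix n show "i n = i' n" using assms[of "Suc n"] by (auto simp: code_prefix_Suc)
qed

definition words :: "nat \<Rightarrow> nat \<Rightarrow> nat list set" where
  "words m n = {w \<in> lists {1..m}. length w = n}"

lemma finite_words: "finite (words m n)"
proof -
  have "words m n = {w. set w \<subseteq> {1..m} \<and> length w = n}" by (auto simp: words_def lists_eq_set)
  then show ?thesis using finite_lists_length_eq[of "{1..m}" n] by simp
qed

lemma words_Suc: "words m (Suc n) = (\<lambda>(w, j). w @ [j]) ` (words m n \<times> {1..m})"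
proof (intro equalityI subsetI)
  fix w assume "w \<in> words m (Suc n)"
  then show "w \<in> (\<lambda>(w, j). w @ [j]) ` (words m n \<times> {1..m})"
    by (cases w rule: rev_cases) (force simp: words_def)+
qed (auto simp: words_def)

section \<open>Iterated function systems with bounded distortion\<close>

text \<open>What remains of a conformal system with the open set condition once derivatives are forgotten.
  The set \<open>Q\<close> is invariant and contains the attractor. The distortion assumption says that a word
  map changes all distances in \<open>Q\<close> by the same factor up to \<open>D\<close>, and the pair \<open>a\<close>, \<open>b\<close> serves to
  measure this factor. The images of \<open>v\<close> under incomparable words are separated in proportion to
  it, which is the form in which the open set condition enters.\<close>

locale distortion_ifs =
  fixes \<phi> :: "nat \<Rightarrow> 'a::euclidean_space \<Rightarrow> 'a" and m :: nat and K Q :: "'a set"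
    and c D \<kappa> :: real and a b v :: 'a
  assumes K_compact: "compact K" and K_nonempty: "K \<noteq> {}" and K_subset: "K \<subseteq> Q"
    and K_eq: "K = (\<Union>j\<in>{1..m}. \<phi> j ` K)"
    and Q_bounded: "bounded Q"
    and maps_Q: "j \<in> {1..m} \<Longrightarrow> x \<in> Q \<Longrightarrow> \<phi> j x \<in> Q"
    and c_pos: "0 < c" and c_less: "c < 1"
    and contraction: "j \<in> {1..m} \<Longrightarrow> x \<in> Q \<Longrightarrow> y \<in> Q \<Longrightarrow> dist (\<phi> j x) (\<phi> j y) \<le> c * dist x y"
    and inj: "j \<in> {1..m} \<Longrightarrow> inj_on (\<phi> j) Q"
    and distortion: "w \<in> lists {1..m} \<Longrightarrow> x \<in> Q \<Longrightarrow> y \<in> Q \<Longrightarrow> x' \<in> Q \<Longrightarrow> y' \<in> Q \<Longrightarrow>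
        dist (compose_word \<phi> w x) (compose_word \<phi> w y) * dist x' y'
          \<le> D * dist (compose_word \<phi> w x') (compose_word \<phi> w y') * dist x y"
    and a_in: "a \<in> Q" and b_in: "b \<in> Q" and a_neq_b: "a \<noteq> b"
    and v_in: "v \<in> Q" and \<kappa>_pos: "0 < \<kappa>"
    and separation: "w \<in> lists {1..m} \<Longrightarrow> w' \<in> lists {1..m} \<Longrightarrow> \<not> prefix w w' \<Longrightarrow> \<not> prefix w' w \<Longrightarrow>
        \<kappa> * dist (compose_word \<phi> w a) (compose_word \<phi> w b)
          \<le> dist (compose_word \<phi> w v) (compose_word \<phi> w' v)"
begin

abbreviation W :: "nat list set" where "W \<equiv> lists {1..m}"

abbreviation f :: "nat list \<Rightarrow> 'a \<Rightarrow> 'a" where "f \<equiv> compose_word \<phi>"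

definition L :: "nat list \<Rightarrow> real" where
  "L w = dist (f w a) (f w b) / dist a b"

lemma f_Q: "w \<in> W \<Longrightarrow> x \<in> Q \<Longrightarrow> f w x \<in> Q"
  by (rule compose_word_in[of "{1..m}" Q \<phi>, OF maps_Q])

lemma phi_K: "j \<in> {1..m} \<Longrightarrow> x \<in> K \<Longrightarrow> \<phi> j x \<in> K"
  using K_eq by blast

lemma f_K: "w \<in> W \<Longrightarrow> x \<in> K \<Longrightarrow> f w x \<in> K"
  by (induction w) (auto intro: phi_K simp del: UN_simps)

lemma f_inj: "w \<in> W \<Longrightarrow> inj_on (f w) Q"
  by (rule compose_word_inj_on[of "{1..m}" Q \<phi>, OF maps_Q inj])

lemma f_contraction:
  "w \<in> W \<Longrightarrow> x \<in> Q \<Longrightarrow> y \<in> Q \<Longrightarrow> dist (f w x) (f w y) \<le> c ^ length w * dist x y"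
  by (rule compose_word_contraction[of "{1..m}" Q \<phi>, OF maps_Q less_imp_le[OF c_pos] contraction])

lemma dist_ab_pos: "0 < dist a b" using a_neq_b by simp

lemma L_Nil [simp]: "L [] = 1" using a_neq_b by (simp add: L_def)

lemma L_pos: assumes "w \<in> W" shows "0 < L w"
proof -
  have "f w a \<noteq> f w b" using f_inj[OF assms] a_in b_in a_neq_b by (auto simp: inj_on_def)
  then show ?thesis using a_neq_b by (simp add: L_def)
qed

lemma D_ge_1: "1 \<le> D"
proof -
  have "dist a b * dist a b \<le> D * dist a b * dist a b"
    using distortion[of "[]" a b a b] a_in b_in by simp
  then show ?thesis using dist_ab_pos by (simp add: mult.assoc)
qed

lemma dist_f_ab: "dist (f w a) (f w b) = L w * dist a b"
  using dist_ab_pos by (simp add: L_def)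

lemma f_upper:
  assumes "w \<in> W" "x \<in> Q" "y \<in> Q"
  shows "dist (f w x) (f w y) \<le> D * L w * dist x y"
proof -
  have "dist (f w x) (f w y) * dist a b \<le> D * L w * dist x y * dist a b"
    using distortion[OF assms a_in b_in] by (simp add: dist_f_ab mult_ac)
  then show ?thesis using dist_ab_pos by simp
qed

lemma f_lower:
  assumes "w \<in> W" "x \<in> Q" "y \<in> Q"
  shows "L w * dist x y \<le> D * dist (f w x) (f w y)"
proof -
  have "L w * dist x y * dist a b \<le> D * dist (f w x) (f w y) * dist a b"
    using distortion[OF assms(1) a_in b_in assms(2,3)] by (simp add: dist_f_ab mult_ac)
  then show ?thesis using dist_ab_pos by simp
qed

lemma L_append_upper:
  assumes "u \<in> W" "w \<in> W" shows "L (u @ w) \<le> D * L u * L w"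
proof -
  have "L (u @ w) * dist a b \<le> D * L u * L w * dist a b"
    using f_upper[OF assms(1), of "f w a" "f w b"] f_Q[OF assms(2)] a_in b_in
    by (simp add: dist_f_ab[symmetric] compose_word_append mult.assoc)
  then show ?thesis using dist_ab_pos by simp
qed

lemma L_append_lower:
  assumes "u \<in> W" "w \<in> W" shows "L u * L w \<le> D * L (u @ w)"
proof -
  have "L u * L w * dist a b \<le> D * L (u @ w) * dist a b"
    using f_lower[OF assms(1), of "f w a" "f w b"] f_Q[OF assms(2)] a_in b_in
    by (simp add: dist_f_ab[symmetric] compose_word_append mult.assoc)
  then show ?thesis using dist_ab_pos by simp
qed

lemma L_le_power: "w \<in> W \<Longrightarrow> L w \<le> c ^ length w"
  using f_contraction[of w a b] a_in b_in dist_ab_pos by (simp add: dist_f_ab)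

lemma f_continuous: "w \<in> W \<Longrightarrow> continuous_on K (f w)"
  by (rule continuous_on_subset[OF compose_word_continuous_on[of "{1..m}" Q \<phi>, OF maps_Q less_imp_le[OF c_pos] contraction] K_subset])

lemma f_image_compact: "w \<in> W \<Longrightarrow> compact A \<Longrightarrow> A \<subseteq> K \<Longrightarrow> compact (f w ` A)"
  using f_continuous continuous_on_subset compact_continuous_image by metis

lemma f_image_append_subset: "w \<in> W \<Longrightarrow> f (u @ w) ` K \<subseteq> f u ` K"
  using f_K by (auto simp: compose_word_append)

lemma f_image_prefix_subset:
  assumes "w \<in> W" "prefix u w" shows "f w ` K \<subseteq> f u ` K"
proof -
  obtain u' where "w = u @ u'" using assms(2) by (auto simp: prefix_def)
  moreover from this have "u' \<in> W" using assms(1) by simp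
  ultimately show ?thesis using f_image_append_subset by simp
qed

definition diamQ :: real where "diamQ = diameter Q + 1"

lemma diamQ_pos: "0 < diamQ" using diameter_ge_0[OF Q_bounded] by (simp add: diamQ_def)

lemma dist_le_diamQ: "x \<in> Q \<Longrightarrow> y \<in> Q \<Longrightarrow> dist x y \<le> diamQ"
  using diameter_bounded_bound[OF Q_bounded] by (fastforce simp: diamQ_def)

lemma dist_f_le_diamQ:
  assumes "w \<in> W" "x \<in> Q" "y \<in> Q"
  shows "dist (f w x) (f w y) \<le> c ^ length w * diamQ"
proof -
  have "dist (f w x) (f w y) \<le> c ^ length w * dist x y" using assms by (rule f_contraction)
  also have "\<dots> \<le> c ^ length w * diamQ"
    using assms c_pos by (intro mult_left_mono dist_le_diamQ) auto
  finally show ?thesis .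
qed

lemma c_powr_vanishes: "0 < e \<Longrightarrow> \<exists>n. c ^ n * B < e" for B e :: real
proof -
  assume "0 < e"
  have "(\<lambda>n. c ^ n * B) \<longlonglongrightarrow> 0 * B"
    using c_pos c_less by (intro tendsto_mult LIMSEQ_realpow_zero tendsto_const) auto
  then have "\<forall>\<^sub>F n in sequentially. c ^ n * B < e"
    using \<open>0 < e\<close> by (intro order_tendstoD(2)[of _ "0 * B"]) auto
  then show ?thesis by (auto simp: eventually_sequentially)
qed

lemma exists_code:
  assumes "x \<in> K"
  obtains i where "i \<in> code_space m" "\<And>n. x \<in> f (code_prefix i n) ` K"
proof -
  have "\<forall>x\<in>K. \<exists>p. fst p \<in> {1..m} \<and> snd p \<in> K \<and> x = \<phi> (fst p) (snd p)"
    using K_eq by fastforce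
  then obtain p where p: "\<And>x. x \<in> K \<Longrightarrow> fst (p x) \<in> {1..m} \<and> snd (p x) \<in> K \<and> x = \<phi> (fst (p x)) (snd (p x))"
    by metis
  define y where "y n = ((snd \<circ> p) ^^ n) x" for n
  define i where "i n = fst (p (y n))" for n
  have y: "y n \<in> K" for n
    by (induction n) (use p assms in \<open>auto simp: y_def\<close>)
  have step: "y n = \<phi> (i n) (y (Suc n))" for n
    using p[OF y[of n]] by (auto simp: i_def y_def)
  have "i \<in> code_space m" using p[OF y] by (auto simp: code_space_def i_def)
  moreover have "x = f (code_prefix i n) (y n)" for n
  proof (induction n)
    case (Suc n)
    then show ?case using step[of n] by (simp add: code_prefix_Suc compose_word_append)
  qed (simp add: y_def)
  ultimately show ?thesis using that y by blast
qed

lemma coding_map_eqI: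
  assumes i: "i \<in> code_space m" and x: "\<And>n. x \<in> f (code_prefix i n) ` K"
  shows "coding_map \<phi> K i = x"
  unfolding coding_map_def
proof (rule the_equality)
  show *: "\<forall>x0\<in>K. (\<lambda>n. word_map \<phi> i n x0) \<longlonglongrightarrow> x"
  proof
    fix x0 assume x0: "x0 \<in> K"
    have bound: "dist (word_map \<phi> i n x0) x \<le> c ^ n * diamQ" for n
    proof -
      obtain y where y: "y \<in> K" "x = f (code_prefix i n) y" using x by auto
      then show ?thesis
        using dist_f_le_diamQ[OF code_prefix_in_lists[OF i, of n], of x0 y] x0 K_subset
        by (auto simp: word_map_eq_compose_word)
    qed
    have "(\<lambda>n. c ^ n * diamQ) \<longlonglongrightarrow> 0 * diamQ"
      using c_pos c_less by (intro tendsto_mult LIMSEQ_realpow_zero tendsto_const) auto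
    then have "(\<lambda>n. dist (word_map \<phi> i n x0) x) \<longlonglongrightarrow> 0"
      using bound by (auto intro!: always_eventually elim: Lim_null_comparison[rotated])
    then show "(\<lambda>n. word_map \<phi> i n x0) \<longlonglongrightarrow> x"
      by (rule iffD2[OF tendsto_dist_iff])
  qed
  fix z assume "\<forall>x0\<in>K. (\<lambda>n. word_map \<phi> i n x0) \<longlonglongrightarrow> z"
  then show "z = x" using * K_nonempty LIMSEQ_unique by blast
qed

text \<open>The cylinders along a code are nested nonempty compact sets whose diameters tend to zero; the
  limit that defines the coding map is their common point.\<close>

lemma coding_map_iff:
  assumes i: "i \<in> code_space m"
  shows "coding_map \<phi> K i = x \<longleftrightarrow> (\<forall>n. x \<in> f (code_prefix i n) ` K)"
proof
  have W: "code_prefix i n \<in> W" for n using code_prefix_in_lists[OF i] .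
  have "\<Inter> (range (\<lambda>n. f (code_prefix i n) ` K)) \<noteq> {}"
  proof (rule compact_nest)
    show "compact (f (code_prefix i n) ` K)" for n using f_image_compact[OF W K_compact] by simp
    show "f (code_prefix i n) ` K \<noteq> {}" for n using K_nonempty by simp
    show "f (code_prefix i n) ` K \<subseteq> f (code_prefix i k) ` K" if "k \<le> n" for k n
      using f_image_prefix_subset[OF W, of "code_prefix i k" n] take_code_prefix[OF that, of i]
        take_is_prefix[of k "code_prefix i n"] by simp
  qed
  then obtain z where z: "\<And>n. z \<in> f (code_prefix i n) ` K" by blast
  assume "coding_map \<phi> K i = x"
  then have "x = z" using coding_map_eqI[OF i z] by simp
  then show "\<forall>n. x \<in> f (code_prefix i n) ` K" using z by simp
qed (use coding_map_eqI[OF i] in blast)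

lemma codes_of_eq: "codes_of m \<phi> K x = {i \<in> code_space m. \<forall>n. x \<in> f (code_prefix i n) ` K}"
  unfolding codes_of_def using coding_map_iff by blast

lemma extend_to_code:
  assumes w: "w \<in> W" and x: "x \<in> f w ` K"
  obtains i where "i \<in> codes_of m \<phi> K x" "code_prefix i (length w) = w"
proof -
  obtain y where y: "y \<in> K" "x = f w y" using x by auto
  obtain k where k: "k \<in> code_space m" "\<And>n. y \<in> f (code_prefix k n) ` K"
    using exists_code[OF y(1)] by metis
  define i where "i n = (if n < length w then w ! n else k (n - length w))" for n
  have i: "i \<in> code_space m"
    using w k by (fastforce simp: code_space_def i_def in_lists_conv_set)
  have long: "code_prefix i (length w + n) = w @ code_prefix k n" for n
    by (rule nth_equalityI) (auto simp: code_prefix_def i_def nth_append)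
  have "x \<in> f (code_prefix i n) ` K" for n
  proof -
    have "x \<in> f (code_prefix i (length w + n)) ` K"
      using k(2)[of n] y by (auto simp: long compose_word_append)
    moreover have "prefix (code_prefix i n) (code_prefix i (length w + n))"
      using take_code_prefix[of n "length w + n" i] take_is_prefix by (metis le_add2)
    ultimately show ?thesis
      using f_image_prefix_subset[OF code_prefix_in_lists[OF i]] by blast
  qed
  then have "i \<in> codes_of m \<phi> K x" using i by (simp add: codes_of_eq)
  then show ?thesis using that long[of 0] by simp
qed

text \<open>The points with exactly one code, described without codes: at each length only one word has a
  cylinder through the point. Every word through a point extends to a code, which makes the two
  descriptions agree.\<close>

definition G :: "'a set" where
  "G = {x \<in> K. \<forall>n. \<forall>w\<in>words m n. \<forall>w'\<in>words m n. x \<in> f w ` K \<longrightarrow> x \<in> f w' ` K \<longrightarrow> w = w'}"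

lemma G_D:
  "x \<in> G \<Longrightarrow> w \<in> W \<Longrightarrow> w' \<in> W \<Longrightarrow> length w = length w' \<Longrightarrow> x \<in> f w ` K \<Longrightarrow> x \<in> f w' ` K \<Longrightarrow> w = w'"
  by (auto simp: G_def words_def)

lemma uniquely_coded_eq: "uniquely_coded m \<phi> K = G"
proof (intro equalityI subsetI)
  fix x assume "x \<in> uniquely_coded m \<phi> K"
  then obtain i where x: "x \<in> K" "codes_of m \<phi> K x = {i}"
    unfolding uniquely_coded_def by (auto elim: card_1_singletonE)
  have "w = w'" if "w \<in> words m n" "w' \<in> words m n" "x \<in> f w ` K" "x \<in> f w' ` K" for n w w'
    using that extend_to_code[of w x] extend_to_code[of w' x] x(2)
    by (metis (mono_tags, lifting) mem_Collect_eq singletonD words_def)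
  then show "x \<in> G" using x by (auto simp: G_def)
next
  fix x assume x: "x \<in> G"
  then have "x \<in> K" by (simp add: G_def)
  then obtain i where i: "i \<in> code_space m" "\<And>n. x \<in> f (code_prefix i n) ` K"
    using exists_code by metis
  have "codes_of m \<phi> K x = {i}"
  proof
    show "codes_of m \<phi> K x \<subseteq> {i}"
    proof
      fix k assume k: "k \<in> codes_of m \<phi> K x"
      have "code_prefix k n = code_prefix i n" for n
        using k i x code_prefix_in_lists by (intro G_D[of x]) (auto simp: codes_of_eq)
      then show "k \<in> {i}" using code_eqI by blast
    qed
  qed (use i in \<open>simp add: codes_of_eq\<close>)
  then show "x \<in> uniquely_coded m \<phi> K" using \<open>x \<in> K\<close> by (simp add: uniquely_coded_def)
qed

abbreviation T :: "'a \<Rightarrow> 'a" where "T \<equiv> induced_map m \<phi> K"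

lemma T_outside: "x \<notin> G \<Longrightarrow> T x = x"
  by (simp add: induced_map_def uniquely_coded_eq)

text \<open>Prefixing a code of \<open>y\<close> with \<open>j\<close> gives a code of \<open>\<phi> j y\<close>. If the latter has only one code, so has
  \<open>y\<close>, and the shift removes the prefix.\<close>

lemma T_step:
  assumes x: "x \<in> G" and j: "j \<in> {1..m}" and y: "y \<in> K" "x = \<phi> j y"
  shows "T x = y" "y \<in> G"
proof -
  show "y \<in> G"
  proof -
    have "w = w'" if "w \<in> words m n" "w' \<in> words m n" "y \<in> f w ` K" "y \<in> f w' ` K" for n w w'
    proof -
      have "j # w = j # w'"
        using that j y by (intro G_D[OF x]) (auto simp: words_def)
      then show ?thesis by simp
    qed
    then show ?thesis using y by (auto simp: G_def)
  qed
  obtain k where k': "k \<in> code_space m" "\<And>n. y \<in> f (code_prefix k n) ` K"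
    using exists_code[OF y(1)] by metis
  define i where "i = case_nat j k"
  have Suc: "code_prefix i (Suc n) = j # code_prefix k n" for n
    by (simp add: code_prefix_def i_def upt_conv_Cons map_Suc_upt[symmetric] comp_def del: upt_Suc)
  have "x \<in> f (code_prefix i n) ` K" for n
  proof (cases n)
    case 0
    then show ?thesis using x by (simp add: G_def)
  next
    case (Suc n')
    then show ?thesis using k'(2)[of n'] y(2) by (auto simp: \<open>\<And>n. code_prefix i (Suc n) = _\<close>)
  qed
  then have "i \<in> codes_of m \<phi> K x"
    using k'(1) j by (auto simp: codes_of_eq code_space_def i_def split: nat.splits)
  moreover have U: "x \<in> uniquely_coded m \<phi> K" using x by (simp add: uniquely_coded_eq)
  ultimately have "codes_of m \<phi> K x = {i}"
    unfolding uniquely_coded_def by (auto elim!: card_1_singletonE)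
  then have "T x = coding_map \<phi> K (left_shift i)" using U by (simp add: induced_map_def)
  also have "left_shift i = k" by (auto simp: left_shift_def i_def)
  also have "coding_map \<phi> K k = y" using coding_map_eqI k' by blast
  finally show "T x = y" .
qed

lemma T_iterate:
  "w \<in> W \<Longrightarrow> x \<in> G \<Longrightarrow> x \<in> f w ` K \<Longrightarrow> (T ^^ length w) x \<in> G \<and> f w ((T ^^ length w) x) = x"
proof (induction w arbitrary: x)
  case (Cons j w)
  then obtain z where z: "z \<in> K" "x = \<phi> j (f w z)" by auto
  have T: "T x = f w z" "f w z \<in> G"
    using T_step[of x j "f w z"] Cons.prems z f_K by auto
  then show ?case
    using Cons.IH[of "f w z"] Cons.prems z by (auto simp: funpow_swap1[symmetric] funpow_Suc_right simp del: funpow.simps)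
qed simp

lemma G_subset_K: "G \<subseteq> K" by (auto simp: G_def)

section \<open>Words at a given scale\<close>

text \<open>The words at which \<open>L\<close> first drops to \<open>r\<close>. The condition runs over all proper prefixes because
  \<open>L\<close> is multiplicative only up to a constant and may grow when a letter is appended; in this form
  no word of the set is a prefix of another one.\<close>

definition scale_words :: "real \<Rightarrow> nat list set" where
  "scale_words r = {w \<in> W. L w \<le> r \<and> (\<forall>u. strict_prefix u w \<longrightarrow> r < L u)}"

lemma scale_words_prefix_free:
  "w \<in> scale_words r \<Longrightarrow> w' \<in> scale_words r \<Longrightarrow> prefix w w' \<Longrightarrow> w = w'"
  by (force simp: scale_words_def strict_prefix_def)

lemma code_hits_scale_words:
  assumes i: "i \<in> code_space m" and r: "0 < r"
  obtains n where "code_prefix i n \<in> scale_words r"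
proof -
  obtain N where "c ^ N * 1 < r" using c_powr_vanishes[OF r] by blast
  then have "L (code_prefix i N) \<le> r"
    using L_le_power[OF code_prefix_in_lists[OF i], of N] by simp
  then have ex: "\<exists>n. L (code_prefix i n) \<le> r" by blast
  define n where "n = (LEAST n. L (code_prefix i n) \<le> r)"
  have "L (code_prefix i n) \<le> r" unfolding n_def using LeastI_ex[OF ex] .
  moreover have "r < L u" if "strict_prefix u (code_prefix i n)" for u
  proof -
    have len: "length u < n" using prefix_length_less[OF that] by simp
    then have "u = code_prefix i (length u)"
      using that take_code_prefix[of "length u" n i] by (metis append_eq_conv_conj less_imp_le strict_prefixE' )
    moreover have "\<not> L (code_prefix i (length u)) \<le> r" using not_less_Least len unfolding n_def by blast
    ultimately show ?thesis by simp
  qed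
  ultimately show ?thesis using that code_prefix_in_lists[OF i] by (auto simp: scale_words_def)
qed

text \<open>Dropping the last letter brings \<open>L\<close> above \<open>r\<close> and changes it by at most a constant factor. The
  bound \<open>r < 1\<close> excludes the empty word, which has no last letter.\<close>

lemma scale_words_lower:
  obtains \<theta> where "0 < \<theta>" "\<And>r w. r < 1 \<Longrightarrow> w \<in> scale_words r \<Longrightarrow> \<theta> * r \<le> L w"
proof -
  define \<theta> where "\<theta> = Min ((\<lambda>j. L [j]) ` {1..m}) / D"
  have ne: "{1..m} \<noteq> {}" using K_eq K_nonempty by blast
  have pos: "0 < Min ((\<lambda>j. L [j]) ` {1..m})" using ne L_pos by (subst Min_gr_iff) auto
  then have "0 < \<theta>" using D_ge_1 by (simp add: \<theta>_def)
  moreover have "\<theta> * r \<le> L w" if "r < 1" and w: "w \<in> scale_words r" for r w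
  proof -
    have "w \<noteq> []" using that by (auto simp: scale_words_def)
    then obtain u j where uj: "w = u @ [j]" using rev_exhaust by blast
    then have W: "u \<in> W" "[j] \<in> W" using w by (auto simp: scale_words_def)
    have "strict_prefix u w" using uj by (auto simp: strict_prefix_def)
    then have "r < L u" using w by (auto simp: scale_words_def)
    have "\<theta> * r \<le> \<theta> * L u" using \<open>r < L u\<close> \<open>0 < \<theta>\<close> by simp
    also have "\<dots> \<le> (L [j] / D) * L u"
      unfolding \<theta>_def using W D_ge_1 L_pos[of u] by (intro mult_right_mono divide_right_mono Min_le) auto
    also have "\<dots> \<le> L w" using L_append_lower[OF W] D_ge_1 by (simp add: uj field_simps)
    finally show ?thesis .
  qed
  ultimately show ?thesis using that by blast
qed

text \<open>The points \<open>\<phi>\<^sub>w(v)\<close> of the cylinders that meet the ball stay within a distance of order \<open>r\<close> from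
  its centre, and two of them are at least a distance of order \<open>r\<close> apart.\<close>

lemma card_scale_words_le:
  "\<exists>M::nat. \<forall>x r F. 0 < r \<and> r < 1 \<and> F \<subseteq> {w \<in> scale_words r. f w ` K \<inter> cball x r \<noteq> {}} \<longrightarrow>
      finite F \<and> card F \<le> M"
proof -
  obtain \<theta> where \<theta>: "0 < \<theta>" "\<And>r w. r < 1 \<Longrightarrow> w \<in> scale_words r \<Longrightarrow> \<theta> * r \<le> L w"
    using scale_words_lower by metis
  define e where "e = \<kappa> * \<theta> * dist a b"
  have "0 < e" using \<kappa>_pos \<theta> dist_ab_pos by (simp add: e_def)
  obtain M :: nat where M: "\<And>(x::'a) r S. 0 < r \<Longrightarrow> S \<subseteq> cball x ((1 + D * diamQ) * r) \<Longrightarrow>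
      (\<And>p q. p \<in> S \<Longrightarrow> q \<in> S \<Longrightarrow> p \<noteq> q \<Longrightarrow> e * r \<le> dist p q) \<Longrightarrow> finite S \<and> card S \<le> M"
    using card_separated_le[OF \<open>0 < e\<close>, of "1 + D * diamQ"] by metis
  have "finite F \<and> card F \<le> M"
    if r: "0 < r" "r < 1" and F: "F \<subseteq> {w \<in> scale_words r. f w ` K \<inter> cball x r \<noteq> {}}" for x r F
  proof -
    have sep: "e * r \<le> dist (f w v) (f w' v)" if "w \<in> F" "w' \<in> F" "w \<noteq> w'" for w w'
    proof -
      have sw: "w \<in> scale_words r" "w' \<in> scale_words r" using that F by auto
      then have W: "w \<in> W" "w' \<in> W" by (auto simp: scale_words_def)
      have "e * r = \<kappa> * dist a b * (\<theta> * r)" by (simp add: e_def)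
      also have "\<dots> \<le> \<kappa> * dist a b * L w"
        using \<theta>(2)[OF r(2) sw(1)] \<kappa>_pos dist_ab_pos by (intro mult_left_mono) auto
      also have "\<dots> = \<kappa> * dist (f w a) (f w b)" using dist_ab_pos by (simp add: L_def)
      also have "\<dots> \<le> dist (f w v) (f w' v)"
        using separation[OF W] scale_words_prefix_free sw that(3) by blast
      finally show ?thesis .
    qed
    have inj: "inj_on (\<lambda>w. f w v) F"
    proof (rule inj_onI, rule ccontr)
      fix w w' assume "w \<in> F" "w' \<in> F" "f w v = f w' v" "w \<noteq> w'"
      then have "e * r \<le> 0" using sep[of w w'] by simp
      then show False using \<open>0 < e\<close> r by (simp add: mult_le_0_iff)
    qed
    have near: "f w v \<in> cball x ((1 + D * diamQ) * r)" if w: "w \<in> F" for w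
    proof -
      have sw: "w \<in> scale_words r" using w F by auto
      then have W: "w \<in> W" and Lr: "L w \<le> r" by (auto simp: scale_words_def)
      have "f w ` K \<inter> cball x r \<noteq> {}" using w F by blast
      then obtain y where y: "y \<in> K" "dist x (f w y) \<le> r" by auto
      have "dist (f w y) (f w v) \<le> D * L w * dist y v"
        using f_upper[OF W] y K_subset v_in by blast
      also have "\<dots> \<le> D * r * diamQ"
        using Lr y K_subset v_in D_ge_1 r L_pos[OF W] diamQ_pos
        by (intro mult_mono dist_le_diamQ mult_nonneg_nonneg) auto
      finally have "dist x (f w v) \<le> r + D * r * diamQ"
        using y dist_triangle[of x "f w v" "f w y"] by linarith
      then show ?thesis by (simp add: algebra_simps)
    qed
    have "finite ((\<lambda>w. f w v) ` F) \<and> card ((\<lambda>w. f w v) ` F) \<le> M"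
    proof (rule M[OF r(1)])
      show "(\<lambda>w. f w v) ` F \<subseteq> cball x ((1 + D * diamQ) * r)" using near by blast
    qed (use sep in blast)
    then show ?thesis using inj by (simp add: card_image finite_image_iff)
  qed
  then show ?thesis by blast
qed

text \<open>Take a scale \<open>r\<close> so small that all words of length at most \<open>n\<close> are still above it. Distinct words
  of length \<open>n\<close> through \<open>x\<close> then extend to distinct words of scale \<open>r\<close> through \<open>x\<close>, and the bound for
  these does not depend on \<open>r\<close>.\<close>

lemma card_covering_words_le:
  "\<exists>M::nat. \<forall>x n. card {w \<in> words m n. x \<in> f w ` K} \<le> M"
proof -
  obtain M :: nat where M: "\<And>x r F. 0 < r \<Longrightarrow> r < 1 \<Longrightarrow>
      F \<subseteq> {w \<in> scale_words r. f w ` K \<inter> cball x r \<noteq> {}} \<Longrightarrow> finite F \<and> card F \<le> M"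
    using card_scale_words_le by blast
  have "card {w \<in> words m n. x \<in> f w ` K} \<le> M" for x n
  proof -
    define S where "S = insert 1 (L ` (\<Union>k\<le>n. words m k))"
    have S: "finite S" "S \<noteq> {}" "\<And>s. s \<in> S \<Longrightarrow> 0 < s"
      using finite_words L_pos by (auto simp: S_def words_def)
    define r where "r = Min S / 2"
    have Min_pos: "0 < Min S" using S by (subst Min_gr_iff) auto
    moreover have "Min S \<le> 1" using S by (intro Min_le) (auto simp: S_def)
    ultimately have r: "0 < r" "r < 1" by (simp_all add: r_def)
    have short: "r < L w" if "w \<in> W" "length w \<le> n" for w
    proof -
      have "Min S \<le> L w" using that S by (intro Min_le) (auto simp: S_def words_def)
      then show ?thesis using Min_pos by (simp add: r_def)
    qed
    have "\<exists>e. e \<in> scale_words r \<and> x \<in> f e ` K \<and> take n e = w" if wx: "w \<in> words m n" "x \<in> f w ` K" for w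
    proof -
      have w: "w \<in> W" "length w = n" using wx by (auto simp: words_def)
      obtain i where i: "i \<in> codes_of m \<phi> K x" "code_prefix i n = w"
        using extend_to_code[OF w(1) wx(2)] w(2) by metis
      then have i': "i \<in> code_space m" "\<And>n. x \<in> f (code_prefix i n) ` K" by (auto simp: codes_of_eq)
      obtain k where k: "code_prefix i k \<in> scale_words r"
        by (rule code_hits_scale_words[OF i'(1) r(1)])
      then have "\<not> r < L (code_prefix i k)" "code_prefix i k \<in> W" by (auto simp: scale_words_def)
      then have "\<not> k \<le> n" using short[of "code_prefix i k"] by auto
      then have "n \<le> k" by simp
      then show ?thesis using k i'(2) i(2) take_code_prefix by blast
    qed
    then obtain e where e: "\<And>w. w \<in> {w \<in> words m n. x \<in> f w ` K} \<Longrightarrow>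
        e w \<in> scale_words r \<and> x \<in> f (e w) ` K \<and> take n (e w) = w" by (metis (mono_tags, lifting) mem_Collect_eq)
    have "inj_on e {w \<in> words m n. x \<in> f w ` K}" using e by (metis (no_types, lifting) inj_onI)
    moreover have "finite (e ` {w \<in> words m n. x \<in> f w ` K}) \<and> card (e ` {w \<in> words m n. x \<in> f w ` K}) \<le> M"
    proof (rule M[OF r])
      show "e ` {w \<in> words m n. x \<in> f w ` K} \<subseteq> {w \<in> scale_words r. f w ` K \<inter> cball x r \<noteq> {}}"
        using e r by (fastforce simp del: mem_Collect_eq image_iff)
    qed
    ultimately show ?thesis by (simp add: card_image)
  qed
  then show ?thesis by blast
qed

end

section \<open>Sums of indicator functions\<close>

lemma (in finite_measure) sum_measure_mono:
  fixes s :: "'i \<Rightarrow> real" and r :: "'j \<Rightarrow> real"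
  assumes fin: "finite I" "finite J"
    and sets: "\<And>i. i \<in> I \<Longrightarrow> S i \<in> sets M" "\<And>j. j \<in> J \<Longrightarrow> R j \<in> sets M"
    and le: "\<And>x. x \<in> space M \<Longrightarrow> (\<Sum>i\<in>I. s i * indicator (S i) x) \<le> (\<Sum>j\<in>J. r j * indicator (R j) x)"
  shows "(\<Sum>i\<in>I. s i * measure M (S i)) \<le> (\<Sum>j\<in>J. r j * measure M (R j))"
proof -
  have int: "integrable M (\<lambda>x. t * indicator A x)" if "A \<in> sets M" for A and t :: real
    using that by (intro integrable_mult_right integrable_real_indicator) (auto simp: emeasure_eq_measure)
  have "(\<Sum>i\<in>I. s i * measure M (S i)) = (\<integral>x. (\<Sum>i\<in>I. s i * indicator (S i) x) \<partial>M)"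
    using int sets by (subst Bochner_Integration.integral_sum) (auto intro!: sum.cong simp: integral_indicator)
  also have "\<dots> \<le> (\<integral>x. (\<Sum>j\<in>J. r j * indicator (R j) x) \<partial>M)"
    using int sets le by (intro integral_mono Bochner_Integration.integrable_sum) auto
  also have "\<dots> = (\<Sum>j\<in>J. r j * measure M (R j))"
    using int sets by (subst Bochner_Integration.integral_sum) (auto intro!: sum.cong simp: integral_indicator)
  finally show ?thesis .
qed

text \<open>If \<open>X\<close> counts the events that occur, then \<open>2tX - t\<^sup>2X\<^sup>2\<close> is zero where \<open>X = 0\<close> and at most \<open>1\<close>
  everywhere, because \<open>(1 - tX)\<^sup>2\<close> is nonnegative. Integrating this bound for the indicator of the
  union gives an inequality of Chung-Erdos type that involves only sums of measures.\<close>

lemma (in finite_measure) measure_Union_ge_second_moment: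
  fixes F :: "nat \<Rightarrow> 'a set"
  assumes fin: "finite J" and F: "\<And>n. n \<in> J \<Longrightarrow> F n \<in> sets M"
    and pos: "0 < S" "0 < \<beta>"
    and first: "\<alpha> * p * S \<le> (\<Sum>n\<in>J. measure M (F n))" and \<alpha>: "0 < \<alpha>"
    and second: "(\<Sum>(n, l)\<in>J \<times> J. measure M (F n \<inter> F l)) \<le> \<beta> * p * S\<^sup>2"
  shows "p * (\<alpha>\<^sup>2 / \<beta>) \<le> measure M (\<Union>n\<in>J. F n)"
proof -
  \<comment> \<open>maximises \<open>2 t \<alpha> S - t\<^sup>2 \<beta> S\<^sup>2\<close>\<close>
  define t where "t = \<alpha> / (\<beta> * S)"
  have t: "0 \<le> t" using pos \<alpha> by (simp add: t_def)
  define U where "U = (\<Union>n\<in>J. F n)"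
  have U: "U \<in> sets M" using fin F by (auto simp: U_def)
  let ?X = "\<lambda>x. \<Sum>n\<in>J. indicator (F n) x :: real"
  have int: "integrable M (indicator A :: _ \<Rightarrow> real)" if "A \<in> sets M" for A
    using that by (auto simp: emeasure_eq_measure intro!: integrable_real_indicator)
  have sq: "(?X x)\<^sup>2 = (\<Sum>(n, l)\<in>J \<times> J. indicator (F n \<inter> F l) x)" for x
    by (simp add: power2_eq_square sum_product sum.cartesian_product indicator_inter_arith)
  have intX: "integrable M ?X" and intX2: "integrable M (\<lambda>x. (?X x)\<^sup>2)"
    unfolding sq using int F by (auto intro!: Bochner_Integration.integrable_sum simp: case_prod_unfold)
  have X: "(\<integral>x. ?X x \<partial>M) = (\<Sum>n\<in>J. measure M (F n))"
    using int F by (subst Bochner_Integration.integral_sum) (auto intro!: sum.cong)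
  have X2: "(\<integral>x. (?X x)\<^sup>2 \<partial>M) = (\<Sum>(n, l)\<in>J \<times> J. measure M (F n \<inter> F l))"
    unfolding sq using int F
    by (subst Bochner_Integration.integral_sum) (auto intro!: sum.cong simp: case_prod_unfold)
  have pointwise: "2 * t * ?X x - t\<^sup>2 * (?X x)\<^sup>2 \<le> indicator U x" for x
  proof (cases "x \<in> U")
    case True
    have "0 \<le> (1 - t * ?X x)\<^sup>2" by simp
    then show ?thesis using True by (simp add: power2_diff power_mult_distrib algebra_simps)
  next
    case False
    then have "?X x = 0" by (intro sum.neutral) (auto simp: U_def)
    then show ?thesis by simp
  qed
  have "p * (\<alpha>\<^sup>2 / \<beta>) = 2 * t * (\<alpha> * p * S) - t\<^sup>2 * (\<beta> * p * S\<^sup>2)"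
    using pos by (simp add: t_def field_simps power2_eq_square)
  also have "\<dots> \<le> 2 * t * (\<Sum>n\<in>J. measure M (F n)) - t\<^sup>2 * (\<Sum>(n, l)\<in>J \<times> J. measure M (F n \<inter> F l))"
    using first second t by (intro diff_mono mult_left_mono) auto
  also have "\<dots> = (\<integral>x. 2 * t * ?X x - t\<^sup>2 * (?X x)\<^sup>2 \<partial>M)"
    using intX intX2 by (simp add: X X2 del: power_sum)
  also have "\<dots> \<le> (\<integral>x. indicator U x \<partial>M)"
    using pointwise intX intX2 int[OF U] by (intro integral_mono) auto
  also have "\<dots> = measure M U" using U by simp
  finally show ?thesis by (simp add: U_def)
qed

section \<open>Measures comparable with Hausdorff measure\<close>

locale regular_ifs = distortion_ifs +
  fixes \<mu> :: "'a measure" and \<tau> C :: real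
  assumes sets_\<mu>: "sets \<mu> = sets borel" and \<mu>_UNIV: "emeasure \<mu> UNIV = 1"
    and \<mu>_outside: "emeasure \<mu> (- K) = 0"
    and \<tau>_pos: "0 < \<tau>" and C_ge_1: "1 \<le> C"
    and \<mu>_upper: "E \<in> sets borel \<Longrightarrow> emeasure \<mu> E \<le> ennreal C * hausdorff_measure \<tau> (E \<inter> K)"
    and \<mu>_lower: "E \<in> sets borel \<Longrightarrow> ennreal (inverse C) * hausdorff_measure \<tau> (E \<inter> K) \<le> emeasure \<mu> E"
begin

lemma space_\<mu>: "space \<mu> = UNIV"
  using sets_eq_imp_space_eq[OF sets_\<mu>] by simp

sublocale finite_measure \<mu>
  by (rule finite_measureI) (simp add: space_\<mu> \<mu>_UNIV)

abbreviation P :: "'a set \<Rightarrow> real" where "P \<equiv> measure \<mu>"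

lemma P_UNIV: "P UNIV = 1"
  using \<mu>_UNIV by (simp add: measure_def)

lemma P_le_1: "P A \<le> 1"
  using bounded_measure[of A] P_UNIV by (simp add: space_\<mu>)

lemma P_mono: "A \<subseteq> B \<Longrightarrow> B \<in> sets borel \<Longrightarrow> P A \<le> P B"
  by (rule finite_measure_mono) (simp_all add: sets_\<mu>)

lemma K_borel: "K \<in> sets borel"
  using K_compact by (simp add: borel_compact)

lemma P_inter_full:
  assumes "A \<in> sets borel" "E \<in> sets borel" "emeasure \<mu> (- E) = 0"
  shows "P (A \<inter> E) = P A"
proof -
  have "- E \<in> null_sets \<mu>" using assms by (auto simp: null_sets_def sets_\<mu>)
  then have "measure \<mu> (A - - E) = measure \<mu> A"
    using assms by (intro measure_Diff_null_set) (auto simp: sets_\<mu>)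
  then show ?thesis by (simp add: Diff_eq)
qed

lemma P_inter_K: "A \<in> sets borel \<Longrightarrow> P (A \<inter> K) = P A"
  by (rule P_inter_full[OF _ K_borel \<mu>_outside])

lemma P_K: "P K = 1"
  using P_inter_K[of UNIV] P_UNIV by simp

definition C1 :: real where "C1 = C * C * D powr \<tau>"

lemma C1_ge_1: "1 \<le> C1"
proof -
  have "1 * 1 * 1 \<le> C * C * D powr \<tau>"
    using C_ge_1 D_ge_1 \<tau>_pos by (intro mult_mono ge_one_powr_ge_zero) auto
  then show ?thesis by (simp add: C1_def)
qed

text \<open>One factor \<open>C\<close> passes from \<open>\<mu>\<close> to Hausdorff measure, the other one passes back.\<close>

lemma lipschitz_image_measure_le:
  assumes A: "compact A" "A \<subseteq> K" and gA: "compact (g ` A)" "g ` A \<subseteq> K" and l: "0 < l"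
    and lip: "\<And>x y. x \<in> A \<Longrightarrow> y \<in> A \<Longrightarrow> dist (g x) (g y) \<le> l * dist x y"
  shows "P (g ` A) \<le> C * C * l powr \<tau> * P A"
proof -
  have b: "A \<in> sets borel" "g ` A \<in> sets borel" using A gA by (auto simp: borel_compact)
  have "hausdorff_measure \<tau> A = ennreal C * (ennreal (inverse C) * hausdorff_measure \<tau> A)"
    using C_ge_1 by (simp add: mult.assoc[symmetric] ennreal_mult[symmetric])
  also have "\<dots> \<le> ennreal C * emeasure \<mu> A"
    using \<mu>_lower[OF b(1)] A(2) by (intro mult_left_mono) (simp_all add: Int_absorb2)
  finally have HA: "hausdorff_measure \<tau> A \<le> ennreal C * emeasure \<mu> A" .
  have "emeasure \<mu> (g ` A) \<le> ennreal C * hausdorff_measure \<tau> (g ` A)"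
    using \<mu>_upper[OF b(2)] gA(2) by (simp add: Int_absorb2)
  also have "\<dots> \<le> ennreal C * (ennreal (l powr \<tau>) * hausdorff_measure \<tau> A)"
    by (intro mult_left_mono hausdorff_measure_lipschitz_image \<tau>_pos l lip) auto
  also have "\<dots> \<le> ennreal C * (ennreal (l powr \<tau>) * (ennreal C * emeasure \<mu> A))"
    by (intro mult_left_mono HA) auto
  finally show ?thesis
    using C_ge_1 by (simp add: emeasure_eq_measure ennreal_mult[symmetric] mult_ac)
qed

definition q :: "nat list \<Rightarrow> real" where "q w = L w powr \<tau>"

lemma q_pos: "w \<in> W \<Longrightarrow> 0 < q w"
  using L_pos by (fastforce simp: q_def)

lemma P_image_upper:
  assumes w: "w \<in> W" and A: "compact A" "A \<subseteq> K"
  shows "P (f w ` A) \<le> C1 * q w * P A"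
proof -
  have "P (f w ` A) \<le> C * C * (D * L w) powr \<tau> * P A"
  proof (rule lipschitz_image_measure_le[OF A f_image_compact[OF w A]])
    show "dist (f w x) (f w y) \<le> D * L w * dist x y" if "x \<in> A" "y \<in> A" for x y
      using f_upper[OF w] that A K_subset by blast
  qed (use A f_K[OF w] L_pos[OF w] D_ge_1 in auto)
  also have "(D * L w) powr \<tau> = D powr \<tau> * q w"
    using D_ge_1 L_pos[OF w] by (simp add: q_def powr_mult)
  finally show ?thesis by (simp add: C1_def mult_ac)
qed

lemma P_image_lower:
  assumes w: "w \<in> W" and A: "compact A" "A \<subseteq> K"
  shows "q w * P A \<le> C1 * P (f w ` A)"
proof -
  define g where "g = inv_into Q (f w)"
  have gf: "g (f w x) = x" if "x \<in> K" for x
    using f_inj[OF w] that K_subset by (auto simp: g_def)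
  have im: "g ` f w ` A = A"
  proof -
    have "g ` f w ` A = (\<lambda>x. x) ` A" unfolding image_image using gf A by (intro image_cong) auto
    then show ?thesis by simp
  qed
  have "P (g ` f w ` A) \<le> C * C * (D / L w) powr \<tau> * P (f w ` A)"
  proof (rule lipschitz_image_measure_le)
    fix x y assume "x \<in> f w ` A" "y \<in> f w ` A"
    then obtain x' y' where "x' \<in> A" "y' \<in> A" "x = f w x'" "y = f w y'" by auto
    then show "dist (g x) (g y) \<le> D / L w * dist x y"
      using f_lower[OF w, of x' y'] gf A K_subset L_pos[OF w] by (auto simp: field_simps subset_iff)
  qed (use A im f_image_compact[OF w A] f_K[OF w] D_ge_1 L_pos[OF w] in auto)
  then have "q w * P A \<le> q w * (C * C * (D / L w) powr \<tau> * P (f w ` A))"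
    using q_pos[OF w] unfolding im by (intro mult_left_mono) auto
  also have "\<dots> = C1 * P (f w ` A)"
    using D_ge_1 L_pos[OF w] by (simp add: q_def C1_def powr_divide)
  finally show ?thesis .
qed

lemma cylinder_upper: "w \<in> W \<Longrightarrow> P (f w ` K) \<le> C1 * q w"
  using P_image_upper[OF _ K_compact] P_K by simp

lemma cylinder_lower: "w \<in> W \<Longrightarrow> q w \<le> C1 * P (f w ` K)"
  using P_image_lower[OF _ K_compact] P_K by simp

lemma cylinder_compact: "w \<in> W \<Longrightarrow> compact (f w ` K)"
  using f_image_compact[OF _ K_compact] by simp

lemma cylinder_borel: "w \<in> W \<Longrightarrow> f w ` K \<in> sets borel"
  by (simp add: borel_compact cylinder_compact)

lemma q_append_upper: "u \<in> W \<Longrightarrow> w \<in> W \<Longrightarrow> q (u @ w) \<le> D powr \<tau> * q u * q w"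
proof -
  assume uw: "u \<in> W" "w \<in> W"
  then have "L (u @ w) powr \<tau> \<le> (D * L u * L w) powr \<tau>"
    using L_append_upper[OF uw] L_pos[of "u @ w"] \<tau>_pos by (intro powr_mono2) auto
  then show ?thesis using D_ge_1 L_pos[OF uw(1)] L_pos[OF uw(2)] by (simp add: q_def powr_mult)
qed

section \<open>Overlaps of cylinders\<close>

definition overlap :: "'a set" where
  "overlap = (\<Union>(i, j)\<in>{(i, j). i \<in> {1..m} \<and> j \<in> {1..m} \<and> i \<noteq> j}. \<phi> i ` K \<inter> \<phi> j ` K)"

lemma phi_image_compact: "j \<in> {1..m} \<Longrightarrow> compact (\<phi> j ` K)"
  using cylinder_compact[of "[j]"] by simp

lemma overlap_compact: "compact overlap"
  unfolding overlap_def
proof (intro compact_UN)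
  show "finite {(i, j). i \<in> {1..m} \<and> j \<in> {1..m} \<and> i \<noteq> j}"
    by (rule finite_subset[of _ "{1..m} \<times> {1..m}"]) auto
qed (auto intro!: compact_Int phi_image_compact)

lemma overlap_subset: "overlap \<subseteq> K"
  using phi_K by (auto simp: overlap_def)

lemma count_children_ge:
  assumes y: "y \<in> K"
  shows "1 + indicator overlap y \<le> (\<Sum>j\<in>{1..m}. indicator (\<phi> j ` K) y :: real)"
proof -
  obtain i where i: "i \<in> {1..m}" "y \<in> \<phi> i ` K" using y K_eq by blast
  show ?thesis
  proof (cases "y \<in> overlap")
    case True
    then obtain i j where ij: "i \<in> {1..m}" "j \<in> {1..m}" "i \<noteq> j" "y \<in> \<phi> i ` K" "y \<in> \<phi> j ` K"
      by (auto simp: overlap_def)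
    have "(2::real) = (\<Sum>j\<in>{i, j}. indicator (\<phi> j ` K) y)" using ij by simp
    also have "\<dots> \<le> (\<Sum>j\<in>{1..m}. indicator (\<phi> j ` K) y)"
      using ij by (intro sum_mono2) auto
    finally show ?thesis using True by simp
  next
    case False
    have "(1::real) = (\<Sum>j\<in>{i}. indicator (\<phi> j ` K) y)" using i by simp
    also have "\<dots> \<le> (\<Sum>j\<in>{1..m}. indicator (\<phi> j ` K) y)"
      using i by (intro sum_mono2) auto
    finally show ?thesis using False by simp
  qed
qed

lemma indicator_f_image:
  assumes w: "w \<in> W" and "A \<subseteq> K" "y \<in> K"
  shows "indicator (f w ` A) (f w y) = (indicator A y :: real)"
  using f_inj[OF w] assms K_subset by (auto simp: indicator_def inj_on_def subset_iff)

lemma children_measure_ge: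
  assumes w: "w \<in> W"
  shows "P (f w ` K) + P (f w ` overlap) \<le> (\<Sum>j\<in>{1..m}. P (f (w @ [j]) ` K))"
proof -
  define A where "A k = (if k = (0::nat) then f w ` K else f w ` overlap)" for k
  have ov: "f w ` overlap \<in> sets borel"
    using f_image_compact[OF w overlap_compact overlap_subset] by (simp add: borel_compact)
  have "(\<Sum>k\<in>{0,1}. 1 * P (A k)) \<le> (\<Sum>j\<in>{1..m}. 1 * P (f (w @ [j]) ` K))"
  proof (rule sum_measure_mono)
    show "A k \<in> sets \<mu>" for k using ov cylinder_borel[OF w] by (simp add: A_def sets_\<mu>)
    show "f (w @ [j]) ` K \<in> sets \<mu>" if "j \<in> {1..m}" for j
      using cylinder_borel[of "w @ [j]"] w that by (simp add: sets_\<mu>)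
    fix x
    show "(\<Sum>k\<in>{0, 1}. 1 * indicator (A k) x) \<le> (\<Sum>j\<in>{1..m}. 1 * indicator (f (w @ [j]) ` K) x :: real)"
    proof (cases "x \<in> f w ` K")
      case True
      then obtain y where y: "y \<in> K" "x = f w y" by auto
      have im: "f (w @ [j]) ` K = f w ` \<phi> j ` K" for j by (simp add: compose_word_append image_comp)
      have "indicator (f (w @ [j]) ` K) x = (indicator (\<phi> j ` K) y :: real)" if "j \<in> {1..m}" for j
        unfolding im y(2) using that phi_K y by (intro indicator_f_image[OF w]) auto
      then have "(\<Sum>j\<in>{1..m}. 1 * indicator (f (w @ [j]) ` K) x) = (\<Sum>j\<in>{1..m}. indicator (\<phi> j ` K) y :: real)"
        by (intro sum.cong) auto
      then show ?thesis
        using count_children_ge[OF y(1)] indicator_f_image[OF w overlap_subset y(1)] True y(2)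
        by (simp add: A_def)
    next
      case False
      then have "x \<notin> f w ` overlap" using overlap_subset by auto
      then show ?thesis using False by (simp add: A_def sum_nonneg)
    qed
  qed auto
  then show ?thesis by (simp add: A_def)
qed

text \<open>The mean number of words of length \<open>n\<close> through a point. It is bounded because the number itself
  is, while overlaps of positive measure would make it grow linearly in \<open>n\<close>.\<close>

definition level_sum :: "nat \<Rightarrow> real" where
  "level_sum n = (\<Sum>w\<in>words m n. P (f w ` K))"

lemma words_W: "w \<in> words m n \<Longrightarrow> w \<in> W" by (simp add: words_def)

lemma K_covered: "K \<subseteq> (\<Union>w\<in>words m n. f w ` K)"
proof
  fix x assume "x \<in> K"
  then obtain i where i: "i \<in> code_space m" "\<And>n. x \<in> f (code_prefix i n) ` K"
    using exists_code by metis
  then show "x \<in> (\<Union>w\<in>words m n. f w ` K)"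
    using code_prefix_in_lists[OF i(1), of n] by (auto simp: words_def intro!: bexI[of _ "code_prefix i n"])
qed

lemma level_sum_ge_1: "1 \<le> level_sum n"
proof -
  have "P K \<le> P (\<Union>w\<in>words m n. f w ` K)"
    using K_covered cylinder_borel words_W finite_words by (intro P_mono sets.finite_UN) auto
  also have "\<dots> \<le> level_sum n"
    unfolding level_sum_def using cylinder_borel words_W finite_words
    by (intro finite_measure_subadditive_finite) (auto simp: sets_\<mu>)
  finally show ?thesis by (simp add: P_K)
qed

lemma level_sum_Suc: "level_sum n + P overlap / C1\<^sup>2 \<le> level_sum (Suc n)"
proof -
  have "P overlap / C1\<^sup>2 \<le> P overlap / C1\<^sup>2 * level_sum n"
    using mult_left_mono[OF level_sum_ge_1[of n], of "P overlap / C1\<^sup>2"] by simp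
  also have "\<dots> = (\<Sum>w\<in>words m n. P overlap / C1\<^sup>2 * P (f w ` K))"
    by (simp add: level_sum_def sum_distrib_left)
  also have "\<dots> \<le> (\<Sum>w\<in>words m n. P (f w ` overlap))"
  proof (rule sum_mono)
    fix w assume "w \<in> words m n"
    then have w: "w \<in> W" by (rule words_W)
    have "P overlap * P (f w ` K) \<le> P overlap * (C1 * q w)"
      using cylinder_upper[OF w] by (intro mult_left_mono) auto
    also have "\<dots> = C1 * (q w * P overlap)" by simp
    also have "\<dots> \<le> C1 * (C1 * P (f w ` overlap))"
      using P_image_lower[OF w overlap_compact overlap_subset] C1_ge_1 by (intro mult_left_mono) auto
    finally show "P overlap / C1\<^sup>2 * P (f w ` K) \<le> P (f w ` overlap)"
      using C1_ge_1 by (simp add: field_simps power2_eq_square)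
  qed
  finally have "level_sum n + P overlap / C1\<^sup>2
      \<le> (\<Sum>w\<in>words m n. P (f w ` K)) + (\<Sum>w\<in>words m n. P (f w ` overlap))"
    by (simp add: level_sum_def)
  also have "\<dots> = (\<Sum>w\<in>words m n. P (f w ` K) + P (f w ` overlap))" by (simp add: sum.distrib)
  also have "\<dots> \<le> (\<Sum>w\<in>words m n. \<Sum>j\<in>{1..m}. P (f (w @ [j]) ` K))"
    by (intro sum_mono children_measure_ge words_W)
  also have "\<dots> = (\<Sum>(w, j)\<in>words m n \<times> {1..m}. P (f (w @ [j]) ` K))"
    by (simp add: sum.cartesian_product)
  also have "\<dots> = level_sum (Suc n)"
    unfolding level_sum_def words_Suc by (subst sum.reindex) (auto simp: inj_on_def case_prod_unfold)
  finally show ?thesis .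
qed

lemma level_sum_bounded: "\<exists>M. \<forall>n. level_sum n \<le> M"
proof -
  obtain M :: nat where M: "\<And>x n. card {w \<in> words m n. x \<in> f w ` K} \<le> M"
    using card_covering_words_le by blast
  have "level_sum n \<le> real M" for n
  proof -
    have "(\<Sum>w\<in>words m n. 1 * P (f w ` K)) \<le> (\<Sum>j\<in>{[]::nat list}. real M * P UNIV)"
    proof (rule sum_measure_mono)
      fix x
      have "(\<Sum>w\<in>words m n. 1 * indicator (f w ` K) x) = real (card {w \<in> words m n. x \<in> f w ` K})"
        using finite_words by (simp add: indicator_def sum.If_cases Int_def)
      also have "\<dots> \<le> real M" using M by simp
      finally show "(\<Sum>w\<in>words m n. 1 * indicator (f w ` K) x) \<le> (\<Sum>j\<in>{[]::nat list}. real M * indicator UNIV x)"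
        by simp
    qed (auto simp: finite_words sets_\<mu> cylinder_borel words_W)
    then show ?thesis by (simp add: level_sum_def P_UNIV)
  qed
  then show ?thesis by blast
qed

lemma P_overlap: "P overlap = 0"
proof (rule ccontr)
  assume "P overlap \<noteq> 0"
  then have pos: "0 < P overlap / C1\<^sup>2" using C1_ge_1 measure_nonneg[of \<mu> overlap] by (simp add: order_less_le)
  have grow: "real n * (P overlap / C1\<^sup>2) \<le> level_sum n" for n
  proof (induction n)
    case 0
    show ?case using level_sum_ge_1[of 0] by simp
  next
    case (Suc n)
    have "real (Suc n) * (P overlap / C1\<^sup>2) = real n * (P overlap / C1\<^sup>2) + P overlap / C1\<^sup>2"
      by (simp add: distrib_right add_divide_distrib)
    then show ?case using level_sum_Suc[of n] Suc by linarith
  qed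
  obtain M where M: "\<And>n. level_sum n \<le> M" using level_sum_bounded by blast
  obtain n where "M < real n * (P overlap / C1\<^sup>2)" using reals_Archimedean3[OF pos] by blast
  then show False using M[of n] grow[of n] by simp
qed

definition doubly_covered :: "nat \<Rightarrow> 'a set" where
  "doubly_covered n = (\<Union>(w, w')\<in>{(w, w'). w \<in> words m n \<and> w' \<in> words m n \<and> w \<noteq> w'}. f w ` K \<inter> f w' ` K)"

lemma doubly_covered_compact: "compact (doubly_covered n)"
  unfolding doubly_covered_def
proof (intro compact_UN)
  show "finite {(w, w'). w \<in> words m n \<and> w' \<in> words m n \<and> w \<noteq> w'}"
    by (rule finite_subset[of _ "words m n \<times> words m n"]) (auto simp: finite_words)
qed (auto intro!: compact_Int cylinder_compact words_W)

lemma doubly_covered_subset: "doubly_covered n \<subseteq> K"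
  using f_K words_W by (auto simp: doubly_covered_def)

lemma doubly_covered_Suc: "doubly_covered (Suc n) \<subseteq> overlap \<union> (\<Union>j\<in>{1..m}. f [j] ` doubly_covered n)"
proof
  fix x assume "x \<in> doubly_covered (Suc n)"
  then obtain v w where vw: "v \<in> words m (Suc n)" "w \<in> words m (Suc n)" "v \<noteq> w"
      "x \<in> f v ` K" "x \<in> f w ` K" by (auto simp: doubly_covered_def)
  then obtain i v' j w' where eq: "v = i # v'" "w = j # w'" by (cases v; cases w) (auto simp: words_def)
  then have W: "i \<in> {1..m}" "j \<in> {1..m}" "v' \<in> words m n" "w' \<in> words m n"
    using vw by (auto simp: words_def)
  obtain y z where yz: "y \<in> K" "z \<in> K" "x = \<phi> i (f v' y)" "x = \<phi> j (f w' z)"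
    using vw eq by auto
  have K': "f v' y \<in> K" "f w' z \<in> K" using f_K words_W W yz by auto
  show "x \<in> overlap \<union> (\<Union>j\<in>{1..m}. f [j] ` doubly_covered n)"
  proof (cases "i = j")
    case False
    then have "x \<in> overlap" unfolding overlap_def using yz K' W by blast
    then show ?thesis by simp
  next
    case True
    then have "f v' y = f w' z" using inj[of i] yz K' W K_subset by (auto simp: inj_on_def subset_iff)
    moreover have "v' \<noteq> w'" using vw eq True by simp
    ultimately have "f v' y \<in> doubly_covered n" unfolding doubly_covered_def using W yz by fastforce
    then show ?thesis using yz(3) W by auto
  qed
qed

lemma P_doubly_covered: "P (doubly_covered n) = 0"
proof (induction n)
  case 0
  have "doubly_covered 0 = {}" by (auto simp: doubly_covered_def words_def)
  then show ?case by simp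
next
  case (Suc n)
  have sets: "overlap \<in> sets borel" "\<And>j. j \<in> {1..m} \<Longrightarrow> f [j] ` doubly_covered n \<in> sets borel"
    using overlap_compact f_image_compact[of "[_]", OF _ doubly_covered_compact doubly_covered_subset]
    by (auto simp: borel_compact)
  have "P (f [j] ` doubly_covered n) = 0" if "j \<in> {1..m}" for j
    using P_image_upper[of "[j]", OF _ doubly_covered_compact doubly_covered_subset, of n] that Suc
      measure_nonneg[of \<mu> "f [j] ` doubly_covered n"] by (simp add: order_antisym)
  then have "(\<Sum>j\<in>{1..m}. P (f [j] ` doubly_covered n)) = 0" by (intro sum.neutral) auto
  moreover have "P (\<Union>j\<in>{1..m}. f [j] ` doubly_covered n) \<le> (\<Sum>j\<in>{1..m}. P (f [j] ` doubly_covered n))"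
    using sets by (intro finite_measure_subadditive_finite) (auto simp: sets_\<mu>)
  moreover have "P (doubly_covered (Suc n)) \<le> P (overlap \<union> (\<Union>j\<in>{1..m}. f [j] ` doubly_covered n))"
    using sets by (intro P_mono doubly_covered_Suc sets.Un sets.finite_UN) auto
  moreover have "P (overlap \<union> (\<Union>j\<in>{1..m}. f [j] ` doubly_covered n)) \<le> P overlap + P (\<Union>j\<in>{1..m}. f [j] ` doubly_covered n)"
    using sets by (intro measure_Un_le) (auto simp: sets_\<mu>)
  ultimately show ?case using P_overlap measure_nonneg[of \<mu> "doubly_covered (Suc n)"] by linarith
qed

lemma G_eq: "G = K - (\<Union>n. doubly_covered n)"
  by (auto simp: G_def doubly_covered_def; blast)

lemma doubly_covered_borel: "doubly_covered n \<in> sets borel"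
  by (simp add: borel_compact doubly_covered_compact)

lemma G_borel: "G \<in> sets borel"
  unfolding G_eq using K_borel doubly_covered_borel by auto

lemma \<mu>_outside_G: "emeasure \<mu> (- G) = 0"
proof -
  have "emeasure \<mu> (\<Union>n. doubly_covered n) = 0"
    using P_doubly_covered doubly_covered_borel by (intro emeasure_UN_eq_0) (auto simp: emeasure_eq_measure sets_\<mu>)
  moreover have "- G = - K \<union> (\<Union>n. doubly_covered n)" using doubly_covered_subset by (auto simp: G_eq)
  ultimately show ?thesis
    using \<mu>_outside K_borel doubly_covered_borel
    by (simp add: null_setsI[THEN emeasure_Un_null_set[rotated]] sets_\<mu> null_sets_def emeasure_Un_null_set)
qed

lemma P_inter_G: "A \<in> sets borel \<Longrightarrow> P (A \<inter> G) = P A"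
  by (rule P_inter_full[OF _ G_borel \<mu>_outside_G])

end

section \<open>Measures of balls\<close>

lemma powr_add_le:
  fixes x y t :: real
  assumes "0 \<le> x" "0 \<le> y" "0 < t"
  shows "(x + y) powr t \<le> 2 powr t * (x powr t + y powr t)"
proof -
  have "(x + y) powr t \<le> (2 * max x y) powr t" using assms by (intro powr_mono2) auto
  also have "\<dots> = 2 powr t * max x y powr t" using assms by (intro powr_mult)
  also have "\<dots> \<le> 2 powr t * (x powr t + y powr t)" by (intro mult_left_mono) (auto simp: max_def)
  finally show ?thesis .
qed

lemma sum_geometric_le:
  fixes x :: real
  assumes "0 \<le> x" "x < 1" "finite J" and inj: "inj_on g J"
  shows "(\<Sum>n\<in>J. x ^ g n) \<le> 1 / (1 - x)"
proof -
  have "(\<Sum>n\<in>J. x ^ g n) = (\<Sum>k\<in>g ` J. x ^ k)" using inj by (simp add: sum.reindex)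
  also have "\<dots> \<le> (\<Sum>k. x ^ k)" using assms by (intro sum_le_suminf summable_geometric) auto
  finally show ?thesis using assms by (simp add: suminf_geometric)
qed

context regular_ifs begin

text \<open>A cylinder through \<open>x\<close> at a scale slightly below \<open>r\<close> fits into the ball.\<close>

lemma ball_lower: "\<exists>B>0. \<forall>x\<in>K. \<forall>r. 0 < r \<and> r \<le> 1 \<longrightarrow> B * r powr \<tau> \<le> P (cball x r)"
proof -
  obtain \<theta> where \<theta>: "0 < \<theta>" "\<And>r w. r < 1 \<Longrightarrow> w \<in> scale_words r \<Longrightarrow> \<theta> * r \<le> L w"
    using scale_words_lower by metis
  \<comment> \<open>cylinders of scale \<open>e r\<close> have diameter at most \<open>D (e r) diamQ = r / 2\<close>, and \<open>e < 1\<close>\<close>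
  define e where "e = 1 / (2 * D * diamQ)"
  have diamQ_ge_1: "1 \<le> diamQ" using diameter_ge_0[OF Q_bounded] by (simp add: diamQ_def)
  have DQ: "1 * 1 \<le> D * diamQ" using D_ge_1 diamQ_ge_1 by (intro mult_mono) auto
  then have e: "0 < e" "e < 1" by (auto simp: e_def)
  have "(\<theta> * e) powr \<tau> / C1 * r powr \<tau> \<le> P (cball x r)" if x: "x \<in> K" and r: "0 < r" "r \<le> 1" for x r
  proof -
    have er: "0 < e * r" "e * r < 1" using e r mult_less_le_imp_less[of e 1 r 1] by auto
    obtain i where i: "i \<in> code_space m" "\<And>n. x \<in> f (code_prefix i n) ` K"
      using exists_code[OF x] by metis
    obtain n where n: "code_prefix i n \<in> scale_words (e * r)" using code_hits_scale_words[OF i(1) er(1)] .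
    define w where "w = code_prefix i n"
    have w: "w \<in> scale_words (e * r)" "x \<in> f w ` K" using n i by (auto simp: w_def)
    then have W: "w \<in> W" and Lw: "L w \<le> e * r" by (auto simp: scale_words_def)
    have sub: "f w ` K \<subseteq> cball x r"
    proof
      fix y assume "y \<in> f w ` K"
      then obtain x' y' where xy: "x' \<in> K" "y' \<in> K" "x = f w x'" "y = f w y'" using w by auto
      have "dist x y \<le> D * L w * dist x' y'" using f_upper[OF W, of x' y'] xy K_subset by auto
      also have "\<dots> \<le> D * (e * r) * diamQ"
        using Lw xy K_subset D_ge_1 L_pos[OF W] diamQ_pos er by (intro mult_mono dist_le_diamQ mult_left_mono mult_nonneg_nonneg) (use e r in auto)
      also have "\<dots> = r / 2" using D_ge_1 diamQ_pos by (simp add: e_def)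
      finally show "y \<in> cball x r" using r by simp
    qed
    have "(\<theta> * e) powr \<tau> / C1 * r powr \<tau> = (\<theta> * (e * r)) powr \<tau> / C1"
      using \<theta> e r by (simp add: powr_mult mult_ac)
    also have "\<dots> \<le> q w / C1"
      unfolding q_def using \<theta>(2)[OF er(2) w(1)] \<theta>(1) er \<tau>_pos C1_ge_1
      by (intro divide_right_mono powr_mono2) auto
    also have "\<dots> \<le> P (f w ` K)" using cylinder_lower[OF W] C1_ge_1 by (simp add: field_simps)
    also have "\<dots> \<le> P (cball x r)" by (intro P_mono sub) (simp add: borel_closed)
    finally show ?thesis .
  qed
  moreover have "0 < (\<theta> * e) powr \<tau> / C1" using \<theta> e C1_ge_1 by simp
  ultimately show ?thesis by blast
qed

text \<open>The ball is covered by the boundedly many cylinders of scale \<open>r\<close> that meet it, and each of them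
  has measure at most a constant times \<open>r\<^sup>\<tau>\<close>.\<close>

lemma ball_upper: "\<exists>A>0. \<forall>x r. 0 < r \<longrightarrow> P (cball x r) \<le> A * r powr \<tau>"
proof -
  obtain M :: nat where M: "\<And>x r F. 0 < r \<and> r < 1 \<and> F \<subseteq> {w \<in> scale_words r. f w ` K \<inter> cball x r \<noteq> {}} \<Longrightarrow>
      finite F \<and> card F \<le> M"
    using card_scale_words_le by blast
  have "P (cball x r) \<le> (real M * C1 + 1) * r powr \<tau>" if r: "0 < r" for x r
  proof (cases "r < 1")
    case True
    define F where "F = {w \<in> scale_words r. f w ` K \<inter> cball x r \<noteq> {}}"
    have F: "finite F" "card F \<le> M" using M[of r F x] r True by (auto simp: F_def)
    have W: "w \<in> W" if "w \<in> F" for w using that by (auto simp: F_def scale_words_def)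
    have cover: "cball x r \<inter> K \<subseteq> (\<Union>w\<in>F. f w ` K)"
    proof
      fix y assume y: "y \<in> cball x r \<inter> K"
      then obtain i where i: "i \<in> code_space m" "\<And>n. y \<in> f (code_prefix i n) ` K"
        using exists_code[of y] by blast
      obtain n where n: "code_prefix i n \<in> scale_words r" using code_hits_scale_words[OF i(1) r] .
      then have "code_prefix i n \<in> F" using i(2) y unfolding F_def by blast
      then show "y \<in> (\<Union>w\<in>F. f w ` K)" using i(2) by blast
    qed
    have "P (cball x r) = P (cball x r \<inter> K)" by (simp add: P_inter_K borel_closed)
    also have "\<dots> \<le> P (\<Union>w\<in>F. f w ` K)"
      using F W cylinder_borel by (intro P_mono cover sets.finite_UN) auto
    also have "\<dots> \<le> (\<Sum>w\<in>F. P (f w ` K))"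
      using F W cylinder_borel by (intro finite_measure_subadditive_finite) (auto simp: sets_\<mu>)
    also have "\<dots> \<le> (\<Sum>w\<in>F. C1 * r powr \<tau>)"
    proof (rule sum_mono)
      fix w assume w: "w \<in> F"
      then have "L w \<le> r" by (auto simp: F_def scale_words_def)
      then have "q w \<le> r powr \<tau>" unfolding q_def using L_pos[OF W[OF w]] \<tau>_pos by (intro powr_mono2) auto
      then have "C1 * q w \<le> C1 * r powr \<tau>" using C1_ge_1 by simp
      then show "P (f w ` K) \<le> C1 * r powr \<tau>" using cylinder_upper[OF W[OF w]] by simp
    qed
    also have "\<dots> = real (card F) * (C1 * r powr \<tau>)" by simp
    also have "\<dots> \<le> real M * (C1 * r powr \<tau>)" using F C1_ge_1 by (intro mult_right_mono) auto
    also have "\<dots> \<le> (real M * C1 + 1) * r powr \<tau>" by (simp add: algebra_simps)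
    finally show ?thesis .
  next
    case False
    then have "1 \<le> r powr \<tau>" using \<tau>_pos by (intro ge_one_powr_ge_zero) auto
    then have "1 * 1 \<le> (real M * C1 + 1) * r powr \<tau>" using C1_ge_1 by (intro mult_mono) auto
    then show ?thesis using P_le_1[of "cball x r"] by simp
  qed
  moreover have "0 < real M * C1 + 1" using C1_ge_1 by (simp add: add_nonneg_pos)
  ultimately show ?thesis by blast
qed

section \<open>Points that return at a given time\<close>

text \<open>On the uniquely coded points \<open>T\<close> is inverted by the maps \<open>\<phi>\<^sub>j\<close>, so that preimages are images of
  compact sets; measurability of \<open>T\<close> follows.\<close>

lemma T_preimage_closed:
  assumes S: "closed S"
  shows "{x \<in> G. T x \<in> S} = G \<inter> (\<Union>j\<in>{1..m}. f [j] ` (K \<inter> S))"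
proof (intro equalityI subsetI)
  fix x assume x: "x \<in> {x \<in> G. T x \<in> S}"
  then have "x \<in> K" using G_subset_K by auto
  then obtain j y where j: "j \<in> {1..m}" "y \<in> K" "x = \<phi> j y" using K_eq by blast
  then have "T x = y" using T_step[of x j y] x by auto
  then show "x \<in> G \<inter> (\<Union>j\<in>{1..m}. f [j] ` (K \<inter> S))" using j x by auto
next
  fix x assume x: "x \<in> G \<inter> (\<Union>j\<in>{1..m}. f [j] ` (K \<inter> S))"
  then obtain j y where j: "j \<in> {1..m}" "y \<in> K" "y \<in> S" "x = \<phi> j y" by auto
  then show "x \<in> {x \<in> G. T x \<in> S}" using T_step[of x j y] x by auto
qed

lemma T_measurable: "T \<in> borel_measurable borel"
proof (rule borel_measurableI)
  fix S :: "'a set" assume "open S"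
  then have cl: "closed (- S)" by auto
  have "compact (f [j] ` (K \<inter> - S))" if "j \<in> {1..m}" for j
    using that K_compact cl by (intro f_image_compact compact_Int_closed) auto
  then have "G \<inter> (\<Union>j\<in>{1..m}. f [j] ` (K \<inter> - S)) \<in> sets borel"
    by (intro sets.Int G_borel sets.finite_UN borel_compact) auto
  then have meas: "{x \<in> G. T x \<in> - S} \<in> sets borel"
    by (simp only: T_preimage_closed[OF cl])
  have eq: "T -` S \<inter> space borel = (G - {x \<in> G. T x \<in> - S}) \<union> (S - G)"
    using T_outside by (auto; metis)
  show "T -` S \<inter> space borel \<in> sets borel"
    unfolding eq using meas G_borel \<open>open S\<close> by auto
qed

lemma T_funpow_measurable: "(T ^^ n) \<in> borel_measurable borel"
proof (induction n)
  case (Suc n)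
  then show ?case using measurable_comp[OF Suc T_measurable] by (simp add: comp_def)
qed simp

definition returning :: "real \<Rightarrow> nat \<Rightarrow> 'a set" where
  "returning r n = {x \<in> G. dist x ((T ^^ n) x) < r}"

lemma dist_T_borel: "{x. dist x ((T ^^ n) x) < r} \<in> sets borel"
proof -
  have "(\<lambda>x. dist x ((T ^^ n) x)) \<in> borel_measurable borel"
    by (intro borel_measurable_dist T_funpow_measurable) simp
  then show ?thesis by (simp add: borel_measurable_iff_less)
qed

lemma returning_borel: "returning r n \<in> sets borel"
proof -
  have "returning r n = G \<inter> {x. dist x ((T ^^ n) x) < r}" by (auto simp: returning_def)
  then show ?thesis using G_borel dist_T_borel by simp
qed

lemma T_word:
  assumes "w \<in> words m n" "x \<in> G" "x \<in> f w ` K"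
  shows "(T ^^ n) x \<in> G" "f w ((T ^^ n) x) = x"
  using T_iterate[of w x] assms by (auto simp: words_def)

text \<open>If \<open>\<phi>\<^sub>w\<close> moves both \<open>y\<close> and \<open>y\<^sub>0\<close> by less than \<open>r\<close>, then \<open>|y - y\<^sub>0| \<le> 2r + c |y - y\<^sub>0|\<close>.\<close>

lemma returning_in_ball_image:
  assumes n: "1 \<le> n" and w: "w \<in> words m n"
  obtains y0 where "returning r n \<inter> f w ` K \<subseteq> f w ` (K \<inter> cball y0 (2 / (1 - c) * r))"
proof (cases "returning r n \<inter> f w ` K = {}")
  case False
  then obtain x0 where x0: "x0 \<in> returning r n" "x0 \<in> f w ` K" by auto
  define y0 where "y0 = (T ^^ n) x0"
  have y0: "y0 \<in> G" "f w y0 = x0" "dist x0 y0 < r"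
    using T_word[OF w] x0 by (auto simp: y0_def returning_def)
  have "x \<in> f w ` (K \<inter> cball y0 (2 / (1 - c) * r))" if "x \<in> returning r n \<inter> f w ` K" for x
  proof -
    define y where "y = (T ^^ n) x"
    have y: "y \<in> G" "f w y = x" "dist x y < r"
      using T_word[OF w] that by (auto simp: y_def returning_def)
    have "dist (f w y) (f w y0) \<le> c ^ length w * dist y y0"
      using y y0 G_subset_K K_subset words_W[OF w] by (intro f_contraction) auto
    also have "\<dots> \<le> c ^ 1 * dist y y0"
      using w n c_pos c_less by (intro mult_right_mono power_decreasing) (auto simp: words_def)
    finally have "dist x x0 \<le> c * dist y y0" using y y0 by simp
    moreover have "dist y y0 \<le> dist x y + dist x x0 + dist x0 y0"
      using dist_triangle[of y y0 x] dist_triangle[of x y0 x0] by (simp add: dist_commute)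
    ultimately have "(1 - c) * dist y y0 \<le> 2 * r" using y y0 by (simp add: algebra_simps)
    then have "dist y0 y \<le> 2 / (1 - c) * r" using c_less by (simp add: field_simps dist_commute)
    then show ?thesis using y G_subset_K by auto
  qed
  then show ?thesis using that by blast
qed (use that in blast)

text \<open>The centre is the fixed point \<open>z\<close> of \<open>\<phi>\<^sub>w\<close>: if \<open>y\<close> is within \<open>r / 3\<close> of \<open>z\<close>, so is its image.\<close>

lemma ball_image_in_returning:
  assumes w: "w \<in> words m n" and r: "0 < r" and n: "1 \<le> n"
  obtains z where "z \<in> K" "f w ` (K \<inter> cball z (r / 3)) \<inter> G \<subseteq> returning r n"
proof -
  have W: "w \<in> W" using words_W[OF w] .
  have "\<exists>!z\<in>K. f w z = z"
  proof (rule Banach_fix)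
    show "complete K" using K_compact by (rule compact_imp_complete)
    show "f w ` K \<subseteq> K" using f_K[OF W] by auto
    show "dist (f w x) (f w y) \<le> c * dist x y" if "x \<in> K" "y \<in> K" for x y
    proof -
      have "dist (f w x) (f w y) \<le> c ^ length w * dist x y"
        using that K_subset by (intro f_contraction W) auto
      also have "\<dots> \<le> c ^ 1 * dist x y"
        using w n c_pos c_less by (intro mult_right_mono power_decreasing) (auto simp: words_def)
      finally show ?thesis by simp
    qed
  qed (use K_nonempty c_pos c_less in auto)
  then obtain z where z: "z \<in> K" "f w z = z" by blast
  have "x \<in> returning r n" if x: "x \<in> f w ` (K \<inter> cball z (r / 3)) \<inter> G" for x
  proof -
    obtain y where y: "y \<in> K" "dist z y \<le> r / 3" "x = f w y" using x by auto
    have "x \<in> f w ` K" using y by auto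
    then have T: "(T ^^ n) x \<in> G" "f w ((T ^^ n) x) = f w y" using T_word[OF w] x y by auto
    then have Ty: "(T ^^ n) x = y"
      using f_inj[OF W] y G_subset_K K_subset unfolding inj_on_def by blast
    have "dist (f w z) (f w y) \<le> c ^ length w * dist z y"
      using y z K_subset W by (intro f_contraction) auto
    also have "\<dots> \<le> 1 * dist z y"
      using c_pos c_less by (intro mult_right_mono power_le_one) auto
    finally have "dist z x \<le> r / 3" using y z by simp
    then have "dist x y < r" using y(2) r dist_triangle[of x y z] by (simp add: dist_commute)
    then show ?thesis using Ty x by (simp add: returning_def)
  qed
  then show ?thesis using that z by blast
qed

lemma returning_cylinder_upper:
  "\<exists>A>0. \<forall>r n w. 0 \<le> r \<and> 1 \<le> n \<and> w \<in> words m n \<longrightarrow> P (returning r n \<inter> f w ` K) \<le> A * q w * r powr \<tau>"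
proof -
  obtain A where A: "0 < A" "\<And>x r. 0 < r \<Longrightarrow> P (cball x r) \<le> A * r powr \<tau>" using ball_upper by blast
  define \<rho> where "\<rho> = 2 / (1 - c)"
  have \<rho>: "0 < \<rho>" using c_less by (simp add: \<rho>_def)
  have "P (returning r n \<inter> f w ` K) \<le> C1 * A * \<rho> powr \<tau> * q w * r powr \<tau>"
    if r: "0 \<le> r" and n: "1 \<le> n" and w: "w \<in> words m n" for r n w
  proof (cases "r = 0")
    case True
    then show ?thesis by (simp add: returning_def)
  next
    case False
    then have \<rho>r: "0 < \<rho> * r" using r \<rho> by simp
    obtain y0 where y0: "returning r n \<inter> f w ` K \<subseteq> f w ` (K \<inter> cball y0 (\<rho> * r))"
      using returning_in_ball_image[OF n w] unfolding \<rho>_def by metis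
    have cpt: "compact (K \<inter> cball y0 (\<rho> * r))" using K_compact by (intro compact_Int_closed) auto
    have "P (returning r n \<inter> f w ` K) \<le> P (f w ` (K \<inter> cball y0 (\<rho> * r)))"
      using f_image_compact[OF words_W[OF w] cpt] by (intro P_mono y0 borel_compact) auto
    also have "\<dots> \<le> C1 * q w * P (K \<inter> cball y0 (\<rho> * r))"
      using cpt by (intro P_image_upper words_W[OF w]) auto
    also have "\<dots> \<le> C1 * q w * P (cball y0 (\<rho> * r))"
      using C1_ge_1 q_pos[OF words_W[OF w]] by (intro mult_left_mono P_mono) (auto simp: borel_closed)
    also have "\<dots> \<le> C1 * q w * (A * (\<rho> * r) powr \<tau>)"
      using C1_ge_1 q_pos[OF words_W[OF w]] \<rho>r by (intro mult_left_mono A) auto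
    also have "\<dots> = C1 * A * \<rho> powr \<tau> * q w * r powr \<tau>" using r \<rho> by (simp add: powr_mult)
    finally show ?thesis .
  qed
  moreover have "0 < C1 * A * \<rho> powr \<tau>" using C1_ge_1 A \<rho> by simp
  ultimately show ?thesis by blast
qed

lemma returning_cylinder_lower:
  "\<exists>B>0. \<forall>r n w. 0 \<le> r \<and> r \<le> 1 \<and> 1 \<le> n \<and> w \<in> words m n \<longrightarrow> B * q w * r powr \<tau> \<le> P (returning r n \<inter> f w ` K)"
proof -
  obtain B where B: "0 < B" "\<And>x r. x \<in> K \<Longrightarrow> 0 < r \<Longrightarrow> r \<le> 1 \<Longrightarrow> B * r powr \<tau> \<le> P (cball x r)"
    using ball_lower by blast
  have "B * (1 / 3) powr \<tau> / C1 * q w * r powr \<tau> \<le> P (returning r n \<inter> f w ` K)"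
    if r: "0 \<le> r" "r \<le> 1" and n: "1 \<le> n" and w: "w \<in> words m n" for r n w
  proof (cases "r = 0")
    case False
    then have r': "0 < r" using r by simp
    have W: "w \<in> W" using words_W[OF w] .
    obtain z where z: "z \<in> K" "f w ` (K \<inter> cball z (r / 3)) \<inter> G \<subseteq> returning r n"
      using ball_image_in_returning[OF w r' n] .
    have cpt: "compact (K \<inter> cball z (r / 3))" using K_compact by (intro compact_Int_closed) auto
    then have b: "f w ` (K \<inter> cball z (r / 3)) \<in> sets borel"
      using f_image_compact[OF W cpt] by (simp add: borel_compact)
    have "B * (1 / 3) powr \<tau> * r powr \<tau> = B * (r / 3) powr \<tau>"
      using r' by (simp add: powr_divide)
    also have "\<dots> \<le> P (cball z (r / 3))" using r r' by (intro B z) auto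
    also have "\<dots> = P (K \<inter> cball z (r / 3))" by (simp add: P_inter_K[symmetric] Int_commute borel_closed)
    finally have "q w * (B * (1 / 3) powr \<tau> * r powr \<tau>) \<le> q w * P (K \<inter> cball z (r / 3))"
      using q_pos[OF W] by (intro mult_left_mono) auto
    also have "\<dots> \<le> C1 * P (f w ` (K \<inter> cball z (r / 3)))"
      using cpt by (intro P_image_lower W) auto
    also have "P (f w ` (K \<inter> cball z (r / 3))) = P (f w ` (K \<inter> cball z (r / 3)) \<inter> G)"
      using b by (simp add: P_inter_G)
    also have "\<dots> \<le> P (returning r n \<inter> f w ` K)"
      using z returning_borel cylinder_borel[OF W] by (intro P_mono) auto
    finally show ?thesis using C1_ge_1 by (simp add: field_simps)
  qed simp
  moreover have "0 < B * (1 / 3) powr \<tau> / C1" using B C1_ge_1 by simp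
  ultimately show ?thesis by blast
qed

lemma P_cylinder_split:
  assumes S: "S \<in> sets borel" and u: "u \<in> W"
  shows "P (S \<inter> f u ` K) = (\<Sum>w\<in>words m l. P (S \<inter> f (u @ w) ` K))"
proof -
  have W: "u @ w \<in> W" if "w \<in> words m l" for w using u words_W[OF that] by simp
  have un: "S \<inter> f u ` K \<inter> G = (\<Union>w\<in>words m l. S \<inter> f (u @ w) ` K \<inter> G)"
  proof (intro equalityI subsetI)
    fix x assume x: "x \<in> S \<inter> f u ` K \<inter> G"
    then obtain y where y: "y \<in> K" "x = f u y" by auto
    then obtain w where "w \<in> words m l" "y \<in> f w ` K" using K_covered by blast
    then show "x \<in> (\<Union>w\<in>words m l. S \<inter> f (u @ w) ` K \<inter> G)"
      using x y by (auto simp: compose_word_append)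
  next
    fix x assume "x \<in> (\<Union>w\<in>words m l. S \<inter> f (u @ w) ` K \<inter> G)"
    then show "x \<in> S \<inter> f u ` K \<inter> G" using f_image_append_subset words_W by blast
  qed
  have disj: "disjoint_family_on (\<lambda>w. S \<inter> f (u @ w) ` K \<inter> G) (words m l)"
  proof (unfold disjoint_family_on_def, intro ballI impI)
    fix w w' assume ww: "w \<in> words m l" "w' \<in> words m l" "w \<noteq> w'"
    have "u @ w = u @ w'" if "x \<in> G" "x \<in> f (u @ w) ` K" "x \<in> f (u @ w') ` K" for x
      using G_D[OF that(1) W W _ that(2,3)] ww by (simp add: words_def)
    then show "S \<inter> f (u @ w) ` K \<inter> G \<inter> (S \<inter> f (u @ w') ` K \<inter> G) = {}" using ww by blast
  qed
  have sets: "S \<inter> f (u @ w) ` K \<in> sets borel" if "w \<in> words m l" for w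
    using S cylinder_borel[OF W[OF that]] by simp
  have "P (S \<inter> f u ` K) = P (S \<inter> f u ` K \<inter> G)"
    using S cylinder_borel[OF u] by (subst P_inter_G) auto
  also have "\<dots> = (\<Sum>w\<in>words m l. P (S \<inter> f (u @ w) ` K \<inter> G))"
    unfolding un using sets G_borel finite_words disj
    by (intro finite_measure_finite_Union) (auto simp: sets_\<mu>)
  also have "\<dots> = (\<Sum>w\<in>words m l. P (S \<inter> f (u @ w) ` K))"
    using sets by (intro sum.cong refl P_inter_G) auto
  finally show ?thesis .
qed

lemma sum_q_bounds:
  assumes u: "u \<in> W"
  shows "(\<Sum>w\<in>words m l. q (u @ w)) \<le> C1 * P (f u ` K)"
    and "P (f u ` K) \<le> C1 * (\<Sum>w\<in>words m l. q (u @ w))"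
proof -
  have split: "P (f u ` K) = (\<Sum>w\<in>words m l. P (f (u @ w) ` K))"
    using P_cylinder_split[of UNIV u l] u by simp
  have W: "u @ w \<in> W" if "w \<in> words m l" for w using u words_W[OF that] by simp
  show "(\<Sum>w\<in>words m l. q (u @ w)) \<le> C1 * P (f u ` K)"
    unfolding split sum_distrib_left by (intro sum_mono cylinder_lower W)
  show "P (f u ` K) \<le> C1 * (\<Sum>w\<in>words m l. q (u @ w))"
    unfolding split sum_distrib_left by (intro sum_mono cylinder_upper W)
qed

lemma append_words: "u \<in> words m k \<Longrightarrow> w \<in> words m (n - k) \<Longrightarrow> k \<le> n \<Longrightarrow> u @ w \<in> words m n"
  by (auto simp: words_def)

lemma returning_upper:
  "\<exists>A>0. \<forall>r n k u. 0 \<le> r \<and> 1 \<le> n \<and> k \<le> n \<and> u \<in> words m k \<longrightarrow>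
     P (returning r n \<inter> f u ` K) \<le> A * r powr \<tau> * P (f u ` K)"
proof -
  obtain A where A: "0 < A" "\<And>r n w. 0 \<le> r \<and> 1 \<le> n \<and> w \<in> words m n \<Longrightarrow>
      P (returning r n \<inter> f w ` K) \<le> A * q w * r powr \<tau>" using returning_cylinder_upper by blast
  have "P (returning r n \<inter> f u ` K) \<le> A * C1 * r powr \<tau> * P (f u ` K)"
    if r: "0 \<le> r" and n: "1 \<le> n" "k \<le> n" and u: "u \<in> words m k" for r n k u
  proof -
    have "P (returning r n \<inter> f u ` K) = (\<Sum>w\<in>words m (n - k). P (returning r n \<inter> f (u @ w) ` K))"
      by (rule P_cylinder_split[OF returning_borel words_W[OF u]])
    also have "\<dots> \<le> (\<Sum>w\<in>words m (n - k). A * q (u @ w) * r powr \<tau>)"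
      using r n append_words[OF u] by (intro sum_mono A) auto
    also have "\<dots> = A * r powr \<tau> * (\<Sum>w\<in>words m (n - k). q (u @ w))"
      by (simp add: sum_distrib_left mult_ac)
    also have "\<dots> \<le> A * r powr \<tau> * (C1 * P (f u ` K))"
      using A sum_q_bounds(1)[OF words_W[OF u]] by (intro mult_left_mono) auto
    finally show ?thesis by (simp add: mult_ac)
  qed
  moreover have "0 < A * C1" using A C1_ge_1 by simp
  ultimately show ?thesis by blast
qed

lemma returning_lower:
  "\<exists>B>0. \<forall>r n k u. 0 \<le> r \<and> r \<le> 1 \<and> 1 \<le> n \<and> k \<le> n \<and> u \<in> words m k \<longrightarrow>
     B * r powr \<tau> * P (f u ` K) \<le> P (returning r n \<inter> f u ` K)"
proof -
  obtain B where B: "0 < B" "\<And>r n w. 0 \<le> r \<and> r \<le> 1 \<and> 1 \<le> n \<and> w \<in> words m n \<Longrightarrow>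
      B * q w * r powr \<tau> \<le> P (returning r n \<inter> f w ` K)" using returning_cylinder_lower by blast
  have "B / C1 * r powr \<tau> * P (f u ` K) \<le> P (returning r n \<inter> f u ` K)"
    if r: "0 \<le> r" "r \<le> 1" and n: "1 \<le> n" "k \<le> n" and u: "u \<in> words m k" for r n k u
  proof -
    have "B / C1 * r powr \<tau> * P (f u ` K) \<le> B / C1 * r powr \<tau> * (C1 * (\<Sum>w\<in>words m (n - k). q (u @ w)))"
      using B C1_ge_1 sum_q_bounds(2)[OF words_W[OF u]] by (intro mult_left_mono) auto
    also have "\<dots> = (\<Sum>w\<in>words m (n - k). B * q (u @ w) * r powr \<tau>)"
      using C1_ge_1 by (simp add: sum_distrib_left mult_ac)
    also have "\<dots> \<le> (\<Sum>w\<in>words m (n - k). P (returning r n \<inter> f (u @ w) ` K))"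
      using r n append_words[OF u] by (intro sum_mono B) auto
    also have "\<dots> = P (returning r n \<inter> f u ` K)"
      by (rule P_cylinder_split[OF returning_borel words_W[OF u], symmetric])
    finally show ?thesis .
  qed
  moreover have "0 < B / C1" using B C1_ge_1 by simp
  ultimately show ?thesis by blast
qed

text \<open>A point \<open>\<phi>\<^sub>w(y)\<close> that returns at time \<open>n\<close> has \<open>y\<close> in a ball of radius of order \<open>r\<close>. A later
  return at time \<open>l\<close> takes place in cylinders of words \<open>wv\<close> such that the cylinder of \<open>v\<close> meets this
  ball, and has conditional measure of order \<open>s\<^sup>\<tau>\<close> in each of them. The cylinders of these \<open>v\<close> lie
  in the ball enlarged by their diameter, which is of order \<open>c\<^sup>l\<^sup>-\<^sup>n\<close>; this is the source of the
  geometric error.\<close>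

lemma returning_pair_upper:
  "\<exists>A>0. \<forall>r s n l k u. 0 \<le> r \<and> 0 \<le> s \<and> 1 \<le> n \<and> k \<le> n \<and> n < l \<and> u \<in> words m k \<longrightarrow>
     P (returning r n \<inter> returning s l \<inter> f u ` K)
       \<le> A * s powr \<tau> * (r powr \<tau> + (c powr \<tau>) ^ (l - n)) * P (f u ` K)"
proof -
  obtain A where A: "0 < A" "\<And>x r. 0 < r \<Longrightarrow> P (cball x r) \<le> A * r powr \<tau>" using ball_upper by blast
  obtain A' where A': "0 < A'" "\<And>r n w. 0 \<le> r \<and> 1 \<le> n \<and> w \<in> words m n \<Longrightarrow>
      P (returning r n \<inter> f w ` K) \<le> A' * q w * r powr \<tau>" using returning_cylinder_upper by blast
  define \<rho> where "\<rho> = 2 / (1 - c)"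
  have \<rho>: "0 < \<rho>" using c_less by (simp add: \<rho>_def)
  define \<gamma> where "\<gamma> = c powr \<tau>"
  define H where "H = max (\<rho> powr \<tau>) (diamQ powr \<tau>)"
  have H: "0 < H" "\<rho> powr \<tau> \<le> H" "diamQ powr \<tau> \<le> H" using \<rho> by (auto simp: H_def less_max_iff_disj)
  define A2 where "A2 = A' * D powr \<tau> * C1 * A * 2 powr \<tau> * H"
  have A2: "0 < A2" using A A' D_ge_1 C1_ge_1 H by (simp add: A2_def)
  have word: "P (returning r n \<inter> returning s l \<inter> f w ` K) \<le> A2 * s powr \<tau> * (r powr \<tau> + \<gamma> ^ (l - n)) * q w"
    if r: "0 \<le> r" and s: "0 \<le> s" and n: "1 \<le> n" "n < l" and w: "w \<in> words m n" for r s n l w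
  proof -
    have W: "w \<in> W" using words_W[OF w] .
    obtain y0 where y0: "returning r n \<inter> f w ` K \<subseteq> f w ` (K \<inter> cball y0 (\<rho> * r))"
      using returning_in_ball_image[OF n(1) w] unfolding \<rho>_def by metis
    define F where "F = {v \<in> words m (l - n). f v ` K \<inter> cball y0 (\<rho> * r) \<noteq> {}}"
    have F: "finite F" "F \<subseteq> words m (l - n)" by (auto simp: F_def finite_words)
    have FW: "v \<in> W" if "v \<in> F" for v using that F words_W by blast
    have wv: "w @ v \<in> words m l" if "v \<in> F" for v
      using that F append_words[OF w, of v l] n by auto
    have cover: "returning r n \<inter> returning s l \<inter> f w ` K \<subseteq> (\<Union>v\<in>F. returning s l \<inter> f (w @ v) ` K)"
    proof
      fix x assume x: "x \<in> returning r n \<inter> returning s l \<inter> f w ` K"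
      then obtain y where y: "y \<in> K" "y \<in> cball y0 (\<rho> * r)" "x = f w y" using y0 by blast
      obtain v where v: "v \<in> words m (l - n)" "y \<in> f v ` K" using K_covered y by blast
      then have "v \<in> F" using y by (auto simp: F_def)
      moreover have "x \<in> f (w @ v) ` K" using v y by (auto simp: compose_word_append)
      ultimately show "x \<in> (\<Union>v\<in>F. returning s l \<inter> f (w @ v) ` K)" using x by blast
    qed
    define R where "R = \<rho> * r + c ^ (l - n) * diamQ"
    have R: "0 < R" using \<rho> r c_pos diamQ_pos by (auto simp: R_def intro!: add_nonneg_pos)
    have ball: "f v ` K \<subseteq> cball y0 R" if v: "v \<in> F" for v
    proof
      fix z assume z: "z \<in> f v ` K"
      have "f v ` K \<inter> cball y0 (\<rho> * r) \<noteq> {}" using v by (simp add: F_def)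
      then obtain z' where "z' \<in> f v ` K" "z' \<in> cball y0 (\<rho> * r)" by blast
      then have z': "z' \<in> f v ` K" "dist y0 z' \<le> \<rho> * r" by auto
      have "length v = l - n" using v F by (auto simp: words_def)
      then have "dist z' z \<le> c ^ (l - n) * diamQ"
        using z z' dist_f_le_diamQ[OF FW[OF v]] K_subset by auto
      then show "z \<in> cball y0 R" using z' dist_triangle[of y0 z z'] by (simp add: R_def)
    qed
    have "(\<Sum>v\<in>F. P (f v ` K)) = (\<Sum>v\<in>F. P (cball y0 R \<inter> f ([] @ v) ` K))"
      using ball by (intro sum.cong refl arg_cong[where f = P]) auto
    also have "\<dots> \<le> (\<Sum>v\<in>words m (l - n). P (cball y0 R \<inter> f ([] @ v) ` K))"
      using F finite_words by (intro sum_mono2) auto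
    also have "\<dots> = P (cball y0 R \<inter> f [] ` K)"
      by (rule P_cylinder_split[symmetric]) (auto simp: borel_closed)
    also have "\<dots> = P (cball y0 R)" by (simp add: P_inter_K borel_closed)
    also have "\<dots> \<le> A * R powr \<tau>" by (rule A(2)[OF R])
    also have "\<dots> \<le> A * (2 powr \<tau> * ((\<rho> * r) powr \<tau> + (c ^ (l - n) * diamQ) powr \<tau>))"
      unfolding R_def using A \<rho> r c_pos diamQ_pos \<tau>_pos by (intro mult_left_mono powr_add_le) auto
    also have "(\<rho> * r) powr \<tau> + (c ^ (l - n) * diamQ) powr \<tau> = \<rho> powr \<tau> * r powr \<tau> + diamQ powr \<tau> * \<gamma> ^ (l - n)"
      using \<rho> r c_pos diamQ_pos by (simp add: powr_mult \<gamma>_def powr_power powr_realpow[symmetric] powr_powr mult_ac)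
    also have "A * (2 powr \<tau> * \<dots>) \<le> A * (2 powr \<tau> * (H * r powr \<tau> + H * \<gamma> ^ (l - n)))"
      using A H by (intro mult_left_mono add_mono mult_right_mono) (auto simp: \<gamma>_def)
    finally have hit: "(\<Sum>v\<in>F. P (f v ` K)) \<le> A * 2 powr \<tau> * H * (r powr \<tau> + \<gamma> ^ (l - n))"
      by (simp add: algebra_simps)
    have sets: "returning s l \<inter> f (w @ v) ` K \<in> sets borel" if "v \<in> F" for v
      using returning_borel cylinder_borel[of "w @ v"] FW[OF that] W by auto
    have "P (returning r n \<inter> returning s l \<inter> f w ` K) \<le> P (\<Union>v\<in>F. returning s l \<inter> f (w @ v) ` K)"
      using F sets by (intro P_mono cover sets.finite_UN) auto
    also have "\<dots> \<le> (\<Sum>v\<in>F. P (returning s l \<inter> f (w @ v) ` K))"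
      using F sets by (intro finite_measure_subadditive_finite) (auto simp: sets_\<mu>)
    also have "\<dots> \<le> (\<Sum>v\<in>F. A' * D powr \<tau> * C1 * q w * s powr \<tau> * P (f v ` K))"
    proof (rule sum_mono)
      fix v assume v: "v \<in> F"
      have "P (returning s l \<inter> f (w @ v) ` K) \<le> A' * q (w @ v) * s powr \<tau>"
        using A'(2)[of s l "w @ v"] s n wv[OF v] by auto
      also have "\<dots> \<le> A' * (D powr \<tau> * q w * q v) * s powr \<tau>"
        using A' q_append_upper[OF W FW[OF v]] by (intro mult_right_mono mult_left_mono) auto
      also have "\<dots> \<le> A' * (D powr \<tau> * q w * (C1 * P (f v ` K))) * s powr \<tau>"
        using A' cylinder_lower[OF FW[OF v]] q_pos[OF W] by (intro mult_right_mono mult_left_mono) auto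
      finally show "P (returning s l \<inter> f (w @ v) ` K) \<le> A' * D powr \<tau> * C1 * q w * s powr \<tau> * P (f v ` K)"
        by (simp add: mult_ac)
    qed
    also have "\<dots> = A' * D powr \<tau> * C1 * q w * s powr \<tau> * (\<Sum>v\<in>F. P (f v ` K))"
      by (simp add: sum_distrib_left)
    also have "\<dots> \<le> A' * D powr \<tau> * C1 * q w * s powr \<tau> * (A * 2 powr \<tau> * H * (r powr \<tau> + \<gamma> ^ (l - n)))"
      using A' C1_ge_1 q_pos[OF W] by (intro mult_left_mono hit) auto
    finally show ?thesis by (simp add: A2_def mult_ac)
  qed
  have "P (returning r n \<inter> returning s l \<inter> f u ` K) \<le> A2 * C1 * s powr \<tau> * (r powr \<tau> + \<gamma> ^ (l - n)) * P (f u ` K)"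
    if r: "0 \<le> r" and s: "0 \<le> s" and n: "1 \<le> n" "k \<le> n" "n < l" and u: "u \<in> words m k" for r s n l k u
  proof -
    have "P (returning r n \<inter> returning s l \<inter> f u ` K)
        = (\<Sum>w\<in>words m (n - k). P (returning r n \<inter> returning s l \<inter> f (u @ w) ` K))"
      by (rule P_cylinder_split[OF _ words_W[OF u]]) (auto intro: returning_borel)
    also have "\<dots> \<le> (\<Sum>w\<in>words m (n - k). A2 * s powr \<tau> * (r powr \<tau> + \<gamma> ^ (l - n)) * q (u @ w))"
      using r s n append_words[OF u] by (intro sum_mono word) auto
    also have "\<dots> = A2 * s powr \<tau> * (r powr \<tau> + \<gamma> ^ (l - n)) * (\<Sum>w\<in>words m (n - k). q (u @ w))"
      by (simp add: sum_distrib_left)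
    also have "\<dots> \<le> A2 * s powr \<tau> * (r powr \<tau> + \<gamma> ^ (l - n)) * (C1 * P (f u ` K))"
      using A2 sum_q_bounds(1)[OF words_W[OF u]] by (intro mult_left_mono) (auto simp: \<gamma>_def)
    finally show ?thesis by (simp add: mult_ac)
  qed
  moreover have "0 < A2 * C1" using A2 C1_ge_1 by simp
  ultimately show ?thesis unfolding \<gamma>_def by blast
qed

section \<open>The second moment of the number of returns\<close>

text \<open>Write \<open>S\<close> for the sum over the block. The expected number of returns in the block is at least of
  order \<open>S\<close>. The sum over pairs is at most of order \<open>S\<^sup>2 + S\<close>, where the linear term collects the
  geometric errors and the diagonal; it is absorbed because \<open>S \<ge> 1\<close>.\<close>

lemma block_lower:
  "\<exists>\<eta>>0. \<forall>\<psi> J k u. finite J \<and> (\<forall>n. 0 \<le> \<psi> n \<and> \<psi> n \<le> 1) \<and> (\<forall>n\<in>J. 1 \<le> n \<and> k \<le> n) \<and>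
      u \<in> words m k \<and> 1 \<le> (\<Sum>n\<in>J. \<psi> n powr \<tau>) \<longrightarrow>
      P (f u ` K) * \<eta> \<le> P (\<Union>n\<in>J. returning (\<psi> n) n \<inter> f u ` K)"
proof -
  define \<gamma> where "\<gamma> = c powr \<tau>"
  have \<gamma>: "0 \<le> \<gamma>" "\<gamma> < 1"
    using c_pos c_less \<tau>_pos powr_less_mono2[of \<tau> c 1] by (auto simp: \<gamma>_def)
  obtain A1 where A1: "0 < A1" "\<And>r n k u. 0 \<le> r \<and> 1 \<le> n \<and> k \<le> n \<and> u \<in> words m k \<Longrightarrow>
      P (returning r n \<inter> f u ` K) \<le> A1 * r powr \<tau> * P (f u ` K)" using returning_upper by blast
  obtain B where B: "0 < B" "\<And>r n k u. 0 \<le> r \<and> r \<le> 1 \<and> 1 \<le> n \<and> k \<le> n \<and> u \<in> words m k \<Longrightarrow>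
      B * r powr \<tau> * P (f u ` K) \<le> P (returning r n \<inter> f u ` K)" using returning_lower by blast
  obtain A2 where A2: "0 < A2" "\<And>r s n l k u. 0 \<le> r \<and> 0 \<le> s \<and> 1 \<le> n \<and> k \<le> n \<and> n < l \<and> u \<in> words m k \<Longrightarrow>
     P (returning r n \<inter> returning s l \<inter> f u ` K) \<le> A2 * s powr \<tau> * (r powr \<tau> + \<gamma> ^ (l - n)) * P (f u ` K)"
    using returning_pair_upper unfolding \<gamma>_def by blast
  define A where "A = max A1 A2"
  have A: "0 < A" "A1 \<le> A" "A2 \<le> A" using A1 by (auto simp: A_def)
  \<comment> \<open>the time between the two returns, written symmetrically to sum over all ordered pairs\<close>
  define g where "g n l = (if n \<le> l then l - n else n - l)" for n l :: nat
  have g_sum: "(\<Sum>l\<in>J. \<gamma> ^ g n l) \<le> 2 / (1 - \<gamma>)" if J: "finite J" for J n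
  proof -
    have "(\<Sum>l\<in>J. \<gamma> ^ g n l) = (\<Sum>l\<in>{l\<in>J. n \<le> l}. \<gamma> ^ g n l) + (\<Sum>l\<in>{l\<in>J. \<not> n \<le> l}. \<gamma> ^ g n l)"
      using J by (subst sum.union_disjoint[symmetric]) (auto intro!: sum.cong)
    also have "\<dots> \<le> 1 / (1 - \<gamma>) + 1 / (1 - \<gamma>)"
      using J \<gamma> by (intro add_mono sum_geometric_le) (auto simp: g_def inj_on_def)
    finally show ?thesis by simp
  qed
  define \<beta> where "\<beta> = A * (1 + 4 / (1 - \<gamma>))"
  have \<beta>: "0 < \<beta>" using A \<gamma> by (auto simp: \<beta>_def intro!: mult_pos_pos add_pos_pos)
  have main: "P (f u ` K) * (B\<^sup>2 / \<beta>) \<le> P (\<Union>n\<in>J. returning (\<psi> n) n \<inter> f u ` K)"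
    if J: "finite J" and \<psi>: "\<And>n. 0 \<le> \<psi> n" "\<And>n. \<psi> n \<le> 1" and Jk: "\<And>n. n \<in> J \<Longrightarrow> 1 \<le> n \<and> k \<le> n"
      and u: "u \<in> words m k" and S1: "1 \<le> (\<Sum>n\<in>J. \<psi> n powr \<tau>)" for \<psi> J k u
  proof -
    define a where "a n = \<psi> n powr \<tau>" for n
    define S where "S = (\<Sum>n\<in>J. a n)"
    define p where "p = P (f u ` K)"
    define F where "F n = returning (\<psi> n) n \<inter> f u ` K" for n
    have a: "0 \<le> a n" "a n \<le> 1" for n
      using \<psi>[of n] \<tau>_pos powr_mono2[of \<tau> "\<psi> n" 1] by (auto simp: a_def)
    have S: "1 \<le> S" using S1 by (simp add: S_def a_def)
    have lt: "P (F n \<inter> F l) \<le> A * p * (a n * a l + (a n + a l) * \<gamma> ^ g n l)"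
      if nl: "n \<in> J" "l \<in> J" "n < l" for n l
    proof -
      have "F n \<inter> F l = returning (\<psi> n) n \<inter> returning (\<psi> l) l \<inter> f u ` K" by (auto simp: F_def)
      then have "P (F n \<inter> F l) \<le> A2 * a l * (a n + \<gamma> ^ (l - n)) * p"
        using A2(2)[of "\<psi> n" "\<psi> l" n k l u] \<psi> Jk[OF nl(1)] nl u by (simp add: a_def p_def)
      also have "\<dots> \<le> A * a l * (a n + \<gamma> ^ (l - n)) * p"
        using A a \<gamma> by (intro mult_right_mono) (auto simp: p_def)
      also have "\<dots> = A * p * (a n * a l + a l * \<gamma> ^ (l - n))" by (simp add: algebra_simps)
      also have "\<dots> \<le> A * p * (a n * a l + (a n + a l) * \<gamma> ^ (l - n))"
        using A a \<gamma> by (intro mult_left_mono add_left_mono mult_right_mono) (auto simp: p_def)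
      finally show ?thesis using nl by (simp add: g_def)
    qed
    have pair: "P (F n \<inter> F l) \<le> A * p * (a n * a l + (a n + a l) * \<gamma> ^ g n l)"
      if nl: "n \<in> J" "l \<in> J" for n l
    proof -
      consider "n < l" | "l < n" | "n = l" by linarith
      then show ?thesis
      proof cases
        case 1
        then show ?thesis using lt nl by simp
      next
        case 2
        then show ?thesis using lt[OF nl(2,1)] by (simp add: g_def Int_commute algebra_simps)
      next
        case 3
        have "P (F n) \<le> A1 * a n * p"
          using A1(2)[of "\<psi> n" n k u] \<psi> Jk[OF nl(1)] u by (simp add: F_def a_def p_def)
        also have "\<dots> \<le> A * a n * p" using A a by (intro mult_right_mono) (auto simp: p_def)
        also have "\<dots> \<le> A * p * (a n * a n + (a n + a n) * 1)"
          using A a by (simp add: p_def algebra_simps)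
        finally show ?thesis using 3 by (simp add: g_def)
      qed
    qed
    have cross: "(\<Sum>(n, l)\<in>J \<times> J. a n * \<gamma> ^ g n l) \<le> S * (2 / (1 - \<gamma>))"
    proof -
      have "(\<Sum>(n, l)\<in>J \<times> J. a n * \<gamma> ^ g n l) = (\<Sum>n\<in>J. a n * (\<Sum>l\<in>J. \<gamma> ^ g n l))"
        by (simp add: sum.cartesian_product[symmetric] sum_distrib_left)
      also have "\<dots> \<le> (\<Sum>n\<in>J. a n * (2 / (1 - \<gamma>)))"
        using a by (intro sum_mono mult_left_mono g_sum J) auto
      also have "\<dots> = S * (2 / (1 - \<gamma>))" by (simp only: S_def sum_distrib_right)
      finally show ?thesis .
    qed
    have cross': "(\<Sum>(n, l)\<in>J \<times> J. a l * \<gamma> ^ g n l) = (\<Sum>(n, l)\<in>J \<times> J. a n * \<gamma> ^ g n l)"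
      by (rule sum.reindex_bij_witness[of _ "\<lambda>(n, l). (l, n)" "\<lambda>(n, l). (l, n)"]) (auto simp: g_def)
    have prod: "(\<Sum>(n, l)\<in>J \<times> J. a n * a l) = S\<^sup>2"
      by (simp add: S_def power2_eq_square sum_product sum.cartesian_product)
    have "(\<Sum>(n, l)\<in>J \<times> J. P (F n \<inter> F l))
        \<le> (\<Sum>(n, l)\<in>J \<times> J. A * p * (a n * a l + (a n + a l) * \<gamma> ^ g n l))"
      using pair by (intro sum_mono) auto
    also have "\<dots> = A * p * (\<Sum>(n, l)\<in>J \<times> J. a n * a l + a n * \<gamma> ^ g n l + a l * \<gamma> ^ g n l)"
      by (simp add: sum_distrib_left case_prod_unfold algebra_simps)
    also have "(\<Sum>(n, l)\<in>J \<times> J. a n * a l + a n * \<gamma> ^ g n l + a l * \<gamma> ^ g n l)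
        = S\<^sup>2 + (\<Sum>(n, l)\<in>J \<times> J. a n * \<gamma> ^ g n l) + (\<Sum>(n, l)\<in>J \<times> J. a l * \<gamma> ^ g n l)"
      by (simp add: prod[symmetric] sum.distrib case_prod_unfold)
    also have "A * p * \<dots> \<le> A * p * (S\<^sup>2 + S * (2 / (1 - \<gamma>)) + S * (2 / (1 - \<gamma>)))"
      using A cross unfolding cross' by (intro mult_left_mono add_mono) (auto simp: p_def)
    also have "\<dots> \<le> A * p * (S\<^sup>2 + S\<^sup>2 * (2 / (1 - \<gamma>)) + S\<^sup>2 * (2 / (1 - \<gamma>)))"
      using A S \<gamma> by (intro mult_left_mono add_mono mult_right_mono order_refl)
        (auto simp: p_def power2_eq_square)
    also have "\<dots> = \<beta> * p * S\<^sup>2" by (simp add: \<beta>_def algebra_simps)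
    finally have second: "(\<Sum>(n, l)\<in>J \<times> J. P (F n \<inter> F l)) \<le> \<beta> * p * S\<^sup>2" .
    have "B * p * S = (\<Sum>n\<in>J. B * a n * p)" by (simp add: S_def sum_distrib_left mult_ac)
    also have "\<dots> \<le> (\<Sum>n\<in>J. P (F n))"
      unfolding F_def a_def p_def using \<psi> Jk u by (intro sum_mono B(2)[where k = k]) auto
    finally have first: "B * p * S \<le> (\<Sum>n\<in>J. P (F n))" .
    have "p * (B\<^sup>2 / \<beta>) \<le> P (\<Union>n\<in>J. F n)"
      using S \<beta> first second B J returning_borel cylinder_borel[OF words_W[OF u]]
      by (intro measure_Union_ge_second_moment[of J F S]) (auto simp: F_def sets_\<mu>)
    then show ?thesis by (simp add: p_def F_def)
  qed
  show ?thesis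
  proof (intro exI conjI allI impI)
    show "0 < B\<^sup>2 / \<beta>" using B \<beta> by simp
    fix \<psi> :: "nat \<Rightarrow> real" and J k u
    assume *: "finite J \<and> (\<forall>n. 0 \<le> \<psi> n \<and> \<psi> n \<le> 1) \<and> (\<forall>n\<in>J. 1 \<le> n \<and> k \<le> n) \<and>
      u \<in> words m k \<and> 1 \<le> (\<Sum>n\<in>J. \<psi> n powr \<tau>)"
    show "P (f u ` K) * (B\<^sup>2 / \<beta>) \<le> P (\<Union>n\<in>J. returning (\<psi> n) n \<inter> f u ` K)"
      by (rule main[where k = k]) (use * in auto)
  qed
qed

section \<open>Infinitely many returns\<close>

definition recurrent :: "(nat \<Rightarrow> real) \<Rightarrow> 'a set" where
  "recurrent \<psi> = {x \<in> G. \<exists>\<^sub>\<infinity>n. dist x ((T ^^ n) x) < \<psi> n}"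

lemma recurrent_eq: "recurrent \<psi> = (\<Inter>N. \<Union>n\<in>{N..}. returning (\<psi> n) n)"
proof (intro equalityI subsetI)
  fix x assume "x \<in> recurrent \<psi>"
  then show "x \<in> (\<Inter>N. \<Union>n\<in>{N..}. returning (\<psi> n) n)"
    by (auto simp: recurrent_def INFM_nat_le returning_def)
next
  fix x assume x: "x \<in> (\<Inter>N. \<Union>n\<in>{N..}. returning (\<psi> n) n)"
  then have "\<exists>n\<ge>N. x \<in> returning (\<psi> n) n" for N by auto
  then show "x \<in> recurrent \<psi>" by (auto simp: recurrent_def INFM_nat_le returning_def)
qed

lemma recurrent_borel: "recurrent \<psi> \<in> sets borel"
  unfolding recurrent_eq by (intro sets.countable_INT sets.countable_UN) (auto intro: returning_borel)

lemma recurrent_null: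
  assumes \<psi>: "\<And>n. 0 \<le> \<psi> n" and sum: "summable (\<lambda>n. \<psi> n powr \<tau>)"
  shows "P (recurrent \<psi>) = 0"
proof -
  obtain A where A: "0 < A" "\<And>r n k u. 0 \<le> r \<and> 1 \<le> n \<and> k \<le> n \<and> u \<in> words m k \<Longrightarrow>
      P (returning r n \<inter> f u ` K) \<le> A * r powr \<tau> * P (f u ` K)" using returning_upper by blast
  have le: "P (returning (\<psi> n) n) \<le> A * \<psi> n powr \<tau>" if "1 \<le> n" for n
    using A(2)[of "\<psi> n" n 0 "[]"] \<psi> that P_inter_K[OF returning_borel] by (simp add: words_def P_K)
  have "summable (\<lambda>n. P (returning (\<psi> n) n))"
    using le by (intro summable_comparison_test'[OF summable_mult[OF sum, of A], of 1]) auto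
  then have "limsup (\<lambda>n. returning (\<psi> n) n) \<in> null_sets \<mu>"
    by (intro borel_cantelli_limsup1) (auto simp: sets_\<mu> returning_borel emeasure_eq_measure)
  moreover have "limsup (\<lambda>n. returning (\<psi> n) n) = recurrent \<psi>"
    by (simp add: recurrent_eq limsup_INF_SUP)
  ultimately show ?thesis by (simp add: null_sets_def measure_def)
qed

text \<open>Divergence provides, beyond every index, a block to which the previous lemma applies. The tail
  unions therefore keep a fixed proportion of the cylinder, and so does their limit.\<close>

lemma recurrent_cylinder_lower:
  "\<exists>\<eta>>0. \<forall>\<psi> k u. (\<forall>n. 0 \<le> \<psi> n \<and> \<psi> n \<le> 1) \<and> \<not> summable (\<lambda>n. \<psi> n powr \<tau>) \<and> u \<in> words m k \<longrightarrow>
      P (f u ` K) * \<eta> \<le> P (recurrent \<psi> \<inter> f u ` K)"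
proof -
  obtain \<eta> where \<eta>: "0 < \<eta>" and block: "\<And>\<psi> J k u. finite J \<and> (\<forall>n. 0 \<le> \<psi> n \<and> \<psi> n \<le> 1) \<and>
      (\<forall>n\<in>J. 1 \<le> n \<and> k \<le> n) \<and> u \<in> words m k \<and> 1 \<le> (\<Sum>n\<in>J. \<psi> n powr \<tau>) \<Longrightarrow>
      P (f u ` K) * \<eta> \<le> P (\<Union>n\<in>J. returning (\<psi> n) n \<inter> f u ` K)"
    using block_lower by blast
  have "P (f u ` K) * \<eta> \<le> P (recurrent \<psi> \<inter> f u ` K)"
    if \<psi>: "\<And>n. 0 \<le> \<psi> n \<and> \<psi> n \<le> 1" and div: "\<not> summable (\<lambda>n. \<psi> n powr \<tau>)" and u: "u \<in> words m k" for \<psi> k u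
  proof -
    define V where "V N = (\<Union>n\<in>{N..}. returning (\<psi> n) n) \<inter> f u ` K" for N
    have V_borel: "V N \<in> sets borel" for N
      unfolding V_def using cylinder_borel[OF words_W[OF u]]
      by (intro sets.Int sets.countable_UN) (auto intro: returning_borel)
    have dec: "decseq V" unfolding V_def by (intro decseq_SucI) (auto simp: Bex_def; meson Suc_leD)
    have bound: "P (f u ` K) * \<eta> \<le> P (V N)" if N: "1 \<le> N" "k \<le> N" for N
    proof -
      have "\<exists>N'. 1 \<le> (\<Sum>n\<in>{N..<N'}. \<psi> n powr \<tau>)"
      proof (rule ccontr)
        assume "\<nexists>N'. 1 \<le> (\<Sum>n\<in>{N..<N'}. \<psi> n powr \<tau>)"
        then have small: "(\<Sum>n\<in>{N..<N'}. \<psi> n powr \<tau>) \<le> 1" for N' by (meson linear)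
        have "(\<Sum>i<n. \<psi> (i + N) powr \<tau>) = (\<Sum>n\<in>{N..<n + N}. \<psi> n powr \<tau>)" for n
          using sum.shift_bounds_nat_ivl[of "\<lambda>n. \<psi> n powr \<tau>" 0 N n] by (simp add: lessThan_atLeast0)
        then have "summable (\<lambda>i. \<psi> (i + N) powr \<tau>)"
          using small by (intro summableI_nonneg_bounded[of _ 1]) auto
        then show False using div summable_iff_shift[of "\<lambda>n. \<psi> n powr \<tau>" N] by simp
      qed
      then obtain N' where "1 \<le> (\<Sum>n\<in>{N..<N'}. \<psi> n powr \<tau>)" by blast
      then have "P (f u ` K) * \<eta> \<le> P (\<Union>n\<in>{N..<N'}. returning (\<psi> n) n \<inter> f u ` K)"
        using \<psi> N u by (intro block[where k = k]) auto
      also have "\<dots> \<le> P (V N)" by (intro P_mono V_borel) (auto simp: V_def)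
      finally show ?thesis .
    qed
    have "(\<lambda>N. P (V N)) \<longlonglongrightarrow> P (\<Inter>N. V N)"
      using V_borel dec by (intro finite_Lim_measure_decseq) (auto simp: sets_\<mu>)
    then have "P (f u ` K) * \<eta> \<le> P (\<Inter>N. V N)"
      by (rule LIMSEQ_le_const) (use bound in \<open>auto intro!: exI[of _ "max 1 k"]\<close>)
    also have "(\<Inter>N. V N) = recurrent \<psi> \<inter> f u ` K" unfolding V_def recurrent_eq by blast
    finally show ?thesis .
  qed
  then show ?thesis using \<eta> by blast
qed

text \<open>Otherwise the complement of \<open>E\<close> in \<open>K\<close> contains a compact set \<open>F\<close> of positive measure. Finite
  unions of the cylinders that meet \<open>F\<close> decrease to \<open>F\<close>, which is disjoint from \<open>E\<close>, although \<open>E\<close>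
  fills a fixed proportion of each of these unions.\<close>

lemma full_measure_if_dense_in_cylinders:
  assumes E: "E \<in> sets borel" and \<eta>: "0 < \<eta>"
    and dense: "\<And>k u. u \<in> words m k \<Longrightarrow> P (f u ` K) * \<eta> \<le> P (E \<inter> f u ` K)"
  shows "P E = 1"
proof (rule ccontr)
  assume ne: "P E \<noteq> 1"
  have b: "K - E \<in> sets borel" using E K_borel by auto
  have "P (K - E) + P (E \<inter> K) = P K"
  proof -
    have "K - E \<union> E \<inter> K = K" "(K - E) \<inter> (E \<inter> K) = {}" by auto
    then show ?thesis
      using finite_measure_Union[of "K - E" "E \<inter> K"] b E K_borel by (simp add: sets_\<mu>)
  qed
  then have "0 < P (K - E)" using ne P_le_1[of E] P_inter_K[OF E] P_K by linarith
  then have "0 < emeasure \<mu> (K - E)" by (simp add: emeasure_eq_measure)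
  also have "emeasure \<mu> (K - E) = (SUP F\<in>{F. F \<subseteq> K - E \<and> compact F}. emeasure \<mu> F)"
    using b by (intro inner_regular) (auto simp: sets_\<mu> emeasure_eq_measure)
  finally obtain F where F: "F \<subseteq> K - E" "compact F" "0 < emeasure \<mu> F"
    by (auto simp: less_SUP_iff)
  then have PF: "0 < P F" by (simp add: emeasure_eq_measure)
  define N where "N n = {u \<in> words m n. f u ` K \<inter> F \<noteq> {}}" for n
  define U where "U n = (\<Union>u\<in>N n. f u ` K)" for n
  have N: "finite (N n)" "\<And>u. u \<in> N n \<Longrightarrow> u \<in> words m n" for n
    by (auto simp: N_def finite_words)
  have U_borel: "U n \<in> sets borel" for n
    unfolding U_def using N cylinder_borel words_W by (intro sets.finite_UN) auto
  have F_U: "F \<subseteq> U n" for n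
  proof
    fix x assume x: "x \<in> F"
    then have "x \<in> K" using F by auto
    then obtain u where u: "u \<in> words m n" "x \<in> f u ` K" using K_covered by blast
    then have "u \<in> N n" using x by (auto simp: N_def)
    then show "x \<in> U n" using u by (auto simp: U_def)
  qed
  have dec: "decseq U"
  proof (rule decseq_SucI, rule subsetI)
    fix n x assume "x \<in> U (Suc n)"
    then obtain u where u: "u \<in> N (Suc n)" "x \<in> f u ` K" by (auto simp: U_def)
    then obtain w j where w: "w \<in> words m n" "j \<in> {1..m}" "u = w @ [j]"
      using N(2)[OF u(1)] unfolding words_Suc by auto
    have sub: "f u ` K \<subseteq> f w ` K" using f_image_append_subset[of "[j]" w] w by simp
    moreover have "f u ` K \<inter> F \<noteq> {}" using u(1) by (simp add: N_def)
    ultimately have "w \<in> N n" using w(1) unfolding N_def by blast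
    then show "x \<in> U n" using sub u by (auto simp: U_def)
  qed
  have Inter: "(\<Inter>n. U n) = F"
  proof (intro equalityI subsetI)
    fix x assume x: "x \<in> (\<Inter>n. U n)"
    have "x \<in> closure F"
    proof (unfold closure_approachable, intro allI impI)
      fix e :: real assume "0 < e"
      then obtain n where n: "c ^ n * diamQ < e" using c_powr_vanishes by blast
      have "x \<in> U n" using x by blast
      then obtain u where u: "u \<in> N n" "x \<in> f u ` K" by (auto simp: U_def)
      then have "f u ` K \<inter> F \<noteq> {}" by (simp add: N_def)
      then obtain y where y: "y \<in> f u ` K" "y \<in> F" by auto
      have "dist y x \<le> c ^ length u * diamQ"
        using u y dist_f_le_diamQ[OF words_W[OF N(2)[OF u(1)]]] K_subset by auto
      then have "dist y x < e" using n N(2)[OF u(1)] by (simp add: words_def)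
      then show "\<exists>y\<in>F. dist y x < e" using y by blast
    qed
    then show "x \<in> F" using F(2) by (simp add: compact_imp_closed closure_closed)
  qed (use F_U in auto)
  have lower: "P F * \<eta> \<le> P (E \<inter> U n)" for n
  proof -
    have disj: "disjoint_family_on (\<lambda>u. E \<inter> f u ` K \<inter> G) (N n)"
      unfolding disjoint_family_on_def using N G_D words_W
      by (smt (verit, ccfv_threshold) Int_iff disjoint_iff words_def mem_Collect_eq)
    have sets: "E \<inter> f u ` K \<in> sets borel" if "u \<in> N n" for u
      using E cylinder_borel words_W N that by auto
    have "P F * \<eta> \<le> P (U n) * \<eta>" using \<eta> by (intro mult_right_mono P_mono F_U U_borel) auto
    also have "\<dots> \<le> (\<Sum>u\<in>N n. P (f u ` K)) * \<eta>"
      unfolding U_def using \<eta> N cylinder_borel words_W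
      by (intro mult_right_mono finite_measure_subadditive_finite) (auto simp: sets_\<mu>)
    also have "\<dots> = (\<Sum>u\<in>N n. P (f u ` K) * \<eta>)" by (simp add: sum_distrib_right)
    also have "\<dots> \<le> (\<Sum>u\<in>N n. P (E \<inter> f u ` K))" using N by (intro sum_mono dense) auto
    also have "\<dots> = (\<Sum>u\<in>N n. P (E \<inter> f u ` K \<inter> G))"
      using sets by (intro sum.cong refl P_inter_G[symmetric]) auto
    also have "\<dots> = P (\<Union>u\<in>N n. E \<inter> f u ` K \<inter> G)"
      using sets G_borel N disj by (intro finite_measure_finite_Union[symmetric]) (auto simp: sets_\<mu>)
    also have "\<dots> \<le> P (E \<inter> U n)"
      using E U_borel by (intro P_mono) (auto simp: U_def)
    finally show ?thesis .
  qed
  have "(\<lambda>n. P (E \<inter> U n)) \<longlonglongrightarrow> P (\<Inter>n. E \<inter> U n)"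
    using E U_borel dec by (intro finite_Lim_measure_decseq) (auto simp: sets_\<mu> decseq_def)
  moreover have "(\<Inter>n. E \<inter> U n) = {}" using Inter F by blast
  ultimately have "(\<lambda>n. P (E \<inter> U n)) \<longlonglongrightarrow> 0" by simp
  then have "P F * \<eta> \<le> 0" by (rule LIMSEQ_le_const) (use lower in auto)
  then show False using PF \<eta> by (simp add: mult_le_0_iff)
qed

lemma recurrent_mono: "(\<And>n. \<psi> n \<le> \<psi>' n) \<Longrightarrow> recurrent \<psi> \<subseteq> recurrent \<psi>'"
  by (auto simp: recurrent_def elim!: INFM_mono intro: less_le_trans)

text \<open>The radii may be truncated at \<open>1\<close>: if the truncated series converged, only finitely many terms
  would have been changed.\<close>

lemma recurrent_full:
  assumes \<psi>: "\<And>n. 0 \<le> \<psi> n" and div: "\<not> summable (\<lambda>n. \<psi> n powr \<tau>)"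
  shows "P (recurrent \<psi>) = 1"
proof -
  define \<psi>' where "\<psi>' n = min (\<psi> n) 1" for n
  have "\<not> summable (\<lambda>n. \<psi>' n powr \<tau>)"
  proof
    assume s: "summable (\<lambda>n. \<psi>' n powr \<tau>)"
    then have "(\<lambda>n. \<psi>' n powr \<tau>) \<longlonglongrightarrow> 0" by (rule summable_LIMSEQ_zero)
    then have "\<forall>\<^sub>F n in sequentially. \<psi>' n powr \<tau> < 1" by (rule order_tendstoD) simp
    then have "\<forall>\<^sub>F n in sequentially. \<psi>' n powr \<tau> = \<psi> n powr \<tau>"
      by eventually_elim (auto simp: \<psi>'_def min_def split: if_splits)
    then have "summable (\<lambda>n. \<psi>' n powr \<tau>) = summable (\<lambda>n. \<psi> n powr \<tau>)" by (rule summable_cong)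
    then show False using s div by simp
  qed
  moreover have "0 \<le> \<psi>' n \<and> \<psi>' n \<le> 1" for n using \<psi> by (auto simp: \<psi>'_def)
  moreover obtain \<eta> where "0 < \<eta>" "\<And>\<psi> k u. (\<forall>n. 0 \<le> \<psi> n \<and> \<psi> n \<le> 1) \<and>
      \<not> summable (\<lambda>n. \<psi> n powr \<tau>) \<and> u \<in> words m k \<Longrightarrow> P (f u ` K) * \<eta> \<le> P (recurrent \<psi> \<inter> f u ` K)"
    using recurrent_cylinder_lower by blast
  ultimately have "P (recurrent \<psi>') = 1"
    by (intro full_measure_if_dense_in_cylinders[of _ \<eta>] recurrent_borel) auto
  moreover have "P (recurrent \<psi>') \<le> P (recurrent \<psi>)"
    by (intro P_mono recurrent_mono recurrent_borel) (simp add: \<psi>'_def)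
  ultimately show ?thesis using P_le_1[of "recurrent \<psi>"] by simp
qed

lemma recurrence_set_inter_G: "recurrence_set K T \<psi> \<inter> G = recurrent (\<lambda>n. \<psi> (real n))"
  using G_subset_K by (auto simp: recurrence_set_def recurrent_def dist_commute)

lemma recurrence_set_borel: "recurrence_set K T \<psi> \<in> sets borel"
proof -
  have "recurrence_set K T \<psi> = K \<inter> (\<Inter>N. \<Union>n\<in>{N..}. {x. dist x ((T ^^ n) x) < \<psi> (real n)})"
    unfolding recurrence_set_def INFM_nat_le mem_ball by (simp add: set_eq_iff Bex_def)
  also have "\<dots> \<in> sets borel"
    by (intro sets.Int K_borel sets.countable_INT sets.countable_UN) (auto intro: dist_T_borel)
  finally show ?thesis .
qed

theorem recurrence_dichotomy:
  assumes \<psi>: "\<And>t. 0 \<le> \<psi> t"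
  shows "recurrence_set K T \<psi> \<in> sets \<mu>"
    and "(\<Sum>n. ennreal (\<psi> (real (Suc n)) powr \<tau>)) < \<infinity> \<Longrightarrow> emeasure \<mu> (recurrence_set K T \<psi>) = 0"
    and "(\<Sum>n. ennreal (\<psi> (real (Suc n)) powr \<tau>)) = \<infinity> \<Longrightarrow> emeasure \<mu> (recurrence_set K T \<psi>) = 1"
proof -
  show "recurrence_set K T \<psi> \<in> sets \<mu>" using recurrence_set_borel by (simp add: sets_\<mu>)
  have P_eq: "P (recurrence_set K T \<psi>) = P (recurrent (\<lambda>n. \<psi> (real n)))"
    using P_inter_G[OF recurrence_set_borel] recurrence_set_inter_G by simp
  show "emeasure \<mu> (recurrence_set K T \<psi>) = 0" if "(\<Sum>n. ennreal (\<psi> (real (Suc n)) powr \<tau>)) < \<infinity>"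
  proof -
    have "summable (\<lambda>n. \<psi> (real (Suc n)) powr \<tau>)"
      using that by (intro summable_suminf_not_top) auto
    then have "summable (\<lambda>n. \<psi> (real n) powr \<tau>)"
      using summable_Suc_iff[of "\<lambda>n. \<psi> (real n) powr \<tau>"] by simp
    then show ?thesis using recurrent_null[of "\<lambda>n. \<psi> (real n)"] \<psi> P_eq by (simp add: emeasure_eq_measure)
  qed
  show "emeasure \<mu> (recurrence_set K T \<psi>) = 1" if "(\<Sum>n. ennreal (\<psi> (real (Suc n)) powr \<tau>)) = \<infinity>"
  proof -
    have "\<not> summable (\<lambda>n. \<psi> (real (Suc n)) powr \<tau>)"
      using that suminf_ennreal2[of "\<lambda>n. \<psi> (real (Suc n)) powr \<tau>"] by auto
    then have "\<not> summable (\<lambda>n. \<psi> (real n) powr \<tau>)"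
      using summable_Suc_iff[of "\<lambda>n. \<psi> (real n) powr \<tau>"] by simp
    then show ?thesis using recurrent_full[of "\<lambda>n. \<psi> (real n)"] \<psi> P_eq by (simp add: emeasure_eq_measure)
  qed
qed

end

section \<open>Distortion of conformal maps\<close>

lemma ln_diff_le:
  fixes u v s0 :: real
  assumes "0 < s0" "s0 \<le> u" "s0 \<le> v"
  shows "\<bar>ln u - ln v\<bar> \<le> \<bar>u - v\<bar> / s0"
proof -
  have *: "ln u - ln v \<le> \<bar>u - v\<bar> / s0" if "s0 \<le> u" "s0 \<le> v" for u v
  proof -
    have "ln u - ln v = ln (u / v)" using that assms by (simp add: ln_div)
    also have "\<dots> \<le> u / v - 1" using that assms by (intro ln_le_minus_one) auto
    also have "\<dots> = (u - v) / v" using that assms by (simp add: field_simps)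
    also have "\<dots> \<le> \<bar>u - v\<bar> / v" using that assms by (intro divide_right_mono) auto
    also have "\<dots> \<le> \<bar>u - v\<bar> / s0" using that assms by (intro divide_left_mono) auto
    finally show ?thesis .
  qed
  show ?thesis using *[of u v] *[of v u] assms by (simp add: abs_le_iff abs_minus_commute)
qed

lemma ball_subset_if_compact_subset_open:
  fixes Q :: "'a::heine_borel set"
  assumes "compact Q" "open S" "Q \<subseteq> S"
  obtains \<delta> where "0 < \<delta>" "\<And>x. x \<in> Q \<Longrightarrow> ball x \<delta> \<subseteq> S"
proof -
  obtain d where d: "0 < d" "\<And>x y. x \<in> Q \<Longrightarrow> y \<in> - S \<Longrightarrow> d \<le> dist x y"
  proof -
    have "closed (- S)" "Q \<inter> - S = {}" using assms by auto
    then show ?thesis using that separate_compact_closed[OF assms(1), of "- S"] by blast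
  qed
  have "ball x d \<subseteq> S" if "x \<in> Q" for x
    using d(2)[OF that] by (meson ComplI mem_ball not_le subsetI)
  then show ?thesis using that d by blast
qed

text \<open>The derivative of the inverse is the inverse similarity, whose norm is the reciprocal ratio.\<close>

lemma similarity_inverse_derivative:
  fixes f :: "'a::euclidean_space \<Rightarrow> 'a"
  assumes \<Omega>: "open \<Omega>" and inj: "inj_on f \<Omega>"
    and der: "\<And>x. x \<in> \<Omega> \<Longrightarrow> (f has_derivative f' x) (at x)"
    and conf: "\<And>x y. x \<in> \<Omega> \<Longrightarrow> norm (f' x y) = s x * norm y" and pos: "\<And>x. x \<in> \<Omega> \<Longrightarrow> 0 < s x"
    and z: "z \<in> \<Omega>"
  shows "\<exists>g'. (inv_into \<Omega> f has_derivative g') (at (f z)) \<and> onorm g' \<le> 1 / s z"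
proof -
  have cont: "continuous_on \<Omega> f"
    using der \<Omega> by (intro continuous_at_imp_continuous_on ballI has_derivative_continuous) blast
  have lin: "linear (f' z)" using der[OF z] has_derivative_linear by blast
  have "inj (f' z)"
  proof (rule injI)
    fix x y assume "f' z x = f' z y"
    then have "norm (f' z (x - y)) = 0" using lin by (simp add: linear_diff)
    then show "x = y" using conf[OF z, of "x - y"] pos[OF z] by simp
  qed
  then obtain g' where g': "linear g'" "\<And>x. f' z (g' x) = x"
    using linear_injective_isomorphism[OF lin] by blast
  have "(inv_into \<Omega> f has_derivative g') (at (f z))"
    using g' by (intro has_derivative_inverse_strong[OF \<Omega> z cont _ der[OF z]])
      (auto simp: inj inv_into_f_f)
  moreover have "onorm g' \<le> 1 / s z"
  proof (rule onorm_le)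
    fix x show "norm (g' x) \<le> 1 / s z * norm x"
      using conf[OF z, of "g' x"] g'(2)[of x] pos[OF z] by (simp add: field_simps)
  qed
  ultimately show ?thesis by blast
qed

text \<open>The upper bound for the distance ratio is the mean value inequality on the segment from \<open>x\<close> to
  \<open>y\<close>. For the lower bound the same inequality is applied to the inverse map on the segment between
  the images, which stays in the image of \<open>\<Omega>\<close> because that set is open by invariance of domain. In
  both cases the derivative is compared with the one at \<open>x\<close> by the Hoelder condition.\<close>

lemma conformal_ratio_near:
  fixes f :: "'a::euclidean_space \<Rightarrow> 'a"
  assumes \<Omega>: "open \<Omega>" and Q: "compact Q" "Q \<subseteq> \<Omega>" and inj: "inj_on f \<Omega>"
    and der: "\<And>x. x \<in> \<Omega> \<Longrightarrow> (f has_derivative f' x) (at x)"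
    and conf: "\<And>x y. x \<in> \<Omega> \<Longrightarrow> norm (f' x y) = s x * norm y"
    and s0: "0 < s0" "\<And>x. x \<in> \<Omega> \<Longrightarrow> s0 \<le> s x"
    and lip: "\<And>x y. x \<in> \<Omega> \<Longrightarrow> y \<in> \<Omega> \<Longrightarrow> dist (f x) (f y) \<le> dist x y"
    and \<alpha>: "0 < \<alpha>" and H: "0 \<le> H"
    and hol: "\<And>x y. x \<in> \<Omega> \<Longrightarrow> y \<in> \<Omega> \<Longrightarrow> \<bar>ln (s x) - ln (s y)\<bar> \<le> H * dist x y powr \<alpha>"
  obtains \<delta> C where "0 < \<delta>" "0 \<le> C" "\<And>x y. x \<in> Q \<Longrightarrow> y \<in> Q \<Longrightarrow> x \<noteq> y \<Longrightarrow> dist x y < \<delta> \<Longrightarrow>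
      \<bar>ln (dist (f x) (f y) / dist x y) - ln (s x)\<bar> \<le> C * dist x y powr \<alpha>"
proof -
  have pos: "0 < s x" if "x \<in> \<Omega>" for x using s0 that by (meson less_le_trans)
  have cont: "continuous_on \<Omega> f"
    using der \<Omega> by (intro continuous_at_imp_continuous_on ballI has_derivative_continuous) blast
  have open_image: "open (f ` \<Omega>)" by (rule invariance_of_domain[OF cont \<Omega> inj])
  have compact_image: "compact (f ` Q)"
    using Q cont by (meson compact_continuous_image continuous_on_subset)
  obtain \<delta>1 where \<delta>1: "0 < \<delta>1" "\<And>x. x \<in> Q \<Longrightarrow> ball x \<delta>1 \<subseteq> \<Omega>"
    using ball_subset_if_compact_subset_open[OF Q(1) \<Omega> Q(2)] by metis
  obtain \<delta>2 where \<delta>2: "0 < \<delta>2" "\<And>x. x \<in> f ` Q \<Longrightarrow> ball x \<delta>2 \<subseteq> f ` \<Omega>"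
    using ball_subset_if_compact_subset_open[OF compact_image open_image image_mono[OF Q(2)]] by metis
  \<comment> \<open>the second summand accounts for the inverse, which may enlarge distances by \<open>1 / s0\<close>\<close>
  define C where "C = H * (1 + (1 / s0) powr \<alpha>)"
  have C: "0 \<le> C" "H \<le> C" "H * (1 / s0) powr \<alpha> \<le> C"
    using H by (auto simp: C_def algebra_simps)
  define g where "g = inv_into \<Omega> f"
  have gf: "g (f x) = x" if "x \<in> \<Omega>" for x using inj that by (simp add: g_def)
  obtain g' where g': "\<And>z. z \<in> \<Omega> \<Longrightarrow> (g has_derivative g' z) (at (f z)) \<and> onorm (g' z) \<le> 1 / s z"
    using similarity_inverse_derivative[OF \<Omega> inj der conf pos] unfolding g_def by metis
  have "\<bar>ln (dist (f x) (f y) / dist x y) - ln (s x)\<bar> \<le> C * dist x y powr \<alpha>"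
    if xy: "x \<in> Q" "y \<in> Q" "x \<noteq> y" and near: "dist x y < min \<delta>1 \<delta>2" for x y
  proof -
    let ?d = "dist x y"
    have x: "x \<in> \<Omega>" "y \<in> \<Omega>" using xy Q by auto
    have d: "0 < ?d" using xy by simp
    have fd: "0 < dist (f x) (f y)" using inj x xy by (auto simp: inj_on_def)
    have seg: "z \<in> \<Omega>" "dist x z \<le> ?d" if "z \<in> closed_segment x y" for z
    proof -
      show "dist x z \<le> ?d" using dist_in_closed_segment[OF that] by (simp add: dist_commute)
      then show "z \<in> \<Omega>" using \<delta>1(2)[OF xy(1)] near by auto
    qed
    have upper: "dist (f x) (f y) \<le> (s x * exp (H * ?d powr \<alpha>)) * ?d"
      unfolding dist_norm
    proof (rule differentiable_bound[of "closed_segment x y" f f'])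
      fix z assume z: "z \<in> closed_segment x y"
      show "(f has_derivative f' z) (at z within closed_segment x y)"
        using der[OF seg(1)[OF z]] by (rule has_derivative_at_withinI)
      have "ln (s z) \<le> ln (s x) + H * dist z x powr \<alpha>" using hol[OF seg(1)[OF z] x(1)] by linarith
      also have "\<dots> \<le> ln (s x) + H * ?d powr \<alpha>"
        using seg(2)[OF z] H \<alpha> by (intro add_left_mono mult_left_mono powr_mono2) (auto simp: dist_commute)
      finally have "exp (ln (s z)) \<le> exp (ln (s x) + H * ?d powr \<alpha>)" by simp
      then have "s z \<le> s x * exp (H * ?d powr \<alpha>)" using pos seg(1)[OF z] x by (simp add: exp_add)
      then show "onorm (f' z) \<le> s x * exp (H * norm (x - y) powr \<alpha>)"
        using conf[OF seg(1)[OF z]]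
        by (intro onorm_le) (auto simp: dist_norm intro!: mult_right_mono)
    qed auto
    have near': "dist (f x) (f y) < \<delta>2" using lip[OF x] near by simp
    have seg': "\<exists>z\<in>\<Omega>. p = f z" if "p \<in> closed_segment (f x) (f y)" for p
    proof -
      have "dist (f x) p \<le> dist (f x) (f y)"
        using dist_in_closed_segment[OF that] by (simp add: dist_commute)
      then have "p \<in> ball (f x) \<delta>2" using near' by simp
      then show ?thesis using \<delta>2(2)[of "f x"] xy by auto
    qed
    \<comment> \<open>the constant bound \<open>1 / s0\<close> on the inverse derivative only serves to locate \<open>g p\<close> near \<open>x\<close>\<close>
    have crude: "dist (g p) x \<le> ?d / s0" if p: "p \<in> closed_segment (f x) (f y)" for p
    proof -
      have "norm (g p - g (f x)) \<le> 1 / s0 * norm (p - f x)"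
      proof (rule differentiable_bound[of "closed_segment (f x) (f y)" g "\<lambda>p. g' (g p)"])
        fix p' assume "p' \<in> closed_segment (f x) (f y)"
        then obtain z where z: "z \<in> \<Omega>" "p' = f z" using seg' by blast
        show "(g has_derivative g' (g p')) (at p' within closed_segment (f x) (f y))"
          using g'[OF z(1)] z gf by (auto intro: has_derivative_at_withinI)
        have "onorm (g' (g p')) \<le> 1 / s z" using g'[OF z(1)] z gf by simp
        also have "\<dots> \<le> 1 / s0" using s0 z pos by (intro divide_left_mono) auto
        finally show "onorm (g' (g p')) \<le> 1 / s0" .
      qed (use p in auto)
      also have "\<dots> \<le> 1 / s0 * ?d"
      proof (rule mult_left_mono)
        have "dist (f x) p \<le> dist (f x) (f y)"
          using dist_in_closed_segment[OF p] by (simp add: dist_commute)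
        then show "norm (p - f x) \<le> ?d" using lip[OF x] by (simp add: dist_norm norm_minus_commute)
      qed (use s0 in simp)
      finally show ?thesis using gf x by (simp add: dist_norm)
    qed
    have lower: "?d \<le> exp (C * ?d powr \<alpha>) / s x * dist (f x) (f y)"
    proof -
      have "norm (g (f x) - g (f y)) \<le> (exp (C * ?d powr \<alpha>) / s x) * norm (f x - f y)"
      proof (rule differentiable_bound[of "closed_segment (f x) (f y)" g "\<lambda>p. g' (g p)"])
        fix p assume p: "p \<in> closed_segment (f x) (f y)"
        then obtain z where z: "z \<in> \<Omega>" "p = f z" using seg' by blast
        show "(g has_derivative g' (g p)) (at p within closed_segment (f x) (f y))"
          using g'[OF z(1)] z gf by (auto intro: has_derivative_at_withinI)
        have "dist z x \<le> ?d / s0" using crude[OF p] gf z by simp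
        then have "H * dist z x powr \<alpha> \<le> H * (?d / s0) powr \<alpha>"
          using H \<alpha> by (intro mult_left_mono powr_mono2) auto
        also have "\<dots> = H * (1 / s0) powr \<alpha> * ?d powr \<alpha>"
          using s0 by (simp add: powr_mult[symmetric] mult.assoc)
        also have "\<dots> \<le> C * ?d powr \<alpha>" using C by (intro mult_right_mono) auto
        finally have "ln (s x) - C * ?d powr \<alpha> \<le> ln (s z)" using hol[OF z(1) x(1)] by linarith
        then have "exp (ln (s x) - C * ?d powr \<alpha>) \<le> exp (ln (s z))" by simp
        then have "s x / exp (C * ?d powr \<alpha>) \<le> s z" using pos x z by (simp add: exp_diff)
        then have "1 / s z \<le> exp (C * ?d powr \<alpha>) / s x"
          using pos x z by (simp add: field_simps)
        then show "onorm (g' (g p)) \<le> exp (C * ?d powr \<alpha>) / s x" using g'[OF z(1)] z gf by simp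
      qed auto
      then show ?thesis using gf x by (simp add: dist_norm)
    qed
    define \<rho> where "\<rho> = dist (f x) (f y) / ?d"
    have \<rho>: "0 < \<rho>" using fd d by (simp add: \<rho>_def)
    have "\<rho> \<le> s x * exp (H * ?d powr \<alpha>)" using upper d by (simp add: \<rho>_def divide_simps)
    then have "ln \<rho> \<le> ln (s x * exp (H * ?d powr \<alpha>))" using \<rho> pos x by (intro iffD2[OF ln_le_cancel_iff]) auto
    also have "\<dots> = ln (s x) + H * ?d powr \<alpha>" using pos[OF x(1)] by (simp add: ln_mult)
    also have "\<dots> \<le> ln (s x) + C * ?d powr \<alpha>" using C by (intro add_left_mono mult_right_mono) auto
    finally have 1: "ln \<rho> - ln (s x) \<le> C * ?d powr \<alpha>" by simp
    have "s x \<le> exp (C * ?d powr \<alpha>) * \<rho>" using lower d pos[OF x(1)] by (simp add: \<rho>_def field_simps)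
    then have "ln (s x) \<le> ln (exp (C * ?d powr \<alpha>) * \<rho>)" using \<rho> pos x by (intro iffD2[OF ln_le_cancel_iff]) auto
    also have "\<dots> = C * ?d powr \<alpha> + ln \<rho>" using \<rho> by (subst ln_mult) auto
    finally have 2: "ln (s x) - ln \<rho> \<le> C * ?d powr \<alpha>" by simp
    show ?thesis using 1 2 unfolding \<rho>_def by linarith
  qed
  then show ?thesis using that[of "min \<delta>1 \<delta>2" C] C \<delta>1 \<delta>2 by simp
qed

lemma dist_ratio_bounded_below_far:
  fixes f :: "'a::euclidean_space \<Rightarrow> 'a"
  assumes Q: "compact Q" and cont: "continuous_on Q f" and inj: "inj_on f Q" and \<delta>: "0 < \<delta>"
  obtains e where "0 < e" "\<And>x y. x \<in> Q \<Longrightarrow> y \<in> Q \<Longrightarrow> \<delta> \<le> dist x y \<Longrightarrow> e \<le> dist (f x) (f y)"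
proof (cases "\<exists>x\<in>Q. \<exists>y\<in>Q. \<delta> \<le> dist x y")
  case True
  define S where "S = (Q \<times> Q) \<inter> {p. \<delta> \<le> dist (fst p) (snd p)}"
  have S: "compact S" "S \<noteq> {}"
    unfolding S_def using Q True
    by (auto intro!: compact_Int_closed compact_Times closed_Collect_le continuous_intros)
  have "continuous_on S (\<lambda>p. dist (f (fst p)) (f (snd p)))"
    by (intro continuous_on_dist continuous_on_compose2[OF cont]) (auto simp: S_def intro!: continuous_intros)
  then obtain p where p: "p \<in> S" "\<And>p'. p' \<in> S \<Longrightarrow> dist (f (fst p)) (f (snd p)) \<le> dist (f (fst p')) (f (snd p'))"
    using continuous_attains_inf[OF S] by blast
  have pQ: "fst p \<in> Q" "snd p \<in> Q" and "fst p \<noteq> snd p" using p(1) \<delta> by (auto simp: S_def)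
  then have "0 < dist (f (fst p)) (f (snd p))" using inj_on_eq_iff[OF inj pQ] by simp
  moreover have "dist (f (fst p)) (f (snd p)) \<le> dist (f x) (f y)" if "x \<in> Q" "y \<in> Q" "\<delta> \<le> dist x y" for x y
  proof -
    have "(x, y) \<in> S" using that by (simp add: S_def)
    from p(2)[OF this] show ?thesis by simp
  qed
  ultimately show ?thesis by (rule that)
next
  case False
  show ?thesis
  proof (rule that)
    show "(0::real) < 1" by simp
  qed (use False in blast)
qed

text \<open>For distant pairs the logarithms are bounded by compactness, and a constant is at most a multiple
  of a power of a distance that is bounded below.\<close>

lemma conformal_ratio_bound:
  fixes f :: "'a::euclidean_space \<Rightarrow> 'a"
  assumes \<Omega>: "open \<Omega>" and Q: "compact Q" "Q \<subseteq> \<Omega>" and inj: "inj_on f \<Omega>"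
    and der: "\<And>x. x \<in> \<Omega> \<Longrightarrow> (f has_derivative f' x) (at x)"
    and conf: "\<And>x y. x \<in> \<Omega> \<Longrightarrow> norm (f' x y) = s x * norm y"
    and s0: "0 < s0" "\<And>x. x \<in> \<Omega> \<Longrightarrow> s0 \<le> s x" and s1: "\<And>x. x \<in> \<Omega> \<Longrightarrow> s x \<le> 1"
    and lip: "\<And>x y. x \<in> \<Omega> \<Longrightarrow> y \<in> \<Omega> \<Longrightarrow> dist (f x) (f y) \<le> dist x y"
    and \<alpha>: "0 < \<alpha>"
    and hol: "\<And>x y. x \<in> \<Omega> \<Longrightarrow> y \<in> \<Omega> \<Longrightarrow> \<bar>s x - s y\<bar> \<le> H * dist x y powr \<alpha>"
  obtains C where "0 \<le> C"
    "\<And>x y. x \<in> Q \<Longrightarrow> y \<in> Q \<Longrightarrow> \<bar>ln (s x) - ln (s y)\<bar> \<le> C * dist x y powr \<alpha>"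
    "\<And>x y. x \<in> Q \<Longrightarrow> y \<in> Q \<Longrightarrow> x \<noteq> y \<Longrightarrow>
      \<bar>ln (dist (f x) (f y) / dist x y) - ln (s x)\<bar> \<le> C * dist x y powr \<alpha>"
proof -
  define H' where "H' = max H 0 / s0"
  have H': "0 \<le> H'" using s0 by (simp add: H'_def)
  have lnhol: "\<bar>ln (s x) - ln (s y)\<bar> \<le> H' * dist x y powr \<alpha>" if "x \<in> \<Omega>" "y \<in> \<Omega>" for x y
  proof -
    have "\<bar>ln (s x) - ln (s y)\<bar> \<le> \<bar>s x - s y\<bar> / s0" using that s0 by (intro ln_diff_le) auto
    also have "\<dots> \<le> (max H 0 * dist x y powr \<alpha>) / s0"
    proof (rule divide_right_mono)
      have "H * dist x y powr \<alpha> \<le> max H 0 * dist x y powr \<alpha>" by (intro mult_right_mono) auto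
      then show "\<bar>s x - s y\<bar> \<le> max H 0 * dist x y powr \<alpha>" using hol[OF that] by linarith
    qed (use s0 in simp)
    finally show ?thesis by (simp add: H'_def)
  qed
  obtain \<delta> C1 where \<delta>: "0 < \<delta>" and C1: "0 \<le> C1" "\<And>x y. x \<in> Q \<Longrightarrow> y \<in> Q \<Longrightarrow> x \<noteq> y \<Longrightarrow> dist x y < \<delta> \<Longrightarrow>
      \<bar>ln (dist (f x) (f y) / dist x y) - ln (s x)\<bar> \<le> C1 * dist x y powr \<alpha>"
    using conformal_ratio_near[OF \<Omega> Q inj der conf s0 lip \<alpha> H' lnhol] by blast
  have cont: "continuous_on Q f"
    using der \<Omega> Q by (intro continuous_at_imp_continuous_on ballI has_derivative_continuous) blast
  obtain e where e: "0 < e" "\<And>x y. x \<in> Q \<Longrightarrow> y \<in> Q \<Longrightarrow> \<delta> \<le> dist x y \<Longrightarrow> e \<le> dist (f x) (f y)"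
    using dist_ratio_bounded_below_far[OF Q(1) cont inj_on_subset[OF inj Q(2)] \<delta>] by blast
  define B where "B = diameter Q + e"
  have B: "0 < B" "e \<le> B" "\<And>x y. x \<in> Q \<Longrightarrow> y \<in> Q \<Longrightarrow> dist x y \<le> B"
    using e diameter_ge_0[OF compact_imp_bounded[OF Q(1)]] diameter_bounded_bound[OF compact_imp_bounded[OF Q(1)]]
    by (fastforce simp: B_def)+
  define C2 where "C2 = (- ln (e / B) - ln s0) / \<delta> powr \<alpha>"
  have far: "\<bar>ln (dist (f x) (f y) / dist x y) - ln (s x)\<bar> \<le> C2 * dist x y powr \<alpha>"
    if xy: "x \<in> Q" "y \<in> Q" "\<delta> \<le> dist x y" for x y
  proof -
    have x: "x \<in> \<Omega>" "y \<in> \<Omega>" using xy Q by auto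
    have d: "0 < dist x y" using xy(3) \<delta> by linarith
    have fd: "e \<le> dist (f x) (f y)" using e(2)[OF xy] .
    have "e / B \<le> dist (f x) (f y) / dist x y"
      using fd B(3)[OF xy(1,2)] e d B by (intro frac_le) auto
    moreover have "0 < dist (f x) (f y) / dist x y" using fd e(1) d by (intro divide_pos_pos) linarith+
    ultimately have 1: "ln (e / B) \<le> ln (dist (f x) (f y) / dist x y)"
      using e B by (subst ln_le_cancel_iff) auto
    have 2: "ln (dist (f x) (f y) / dist x y) \<le> 0"
      using lip[OF x] d fd e by (intro ln_le_zero_iff[THEN iffD2]) (auto simp: divide_simps)
    have "0 < s x" using s0(1) s0(2)[OF x(1)] by linarith
    then have 3: "ln s0 \<le> ln (s x)" "ln (s x) \<le> 0" using s0 s1 x by (auto simp: ln_le_cancel_iff)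
    have "ln s0 \<le> 0" "ln (e / B) \<le> 0" using 1 2 3 by linarith+
    then have nonneg: "0 \<le> - ln (e / B) - ln s0" by linarith
    have "\<bar>ln (dist (f x) (f y) / dist x y) - ln (s x)\<bar> \<le> - ln (e / B) - ln s0" using 1 2 3 by linarith
    also have "\<dots> = C2 * \<delta> powr \<alpha>" using \<delta> by (simp add: C2_def)
    also have "\<dots> \<le> C2 * dist x y powr \<alpha>"
      using nonneg xy(3) \<delta> \<alpha> by (intro mult_left_mono powr_mono2) (auto simp: C2_def)
    finally show ?thesis .
  qed
  define C where "C = max H' (max C1 C2)"
  have C: "H' \<le> C" "C1 \<le> C" "C2 \<le> C" by (auto simp: C_def)
  show ?thesis
  proof (rule that[of C])
    show "0 \<le> C" using H' C by simp
    show "\<bar>ln (s x) - ln (s y)\<bar> \<le> C * dist x y powr \<alpha>" if "x \<in> Q" "y \<in> Q" for x y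
    proof -
      have "\<bar>ln (s x) - ln (s y)\<bar> \<le> H' * dist x y powr \<alpha>" using that Q by (intro lnhol) auto
      also have "\<dots> \<le> C * dist x y powr \<alpha>" using C by (intro mult_right_mono) auto
      finally show ?thesis .
    qed
    show "\<bar>ln (dist (f x) (f y) / dist x y) - ln (s x)\<bar> \<le> C * dist x y powr \<alpha>"
      if "x \<in> Q" "y \<in> Q" "x \<noteq> y" for x y
    proof (cases "dist x y < \<delta>")
      case True
      have "\<bar>ln (dist (f x) (f y) / dist x y) - ln (s x)\<bar> \<le> C1 * dist x y powr \<alpha>"
        using that True by (intro C1)
      also have "\<dots> \<le> C * dist x y powr \<alpha>" using C by (intro mult_right_mono) auto
      finally show ?thesis .
    next
      case False
      have "\<bar>ln (dist (f x) (f y) / dist x y) - ln (s x)\<bar> \<le> C2 * dist x y powr \<alpha>"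
        using that False by (intro far) auto
      also have "\<dots> \<le> C * dist x y powr \<alpha>" using C by (intro mult_right_mono) auto
      finally show ?thesis .
    qed
  qed
qed

text \<open>The logarithm of the distance ratio of a pair under a word is the sum of the logarithms for the
  single maps along the orbit. Up to a summable error each term depends only on the derivative at
  one of the points, and the sums of these derivative terms at different points also differ by a
  summable error, since orbits approach each other geometrically.\<close>

lemma bounded_distortion_words:
  fixes \<phi> :: "nat \<Rightarrow> 'a::metric_space \<Rightarrow> 'a"
  assumes maps: "\<And>j x. j \<in> J \<Longrightarrow> x \<in> Q \<Longrightarrow> \<phi> j x \<in> Q"
    and inj: "\<And>j. j \<in> J \<Longrightarrow> inj_on (\<phi> j) Q"
    and c: "0 < c" "c < 1"
    and contr: "\<And>j x y. j \<in> J \<Longrightarrow> x \<in> Q \<Longrightarrow> y \<in> Q \<Longrightarrow> dist (\<phi> j x) (\<phi> j y) \<le> c * dist x y"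
    and B: "0 \<le> B" "\<And>x y. x \<in> Q \<Longrightarrow> y \<in> Q \<Longrightarrow> dist x y \<le> B" and \<alpha>: "0 < \<alpha>" and C: "0 \<le> C"
    and s_pos: "\<And>j x. j \<in> J \<Longrightarrow> x \<in> Q \<Longrightarrow> 0 < s j x"
    and s_hol: "\<And>j x y. j \<in> J \<Longrightarrow> x \<in> Q \<Longrightarrow> y \<in> Q \<Longrightarrow> \<bar>ln (s j x) - ln (s j y)\<bar> \<le> C * dist x y powr \<alpha>"
    and ratio: "\<And>j x y. j \<in> J \<Longrightarrow> x \<in> Q \<Longrightarrow> y \<in> Q \<Longrightarrow> x \<noteq> y \<Longrightarrow>
        \<bar>ln (dist (\<phi> j x) (\<phi> j y) / dist x y) - ln (s j x)\<bar> \<le> C * dist x y powr \<alpha>"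
  obtains D where "\<And>w x y x' y'. w \<in> lists J \<Longrightarrow> x \<in> Q \<Longrightarrow> y \<in> Q \<Longrightarrow> x' \<in> Q \<Longrightarrow> y' \<in> Q \<Longrightarrow>
      dist (compose_word \<phi> w x) (compose_word \<phi> w y) * dist x' y'
        \<le> D * dist (compose_word \<phi> w x') (compose_word \<phi> w y') * dist x y"
proof -
  let ?f = "compose_word \<phi>"
  define \<gamma> where "\<gamma> = c powr \<alpha>"
  have \<gamma>: "0 < \<gamma>" "\<gamma> < 1" using c \<alpha> powr_less_mono2[of \<alpha> c 1] by (auto simp: \<gamma>_def)
  define E where "E = C * B powr \<alpha>"
  have E: "0 \<le> E" using C by (simp add: E_def)
  have fQ: "?f w x \<in> Q" if "w \<in> lists J" "x \<in> Q" for w x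
    using compose_word_in[of J Q \<phi>, OF maps that] .
  have fcontr: "dist (?f w x) (?f w y) \<le> c ^ length w * dist x y" if "w \<in> lists J" "x \<in> Q" "y \<in> Q" for w x y
    using compose_word_contraction[of J Q \<phi>, OF maps less_imp_le[OF c(1)] contr that] .
  have finj: "?f w x \<noteq> ?f w y" if "w \<in> lists J" "x \<in> Q" "y \<in> Q" "x \<noteq> y" for w x y
    using compose_word_inj_on[of J Q \<phi>, OF maps inj that(1)] that by (auto simp: inj_on_def)
  have small: "C * dist (?f w x) (?f w y) powr \<alpha> \<le> E * \<gamma> ^ length w" if "w \<in> lists J" "x \<in> Q" "y \<in> Q" for w x y
  proof -
    have "dist (?f w x) (?f w y) \<le> c ^ length w * B"
      using fcontr[OF that] B(2)[OF that(2,3)] c by (meson mult_left_mono order_trans zero_le_power less_imp_le)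
    then have "dist (?f w x) (?f w y) powr \<alpha> \<le> (c ^ length w * B) powr \<alpha>"
      using \<alpha> by (intro powr_mono2) auto
    also have "\<dots> = \<gamma> ^ length w * B powr \<alpha>"
      using c B by (simp add: powr_mult \<gamma>_def powr_realpow[symmetric] powr_powr mult_ac)
    finally have "C * dist (?f w x) (?f w y) powr \<alpha> \<le> C * (\<gamma> ^ length w * B powr \<alpha>)"
      using C by (intro mult_left_mono)
    then show ?thesis by (simp add: E_def mult_ac)
  qed
  \<comment> \<open>the logarithm of the derivative of the word map at \<open>x\<close>, by the chain rule\<close>
  define A where "A w x = rec_list (0::real) (\<lambda>j u r. ln (s j (?f u x)) + r) w" for w x
  have A_simps: "A [] x = 0" "A (j # w) x = ln (s j (?f w x)) + A w x" for j w x
    by (simp_all add: A_def)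
  have "\<bar>A w x - A w y\<bar> \<le> E * (\<Sum>k<length w. \<gamma> ^ k) \<and>
      (x \<noteq> y \<longrightarrow> \<bar>ln (dist (?f w x) (?f w y) / dist x y) - A w x\<bar> \<le> E * (\<Sum>k<length w. \<gamma> ^ k))"
    if w: "w \<in> lists J" and xyQ: "x \<in> Q" "y \<in> Q" for w x y
    using w
  proof (induction w rule: list.induct)
    case Nil
    then show ?case by (simp add: A_simps)
  next
    case (Cons j w)
    then have w: "w \<in> lists J" "j \<in> J" and Q: "?f w x \<in> Q" "?f w y \<in> Q" using fQ xyQ by auto
    note sm = small[OF w(1) xyQ]
    have split: "E * (\<Sum>k<length (j # w). \<gamma> ^ k) = E * (\<Sum>k<length w. \<gamma> ^ k) + E * \<gamma> ^ length w"
      by (simp add: distrib_left)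
    have "\<bar>A (j # w) x - A (j # w) y\<bar> \<le> E * (\<Sum>k<length (j # w). \<gamma> ^ k)"
      unfolding split A_simps using s_hol[OF w(2) Q] sm Cons w by auto
    moreover have "\<bar>ln (dist (?f (j # w) x) (?f (j # w) y) / dist x y) - A (j # w) x\<bar>
        \<le> E * (\<Sum>k<length (j # w). \<gamma> ^ k)" if "x \<noteq> y"
    proof -
      let ?d = "dist (?f w x) (?f w y)"
      have pos: "0 < dist x y" "0 < ?d" "0 < dist (\<phi> j (?f w x)) (\<phi> j (?f w y))"
        using that finj[OF w(1) xyQ that] finj[OF Cons.prems xyQ that] by auto
      have "dist (?f (j # w) x) (?f (j # w) y) / dist x y
          = (dist (\<phi> j (?f w x)) (\<phi> j (?f w y)) / ?d) * (?d / dist x y)"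
        using pos by simp
      then have "ln (dist (?f (j # w) x) (?f (j # w) y) / dist x y)
          = ln (dist (\<phi> j (?f w x)) (\<phi> j (?f w y)) / ?d) + ln (?d / dist x y)"
        using pos by (simp only: ln_mult_pos divide_pos_pos)
      moreover have "\<bar>ln (dist (\<phi> j (?f w x)) (\<phi> j (?f w y)) / ?d) - ln (s j (?f w x))\<bar> \<le> E * \<gamma> ^ length w"
        using ratio[OF w(2) Q] sm pos by fastforce
      moreover have "\<bar>ln (?d / dist x y) - A w x\<bar> \<le> E * (\<Sum>k<length w. \<gamma> ^ k)"
        using Cons w that by auto
      ultimately show ?thesis unfolding split A_simps by linarith
    qed
    ultimately show ?case by blast
  qed
  moreover have "E * (\<Sum>k<length w. \<gamma> ^ k) \<le> E / (1 - \<gamma>)" for w :: "nat list"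
  proof -
    have "(\<Sum>k<length w. \<gamma> ^ k) \<le> (\<Sum>k. \<gamma> ^ k)"
      using \<gamma> by (intro sum_le_suminf summable_geometric) auto
    also have "\<dots> = 1 / (1 - \<gamma>)" using \<gamma> by (simp add: suminf_geometric)
    finally have "E * (\<Sum>k<length w. \<gamma> ^ k) \<le> E * (1 / (1 - \<gamma>))" using E by (intro mult_left_mono)
    then show ?thesis by simp
  qed
  ultimately have A: "\<bar>A w x - A w y\<bar> \<le> E / (1 - \<gamma>)"
      "x \<noteq> y \<Longrightarrow> \<bar>ln (dist (?f w x) (?f w y) / dist x y) - A w x\<bar> \<le> E / (1 - \<gamma>)"
    if "w \<in> lists J" "x \<in> Q" "y \<in> Q" for w x y
    using that by (meson order_trans)+
  define F where "F = E / (1 - \<gamma>)"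
  have "dist (?f w x) (?f w y) * dist x' y' \<le> exp (3 * F) * dist (?f w x') (?f w y') * dist x y"
    if w: "w \<in> lists J" and xy: "x \<in> Q" "y \<in> Q" "x' \<in> Q" "y' \<in> Q" for w x y x' y'
  proof (cases "x = y \<or> x' = y'")
    case True
    then show ?thesis by auto
  next
    case False
    then have ne: "x \<noteq> y" "x' \<noteq> y'" by auto
    have pos: "0 < dist x y" "0 < dist x' y'" "0 < dist (?f w x) (?f w y)" "0 < dist (?f w x') (?f w y')"
      using ne finj[OF w] xy by auto
    have "ln (dist (?f w x) (?f w y) / dist x y) \<le> 3 * F + ln (dist (?f w x') (?f w y') / dist x' y')"
      using A(2)[OF w xy(1,2) ne(1)] A(2)[OF w xy(3,4) ne(2)] A(1)[OF w xy(1,3)]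
      unfolding F_def[symmetric] by linarith
    then have "exp (ln (dist (?f w x) (?f w y) / dist x y))
        \<le> exp (3 * F + ln (dist (?f w x') (?f w y') / dist x' y'))" by simp
    then have "dist (?f w x) (?f w y) / dist x y \<le> exp (3 * F) * (dist (?f w x') (?f w y') / dist x' y')"
      using pos by (simp add: exp_add)
    then show ?thesis using pos by (simp add: field_simps)
  qed
  then show ?thesis using that by blast
qed

text \<open>The image of the open ball is open and its frontier is contained in the image of the sphere. A
  ball about \<open>f v\<close> that does not reach the latter cannot leave the former, by connectedness.\<close>

lemma ball_subset_image_ball:
  fixes f :: "'a::euclidean_space \<Rightarrow> 'a"
  assumes cont: "continuous_on (cball v \<delta>) f" and inj: "inj_on f (cball v \<delta>)" and \<delta>: "0 < \<delta>"
    and far: "\<And>y. y \<in> sphere v \<delta> \<Longrightarrow> r \<le> dist (f v) (f y)"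
  shows "ball (f v) r \<subseteq> f ` ball v \<delta>"
proof (rule ccontr)
  assume not_sub: "\<not> ball (f v) r \<subseteq> f ` ball v \<delta>"
  then have r: "0 < r" by (metis ball_eq_empty empty_subsetI not_less)
  have sub: "ball v \<delta> \<subseteq> cball v \<delta>" by auto
  have op: "open (f ` ball v \<delta>)"
    using continuous_on_subset[OF cont sub] inj_on_subset[OF inj sub] by (intro invariance_of_domain) auto
  have "closed (f ` cball v \<delta>)"
    using compact_continuous_image[OF cont] by (simp add: compact_imp_closed)
  then have "closure (f ` ball v \<delta>) \<subseteq> f ` cball v \<delta>"
    using sub by (intro closure_minimal image_mono) auto
  then have frontier: "frontier (f ` ball v \<delta>) \<subseteq> f ` sphere v \<delta>"
    using op by (fastforce simp: frontier_def interior_open)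
  have "ball (f v) r \<inter> frontier (f ` ball v \<delta>) \<noteq> {}"
  proof (rule connected_Int_frontier)
    have "f v \<in> ball (f v) r \<inter> f ` ball v \<delta>" using r \<delta> by simp
    then show "ball (f v) r \<inter> f ` ball v \<delta> \<noteq> {}" by blast
  qed (use not_sub in auto)
  then show False using frontier far by fastforce
qed

lemma incomparable_words_disjoint:
  assumes V: "\<And>j. j \<in> J \<Longrightarrow> \<phi> j ` V \<subseteq> V"
    and disj: "\<And>i j. i \<in> J \<Longrightarrow> j \<in> J \<Longrightarrow> i \<noteq> j \<Longrightarrow> \<phi> i ` V \<inter> \<phi> j ` V = {}"
    and inj: "\<And>j. j \<in> J \<Longrightarrow> inj_on (\<phi> j) V"
    and w: "w \<in> lists J" "w' \<in> lists J" "\<not> prefix w w'" "\<not> prefix w' w"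
  shows "compose_word \<phi> w ` V \<inter> compose_word \<phi> w' ` V = {}"
  using w
proof (induction w arbitrary: w' rule: list.induct)
  case (Cons j u)
  have stay: "compose_word \<phi> w x \<in> V" if "w \<in> lists J" "x \<in> V" for w x
    using compose_word_in[of J V \<phi>] V that by blast
  from Cons.prems obtain i u' where w': "w' = i # u'" by (cases w') auto
  have J: "j \<in> J" "i \<in> J" "u \<in> lists J" "u' \<in> lists J" using Cons.prems w' by auto
  have sub: "compose_word \<phi> u ` V \<subseteq> V" "compose_word \<phi> u' ` V \<subseteq> V" using stay J by auto
  show ?case
  proof (cases "i = j")
    case True
    then have IH: "compose_word \<phi> u ` V \<inter> compose_word \<phi> u' ` V = {}"
      using Cons.IH[OF J(3,4)] Cons.prems w' by auto
    have "\<phi> j ` (compose_word \<phi> u ` V) \<inter> \<phi> j ` (compose_word \<phi> u' ` V)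
        = \<phi> j ` (compose_word \<phi> u ` V \<inter> compose_word \<phi> u' ` V)"
      using sub inj[OF J(1)] by (intro inj_on_image_Int[symmetric])
    then show ?thesis using IH w' True by (simp add: image_comp)
  next
    case False
    have "\<phi> j ` (compose_word \<phi> u ` V) \<inter> \<phi> i ` (compose_word \<phi> u' ` V) \<subseteq> \<phi> j ` V \<inter> \<phi> i ` V"
      using sub by blast
    also have "\<dots> = {}" using disj[of j i] False J by auto
    finally show ?thesis using w' by (simp add: image_comp)
  qed
qed simp

section \<open>Conformal systems with the open set condition\<close>

text \<open>As invariant set serves the union of the closures of the sets \<open>\<phi>\<^sub>j(\<Omega>)\<close>: it is compact, contains
  the attractor, and contains \<open>\<phi>\<^sub>1(V)\<close>, where \<open>V\<close> is given by the open set condition. With \<open>v\<close>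
  chosen in \<open>\<phi>\<^sub>1(V)\<close>, bounded distortion puts a ball of radius proportional to \<open>L(w)\<close> about \<open>\<phi>\<^sub>w(v)\<close>
  inside \<open>\<phi>\<^sub>w(V)\<close>, and \<open>\<phi>\<^sub>w\<^sub>'(V)\<close> avoids this set for incomparable words.\<close>

lemma conformal_ifs_imp_distortion_ifs:
  fixes \<phi> :: "nat \<Rightarrow> real^'n \<Rightarrow> real^'n"
  assumes ifs: "conformal_ifs \<alpha> \<Omega> m \<phi>" and osc: "open_set_condition \<Omega> m \<phi>"
    and K: "self_conformal_set \<Omega> m \<phi> K"
  obtains Q c D \<kappa> a b v where "distortion_ifs \<phi> m K Q c D \<kappa> a b v"
proof -
  let ?J = "{1..m}"
  have \<alpha>: "0 < \<alpha>" and m: "2 \<le> m" and \<Omega>: "open \<Omega>" "bounded \<Omega>"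
    using ifs by (auto simp: conformal_ifs_def)
  have conf: "conformal_on \<Omega> (\<phi> j)" and contr: "\<exists>c<1. c-lipschitz_on \<Omega> (\<phi> j)"
    and maps: "\<phi> j ` \<Omega> \<subseteq> \<Omega>" and clos: "closure (\<phi> j ` \<Omega>) \<subseteq> \<Omega>"
    and inf: "0 < (INF x\<in>\<Omega>. jacobian_norm (\<phi> j) x)"
    and bdd: "bdd_above (jacobian_norm (\<phi> j) ` \<Omega>)" and sup: "(SUP x\<in>\<Omega>. jacobian_norm (\<phi> j) x) < 1"
    and hol: "\<exists>C. \<forall>x\<in>\<Omega>. \<forall>y\<in>\<Omega>. \<bar>jacobian_norm (\<phi> j) x - jacobian_norm (\<phi> j) y\<bar> \<le> C * norm (x - y) powr \<alpha>"
    if "j \<in> ?J" for j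
    using ifs that by (auto simp: conformal_ifs_def)
  have inj: "inj_on (\<phi> j) \<Omega>" if "j \<in> ?J" for j using conf[OF that] by (simp add: conformal_on_def)
  have der: "(\<phi> j has_derivative (*v) (jacobian (\<phi> j) (at x))) (at x)" if "j \<in> ?J" "x \<in> \<Omega>" for j x
    using conf[OF that(1)] that(2) by (auto simp: conformal_on_def jacobian_works[symmetric])
  have similar: "norm (jacobian (\<phi> j) (at x) *v y) = jacobian_norm (\<phi> j) x * norm y" if "j \<in> ?J" "x \<in> \<Omega>" for j x y
    using conf[OF that(1)] that(2) by (auto simp: conformal_on_def)
  define s0 where "s0 j = (INF x\<in>\<Omega>. jacobian_norm (\<phi> j) x)" for j
  have s0_pos: "0 < s0 j" if "j \<in> ?J" for j using inf[OF that] by (simp add: s0_def)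
  have s0_le: "s0 j \<le> jacobian_norm (\<phi> j) x" if "j \<in> ?J" "x \<in> \<Omega>" for j x
    unfolding s0_def using that(2)
    by (intro cINF_lower bdd_belowI2[of _ 0] onorm_pos_le matrix_vector_mul_bounded_linear)
  have s_le_1: "jacobian_norm (\<phi> j) x \<le> 1" if "j \<in> ?J" "x \<in> \<Omega>" for j x
    using cSUP_upper[OF that(2) bdd[OF that(1)]] sup[OF that(1)] by linarith
  obtain cj where cj: "\<And>j. j \<in> ?J \<Longrightarrow> cj j < 1 \<and> (cj j)-lipschitz_on \<Omega> (\<phi> j)"
    using contr by metis
  define c where "c = Max (insert (1/2) (cj ` ?J))"
  have c_ge: "1/2 \<le> c" unfolding c_def by (rule Max_ge) simp_all
  have cj_le: "cj j \<le> c" if "j \<in> ?J" for j unfolding c_def by (rule Max_ge) (use that in simp_all)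
  have c_less: "c < 1" unfolding c_def using cj by (subst Max_less_iff) auto
  have c_pos: "0 < c" using c_ge by simp
  have contraction: "dist (\<phi> j x) (\<phi> j y) \<le> c * dist x y" if "j \<in> ?J" "x \<in> \<Omega>" "y \<in> \<Omega>" for j x y
  proof -
    have "dist (\<phi> j x) (\<phi> j y) \<le> cj j * dist x y" using cj[OF that(1)] that lipschitz_onD by blast
    also have "\<dots> \<le> c * dist x y" using cj_le[OF that(1)] by (intro mult_right_mono) auto
    finally show ?thesis .
  qed
  have nonexp: "dist (\<phi> j x) (\<phi> j y) \<le> dist x y" if "j \<in> ?J" "x \<in> \<Omega>" "y \<in> \<Omega>" for j x y
  proof -
    have "c * dist x y \<le> 1 * dist x y" using c_less by (intro mult_right_mono) auto
    then show ?thesis using contraction[OF that] by simp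
  qed
  define Q where "Q = (\<Union>j\<in>?J. closure (\<phi> j ` \<Omega>))"
  have Q_sub: "Q \<subseteq> \<Omega>" unfolding Q_def using clos by blast
  have Q_compact: "compact Q"
  proof -
    have "closed Q" unfolding Q_def by (intro closed_UN) auto
    then show ?thesis using bounded_subset[OF \<Omega>(2) Q_sub] by (simp add: compact_eq_bounded_closed)
  qed
  have Q_maps: "\<phi> j x \<in> Q" if "j \<in> ?J" "x \<in> \<Omega>" for j x
    unfolding Q_def using that closure_subset[of "\<phi> j ` \<Omega>"] by blast
  have K': "compact K" "K \<noteq> {}" "K \<subseteq> \<Omega>" "K = (\<Union>j\<in>?J. \<phi> j ` K)"
    using K by (auto simp: self_conformal_set_def)
  have K_sub: "K \<subseteq> Q"
  proof
    fix x assume "x \<in> K"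
    then obtain j y where "j \<in> ?J" "y \<in> K" "x = \<phi> j y" using K'(4) by blast
    then show "x \<in> Q" using Q_maps K'(3) by blast
  qed
  have "\<exists>C\<ge>0. (\<forall>x\<in>Q. \<forall>y\<in>Q. \<bar>ln (jacobian_norm (\<phi> j) x) - ln (jacobian_norm (\<phi> j) y)\<bar> \<le> C * dist x y powr \<alpha> \<and>
      (x \<noteq> y \<longrightarrow> \<bar>ln (dist (\<phi> j x) (\<phi> j y) / dist x y) - ln (jacobian_norm (\<phi> j) x)\<bar> \<le> C * dist x y powr \<alpha>))"
    if j: "j \<in> ?J" for j
  proof -
    obtain H where H: "\<And>x y. x \<in> \<Omega> \<Longrightarrow> y \<in> \<Omega> \<Longrightarrow>
        \<bar>jacobian_norm (\<phi> j) x - jacobian_norm (\<phi> j) y\<bar> \<le> H * dist x y powr \<alpha>"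
      using hol[OF j] unfolding dist_norm by blast
    obtain C where "0 \<le> C"
      "\<And>x y. x \<in> Q \<Longrightarrow> y \<in> Q \<Longrightarrow> \<bar>ln (jacobian_norm (\<phi> j) x) - ln (jacobian_norm (\<phi> j) y)\<bar> \<le> C * dist x y powr \<alpha>"
      "\<And>x y. x \<in> Q \<Longrightarrow> y \<in> Q \<Longrightarrow> x \<noteq> y \<Longrightarrow>
        \<bar>ln (dist (\<phi> j x) (\<phi> j y) / dist x y) - ln (jacobian_norm (\<phi> j) x)\<bar> \<le> C * dist x y powr \<alpha>"
      using conformal_ratio_bound[OF \<Omega>(1) Q_compact Q_sub inj[OF j] der[OF j] similar[OF j] s0_pos[OF j]
          s0_le[OF j] s_le_1[OF j] nonexp[OF j] \<alpha> H] by blast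
    then show ?thesis by blast
  qed
  then obtain Cj where Cj: "\<And>j. j \<in> ?J \<Longrightarrow> 0 \<le> Cj j"
    "\<And>j x y. j \<in> ?J \<Longrightarrow> x \<in> Q \<Longrightarrow> y \<in> Q \<Longrightarrow>
      \<bar>ln (jacobian_norm (\<phi> j) x) - ln (jacobian_norm (\<phi> j) y)\<bar> \<le> Cj j * dist x y powr \<alpha>"
    "\<And>j x y. j \<in> ?J \<Longrightarrow> x \<in> Q \<Longrightarrow> y \<in> Q \<Longrightarrow> x \<noteq> y \<Longrightarrow>
      \<bar>ln (dist (\<phi> j x) (\<phi> j y) / dist x y) - ln (jacobian_norm (\<phi> j) x)\<bar> \<le> Cj j * dist x y powr \<alpha>"
    by metis
  define C where "C = (\<Sum>j\<in>?J. Cj j)"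
  have C: "0 \<le> C" "\<And>j. j \<in> ?J \<Longrightarrow> Cj j \<le> C"
    unfolding C_def using Cj(1) by (auto intro: sum_nonneg member_le_sum)
  have C_mono: "Cj j * dist x y powr \<alpha> \<le> C * dist x y powr \<alpha>" if "j \<in> ?J" for j x y
    using C(2)[OF that] by (intro mult_right_mono) auto
  have Q_stay: "\<phi> j x \<in> Q" if "j \<in> ?J" "x \<in> Q" for j x using Q_maps that Q_sub by blast
  have Q_inj: "inj_on (\<phi> j) Q" if "j \<in> ?J" for j using inj_on_subset[OF inj[OF that] Q_sub] .
  have Q_contraction: "dist (\<phi> j x) (\<phi> j y) \<le> c * dist x y" if "j \<in> ?J" "x \<in> Q" "y \<in> Q" for j x y
    using contraction that Q_sub by blast
  have Q_bdd: "bounded Q" using Q_compact by (rule compact_imp_bounded)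
  obtain D where D: "\<And>w x y x' y'. w \<in> lists ?J \<Longrightarrow> x \<in> Q \<Longrightarrow> y \<in> Q \<Longrightarrow> x' \<in> Q \<Longrightarrow> y' \<in> Q \<Longrightarrow>
      dist (compose_word \<phi> w x) (compose_word \<phi> w y) * dist x' y'
        \<le> D * dist (compose_word \<phi> w x') (compose_word \<phi> w y') * dist x y"
  proof (rule bounded_distortion_words[where J = ?J and Q = Q and \<phi> = \<phi> and c = c and B = "diameter Q"
      and \<alpha> = \<alpha> and C = C and s = "\<lambda>j. jacobian_norm (\<phi> j)"])
    show "dist x y \<le> diameter Q" if "x \<in> Q" "y \<in> Q" for x y using diameter_bounded_bound[OF Q_bdd that] .
    show "0 \<le> diameter Q" using diameter_ge_0[OF Q_bdd] .
    show "\<phi> j x \<in> Q" if "j \<in> ?J" "x \<in> Q" for j x using Q_stay[OF that] .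
    show "inj_on (\<phi> j) Q" if "j \<in> ?J" for j using Q_inj[OF that] .
    show "dist (\<phi> j x) (\<phi> j y) \<le> c * dist x y" if "j \<in> ?J" "x \<in> Q" "y \<in> Q" for j x y
      using Q_contraction[OF that] .
    show "0 < jacobian_norm (\<phi> j) x" if "j \<in> ?J" "x \<in> Q" for j x
      using s0_pos[OF that(1)] s0_le[OF that(1), of x] that(2) Q_sub by (meson less_le_trans subsetD)
    show "\<bar>ln (jacobian_norm (\<phi> j) x) - ln (jacobian_norm (\<phi> j) y)\<bar> \<le> C * dist x y powr \<alpha>"
      if "j \<in> ?J" "x \<in> Q" "y \<in> Q" for j x y
      using Cj(2)[OF that] C_mono[OF that(1), of x y] by linarith
    show "\<bar>ln (dist (\<phi> j x) (\<phi> j y) / dist x y) - ln (jacobian_norm (\<phi> j) x)\<bar> \<le> C * dist x y powr \<alpha>"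
      if "j \<in> ?J" "x \<in> Q" "y \<in> Q" "x \<noteq> y" for j x y
      using Cj(3)[OF that] C_mono[OF that(1), of x y] by linarith
  qed (use c_pos c_less \<alpha> C in auto)
  obtain V where V0: "V \<noteq> {} \<and> open V \<and> V \<subseteq> \<Omega> \<and> (\<forall>j\<in>?J. \<phi> j ` V \<subseteq> V) \<and>
      (\<forall>i\<in>?J. \<forall>j\<in>?J. i \<noteq> j \<longrightarrow> \<phi> i ` V \<inter> \<phi> j ` V = {})"
    using osc unfolding open_set_condition_def ..
  then have V: "V \<noteq> {}" "open V" "V \<subseteq> \<Omega>" "\<And>j. j \<in> ?J \<Longrightarrow> \<phi> j ` V \<subseteq> V" by simp_all
  have V_disjoint: "\<phi> i ` V \<inter> \<phi> j ` V = {}" if "i \<in> ?J" "j \<in> ?J" "i \<noteq> j" for i j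
    using V0 that by simp
  have one: "1 \<in> ?J" using m by simp
  have "continuous_on \<Omega> (\<phi> 1)"
    using der[OF one] \<Omega>(1) by (intro continuous_at_imp_continuous_on ballI has_derivative_continuous) blast
  then have "open (\<phi> 1 ` V)"
    using V inj_on_subset[OF inj[OF one] V(3)] by (intro invariance_of_domain) (auto intro: continuous_on_subset)
  moreover obtain v where v: "v \<in> \<phi> 1 ` V" using V(1) by blast
  ultimately obtain \<delta> where \<delta>: "0 < \<delta>" "cball v \<delta> \<subseteq> \<phi> 1 ` V" by (meson open_contains_cball)
  have ball_Q: "cball v \<delta> \<subseteq> Q" using \<delta>(2) V(3) Q_maps[OF one] by blast
  have ball_V: "cball v \<delta> \<subseteq> V" using \<delta>(2) V(4)[OF one] by blast
  define b where "b = v + \<delta> *\<^sub>R axis undefined 1"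
  have b: "dist v b = \<delta>" using \<delta>(1) by (simp add: b_def dist_norm norm_axis_1)
  have v_in: "v \<in> Q" "v \<in> V" using ball_Q ball_V \<delta>(1) by auto
  have b_in: "b \<in> Q" using ball_Q b by auto
  have D_pos: "0 < D"
  proof -
    have "\<delta> * \<delta> \<le> D * \<delta> * \<delta>" using D[of "[]" v b v b] v_in b_in b by simp
    then show ?thesis using \<delta>(1) by (simp add: mult.assoc)
  qed
  have "distortion_ifs \<phi> m K Q c D (1 / D) v b v"
  proof
    fix w w' assume w: "w \<in> lists ?J" "w' \<in> lists ?J" "\<not> prefix w w'" "\<not> prefix w' w"
    let ?f = "compose_word \<phi>"
    define r where "r = 1 / D * dist (?f w v) (?f w b)"
    have cont: "continuous_on (cball v \<delta>) (?f w)"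
      using compose_word_continuous_on[of ?J Q \<phi>, OF Q_stay less_imp_le[OF c_pos] Q_contraction w(1)] ball_Q
      by (rule continuous_on_subset)
    have "ball (?f w v) r \<subseteq> ?f w ` ball v \<delta>"
    proof (rule ball_subset_image_ball[OF cont inj_on_subset[OF compose_word_inj_on[of ?J Q \<phi>, OF Q_stay Q_inj w(1)] ball_Q] \<delta>(1)])
      fix y assume y: "y \<in> sphere v \<delta>"
      then have "y \<in> Q" using ball_Q by auto
      then have "dist (?f w v) (?f w b) * \<delta> \<le> D * dist (?f w v) (?f w y) * \<delta>"
        using D[OF w(1) v_in(1) b_in v_in(1), of y] y b by simp
      then show "r \<le> dist (?f w v) (?f w y)" using \<delta>(1) D_pos by (simp add: r_def field_simps)
    qed
    moreover have "?f w' v \<notin> ?f w ` ball v \<delta>"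
    proof -
      have "?f w ` V \<inter> ?f w' ` V = {}"
        by (rule incomparable_words_disjoint[OF V(4) V_disjoint inj_on_subset[OF inj V(3)] w])
      moreover have "ball v \<delta> \<subseteq> V" using ball_V ball_subset_cball by blast
      ultimately show ?thesis using v_in(2) by blast
    qed
    ultimately show "1 / D * dist (?f w v) (?f w b) \<le> dist (?f w v) (?f w' v)"
      unfolding r_def[symmetric] by (meson mem_ball not_le subsetD)
  next
    show "K = (\<Union>j\<in>?J. \<phi> j ` K)" by (rule K'(4))
    show "\<phi> j x \<in> Q" if "j \<in> ?J" "x \<in> Q" for j x using Q_stay[OF that] .
    show "dist (\<phi> j x) (\<phi> j y) \<le> c * dist x y" if "j \<in> ?J" "x \<in> Q" "y \<in> Q" for j x y
      using Q_contraction[OF that] .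
    show "inj_on (\<phi> j) Q" if "j \<in> ?J" for j using Q_inj[OF that] .
    show "dist (compose_word \<phi> w x) (compose_word \<phi> w y) * dist x' y'
        \<le> D * dist (compose_word \<phi> w x') (compose_word \<phi> w y') * dist x y"
      if "w \<in> lists ?J" "x \<in> Q" "y \<in> Q" "x' \<in> Q" "y' \<in> Q" for w x y x' y' using D[OF that] .
    show "0 < 1 / D" using D_pos by simp
    show "v \<noteq> b" using b \<delta>(1) by auto
  qed (rule K'(1,2) K_sub Q_bdd c_pos c_less v_in(1) b_in)+
  then show ?thesis by (rule that)
qed

section \<open>Recurrence in self-conformal systems\<close>

text \<open>An injective self-map of a finite set is onto, so a pair at maximal distance is the image of a
  pair, whose distance would have to be larger.\<close>

lemma finite_attractor_singleton:
  assumes fin: "finite K" and ne: "K \<noteq> {}" and maps: "f ` K \<subseteq> K" and inj: "inj_on f K"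
    and contr: "\<And>x y. x \<in> K \<Longrightarrow> y \<in> K \<Longrightarrow> x \<noteq> y \<Longrightarrow> dist (f x) (f y) < dist x y"
  obtains p where "K = {p}"
proof -
  have surj: "f ` K = K" using fin maps inj by (simp add: endo_inj_surj)
  obtain p where p: "p \<in> K \<times> K" "\<And>p'. p' \<in> K \<times> K \<Longrightarrow> dist (fst p') (snd p') \<le> dist (fst p) (snd p)"
  proof -
    define g where "g p = dist (fst p) (snd p)" for p :: "'a \<times> 'a"
    have g: "finite (g ` (K \<times> K))" "g ` (K \<times> K) \<noteq> {}" using fin ne by auto
    obtain p where p: "p \<in> K \<times> K" "Max (g ` (K \<times> K)) = g p" using Max_in[OF g] by blast
    have "g p' \<le> g p" if "p' \<in> K \<times> K" for p' using Max_ge[OF g(1)] that p(2) by simp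
    then show ?thesis using that p(1) unfolding g_def by blast
  qed
  have "fst p \<in> f ` K" "snd p \<in> f ` K" using p(1) surj by (simp_all add: mem_Times_iff)
  then obtain x y where xy: "x \<in> K" "y \<in> K" "fst p = f x" "snd p = f y" by blast
  have "x = y" using contr[OF xy(1,2)] p(2)[of "(x, y)"] xy by force
  then have zero: "dist (fst p) (snd p) = 0" using xy by simp
  have "x' = y'" if "x' \<in> K" "y' \<in> K" for x' y' using p(2)[of "(x', y')"] that zero by simp
  then show ?thesis using ne that by blast
qed

text \<open>All codes lead to the same point. With at least two symbols it is not uniquely coded, so that
  \<open>T\<close> fixes it by definition and it returns exactly when the radius is positive.\<close>

lemma recurrence_set_singleton:
  assumes p: "\<And>j. j \<in> {1..m} \<Longrightarrow> \<phi> j p = p" and m: "2 \<le> m"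
  shows "recurrence_set {p} (induced_map m \<phi> {p}) \<psi> = (if \<exists>\<^sub>\<infinity>n. 0 < \<psi> (real n) then {p} else {})"
proof -
  have word: "word_map \<phi> i n p = p" if "i \<in> code_space m" for i n
    using that by (induction n) (auto simp: code_space_def p)
  have coding: "coding_map \<phi> {p} i = p" if "i \<in> code_space m" for i
    unfolding coding_map_def using word[OF that] by (auto simp: LIMSEQ_const_iff)
  have two: "(\<lambda>_. 1) \<in> codes_of m \<phi> {p} p" "(\<lambda>_. 2) \<in> codes_of m \<phi> {p} p"
    using m coding by (auto simp: codes_of_def code_space_def)
  have "card (codes_of m \<phi> {p} p) \<noteq> 1"
  proof
    assume "card (codes_of m \<phi> {p} p) = 1"
    then obtain z where "codes_of m \<phi> {p} p = {z}" by (rule card_1_singletonE)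
    then have "(\<lambda>_::nat. 1::nat) = (\<lambda>_. 2)" using two by simp
    from fun_cong[OF this] show False by simp
  qed
  then have "p \<notin> uniquely_coded m \<phi> {p}" by (simp add: uniquely_coded_def)
  then have fixp: "induced_map m \<phi> {p} p = p" by (simp add: induced_map_def)
  have "(induced_map m \<phi> {p} ^^ n) p = p" for n by (induction n) (auto simp: fixp)
  then show ?thesis by (auto simp: recurrence_set_def)
qed

lemma gibbs_measure_properties:
  assumes "gibbs_measure \<Omega> m \<phi> K \<mu>" "compact K"
  shows "sets \<mu> = sets borel" "emeasure \<mu> UNIV = 1" "emeasure \<mu> (- K) = 0"
proof -
  obtain h \<nu> where h: "\<forall>x\<in>K. 0 < h x" and \<nu>: "sets \<nu> = sets borel" and int: "(LINT x:K|\<nu>. h x) = 1"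
    and \<mu>: "\<mu> = density \<nu> (\<lambda>x. ennreal (indicator K x * h x))"
    using assms(1) unfolding gibbs_measure_def by blast
  let ?g = "\<lambda>x. indicator K x * h x"
  have int': "(\<integral>x. ?g x \<partial>\<nu>) = 1" using int by (simp add: set_lebesgue_integral_def)
  then have integrable: "integrable \<nu> ?g" using not_integrable_integral_eq by fastforce
  then have meas: "(\<lambda>x. ennreal (?g x)) \<in> borel_measurable \<nu>" by simp
  have nonneg: "0 \<le> ?g x" for x using h by (auto simp: indicator_def less_imp_le)
  have "(\<integral>\<^sup>+x. ennreal (?g x) \<partial>\<nu>) = 1"
    using nn_integral_eq_integral[OF integrable] nonneg int' by simp
  moreover have "space \<nu> = UNIV" using sets_eq_imp_space_eq[OF \<nu>] by simp
  ultimately show "emeasure \<mu> UNIV = 1"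
    unfolding \<mu> using emeasure_density[OF meas, of UNIV] \<nu> by simp
  show "sets \<mu> = sets borel" using \<mu> \<nu> by simp
  have "- K \<in> sets \<nu>" using \<nu> borel_comp[OF borel_compact[OF assms(2)]] by simp
  then have "emeasure \<mu> (- K) = (\<integral>\<^sup>+x. ennreal (?g x) * indicator (- K) x \<partial>\<nu>)"
    unfolding \<mu> by (rule emeasure_density[OF meas])
  also have "\<dots> = (\<integral>\<^sup>+x. 0 \<partial>\<nu>)" by (intro nn_integral_cong) (auto simp: indicator_def)
  finally show "emeasure \<mu> (- K) = 0" by simp
qed

theorem corollary1p2:
  fixes \<phi> :: "nat \<Rightarrow> real^'n \<Rightarrow> real^'n" and K :: "(real^'n) set"
    and \<mu> :: "(real^'n) measure" and T :: "real^'n \<Rightarrow> real^'n"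
    and \<psi> :: "real \<Rightarrow> real" and \<tau> :: real and m :: nat
  assumes "self_conformal_system m \<phi> K \<mu> T"
    and "\<tau> = hausdorff_dim K"
    and "equivalent_measures (emeasure \<mu>) (\<lambda>E. hausdorff_measure \<tau> (E \<inter> K))"
    and "\<forall>t. 0 \<le> \<psi> t"
  shows "recurrence_set K T \<psi> \<in> sets \<mu> \<and>
    ((\<Sum>n. ennreal (\<psi> (real (Suc n)) powr \<tau>)) < \<infinity> \<longrightarrow> emeasure \<mu> (recurrence_set K T \<psi>) = 0) \<and>
    ((\<Sum>n. ennreal (\<psi> (real (Suc n)) powr \<tau>)) = \<infinity> \<longrightarrow> emeasure \<mu> (recurrence_set K T \<psi>) = 1)"
proof -
  obtain \<alpha> \<Omega> where ifs: "conformal_ifs \<alpha> \<Omega> m \<phi>" and osc: "open_set_condition \<Omega> m \<phi>"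
    and K: "self_conformal_set \<Omega> m \<phi> K" and gibbs: "gibbs_measure \<Omega> m \<phi> K \<mu>" and T: "T = induced_map m \<phi> K"
    using assms(1) unfolding self_conformal_system_def by blast
  have K_compact: "compact K" using K by (simp add: self_conformal_set_def)
  note \<mu> = gibbs_measure_properties[OF gibbs K_compact]
  obtain C where C: "1 \<le> C"
    "\<And>E. E \<in> sets borel \<Longrightarrow> ennreal (inverse C) * hausdorff_measure \<tau> (E \<inter> K) \<le> emeasure \<mu> E"
    "\<And>E. E \<in> sets borel \<Longrightarrow> emeasure \<mu> E \<le> ennreal C * hausdorff_measure \<tau> (E \<inter> K)"
    using assms(3) unfolding equivalent_measures_def by blast
  obtain Q c D \<kappa> a b v where dist: "distortion_ifs \<phi> m K Q c D \<kappa> a b v"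
    using conformal_ifs_imp_distortion_ifs[OF ifs osc K] .
  interpret distortion_ifs \<phi> m K Q c D \<kappa> a b v by (rule dist)
  have m: "2 \<le> m" using ifs by (simp add: conformal_ifs_def)
  consider "\<tau> < 0" | "\<tau> = 0" | "0 < \<tau>" by linarith
  then show ?thesis
  proof cases
    case 1
    have "ennreal (inverse C) * hausdorff_measure \<tau> K \<le> emeasure \<mu> UNIV" using C(2)[of UNIV] by simp
    then have "ennreal (inverse C) * hausdorff_measure \<tau> K \<noteq> top" using \<mu>(2) by (auto simp: top_unique)
    then have "hausdorff_measure \<tau> K < \<infinity>" using C(1) by (auto simp: ennreal_mult_eq_top_iff less_top)
    then have "countable K" by (rule countable_if_hausdorff_measure_negative_finite[OF 1])
    have "emeasure \<mu> {x} = 0" if "x \<in> K" for x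
      using C(3)[of "{x}"] that hausdorff_measure_negative_singleton[OF 1, of x] by simp
    then have "emeasure \<mu> K = 0"
      using emeasure_countable_singleton[of K \<mu>] \<open>countable K\<close> \<mu>(1) by (simp add: nn_integral_0_iff_AE AE_count_space)
    moreover have "emeasure \<mu> UNIV \<le> emeasure \<mu> K + emeasure \<mu> (- K)"
      using emeasure_subadditive[of K \<mu> "- K"] borel_compact[OF K_compact] borel_comp[of K] \<mu>(1) by simp
    ultimately show ?thesis using \<mu> by simp
  next
    case 2
    have "finite K"
    proof (rule ccontr)
      assume "infinite K"
      obtain k :: nat where k: "C < real k" using reals_Archimedean2 by blast
      obtain F where F: "F \<subseteq> K" "finite F" "card F = k" using infinite_arbitrarily_large[OF \<open>infinite K\<close>] by blast
      have point: "ennreal (inverse C) \<le> emeasure \<mu> {x}" if "x \<in> F" for x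
      proof -
        have "ennreal (inverse C) * 1 \<le> ennreal (inverse C) * hausdorff_measure \<tau> {x}"
          unfolding 2 by (intro mult_left_mono hausdorff_measure_0_singleton) simp
        also have "\<dots> \<le> emeasure \<mu> {x}"
          using C(2)[of "{x}"] that F(1) by (simp add: subset_iff)
        finally show ?thesis by simp
      qed
      have "ennreal (real k * inverse C) = (\<Sum>x\<in>F. ennreal (inverse C))"
        using F C(1) by (simp add: ennreal_mult ennreal_of_nat_eq_real_of_nat)
      also have "\<dots> \<le> (\<Sum>x\<in>F. emeasure \<mu> {x})" by (intro sum_mono point)
      also have "\<dots> = emeasure \<mu> F" using F(2) \<mu>(1) by (intro emeasure_eq_sum_singleton[symmetric]) auto
      also have "\<dots> \<le> emeasure \<mu> UNIV" using \<mu>(1) by (intro emeasure_mono) auto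
      finally have "real k * inverse C \<le> 1" using \<mu>(2) by simp
      then show False using k C(1) by (simp add: field_simps)
    qed
    then obtain p where p: "K = {p}"
    proof (rule finite_attractor_singleton[where f = "\<phi> 1"])
      have one: "1 \<in> {1..m}" using m by simp
      show "K \<noteq> {}" by (rule K_nonempty)
      show "\<phi> 1 ` K \<subseteq> K" using phi_K[OF one] by auto
      show "inj_on (\<phi> 1) K" using inj_on_subset[OF inj[OF one] K_subset] .
      show "dist (\<phi> 1 x) (\<phi> 1 y) < dist x y" if "x \<in> K" "y \<in> K" "x \<noteq> y" for x y
      proof -
        have "dist (\<phi> 1 x) (\<phi> 1 y) \<le> c * dist x y" using contraction[OF one] that K_subset by blast
        also have "\<dots> < 1 * dist x y" using that c_less by (intro mult_strict_right_mono) auto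
        finally show ?thesis by simp
      qed
    qed
    have "\<phi> j p = p" if "j \<in> {1..m}" for j using phi_K[OF that, of p] p by simp
    then have R: "recurrence_set K T \<psi> = (if \<exists>\<^sub>\<infinity>n. 0 < \<psi> (real n) then {p} else {})"
      unfolding T p using m by (intro recurrence_set_singleton) auto
    have "emeasure \<mu> UNIV \<le> emeasure \<mu> {p} + emeasure \<mu> (- {p})"
      using emeasure_subadditive[of "{p}" \<mu> "- {p}"] \<mu>(1) by simp
    moreover have "emeasure \<mu> {p} \<le> emeasure \<mu> UNIV" using \<mu>(1) by (intro emeasure_mono) auto
    ultimately have mass: "emeasure \<mu> {p} = 1" using \<mu>(2,3) p by simp
    \<comment> \<open>since \<open>0 powr 0 = 0\<close>, the series counts the positive radii\<close>
    have powr: "\<psi> (real (Suc n)) powr \<tau> = (if 0 < \<psi> (real (Suc n)) then 1 else 0)" for n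
      using 2 assms(4) by (auto simp: less_le)
    have INFM_Suc: "(\<exists>\<^sub>\<infinity>n. 0 < \<psi> (real n)) \<longleftrightarrow> (\<exists>\<^sub>\<infinity>n. 0 < \<psi> (real (Suc n)))"
      unfolding INFM_nat by (metis Suc_lessD Suc_less_eq2 gr0_implies_Suc less_Suc_eq_0_disj not_less_eq zero_less_Suc)
    have sum: "(\<Sum>n. ennreal (\<psi> (real (Suc n)) powr \<tau>)) < \<infinity> \<longleftrightarrow> \<not> (\<exists>\<^sub>\<infinity>n. 0 < \<psi> (real n))"
    proof
      assume "(\<Sum>n. ennreal (\<psi> (real (Suc n)) powr \<tau>)) < \<infinity>"
      then have "summable (\<lambda>n. \<psi> (real (Suc n)) powr \<tau>)" by (intro summable_suminf_not_top) auto
      then have "(\<lambda>n. \<psi> (real (Suc n)) powr \<tau>) \<longlonglongrightarrow> 0" by (rule summable_LIMSEQ_zero)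
      then have "\<forall>\<^sub>F n in sequentially. \<psi> (real (Suc n)) powr \<tau> < 1" by (rule order_tendstoD) simp
      then have "\<forall>\<^sub>F n in sequentially. \<not> 0 < \<psi> (real (Suc n))"
        unfolding powr by eventually_elim (auto split: if_splits)
      then show "\<not> (\<exists>\<^sub>\<infinity>n. 0 < \<psi> (real n))"
        unfolding INFM_Suc not_INFM by (simp add: cofinite_eq_sequentially)
    next
      assume "\<not> (\<exists>\<^sub>\<infinity>n. 0 < \<psi> (real n))"
      then have fin: "finite {n. 0 < \<psi> (real (Suc n))}" unfolding INFM_Suc by (simp add: frequently_cofinite)
      have "(\<Sum>n. ennreal (\<psi> (real (Suc n)) powr \<tau>)) = (\<Sum>n\<in>{n. 0 < \<psi> (real (Suc n))}. ennreal (\<psi> (real (Suc n)) powr \<tau>))"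
        unfolding powr by (intro suminf_finite fin) auto
      also have "\<dots> < \<infinity>" using fin by (simp add: sum_ennreal)
      finally show "(\<Sum>n. ennreal (\<psi> (real (Suc n)) powr \<tau>)) < \<infinity>" .
    qed
    show ?thesis
    proof (intro conjI impI)
      show "recurrence_set K T \<psi> \<in> sets \<mu>" unfolding R using \<mu>(1) by simp
      show "emeasure \<mu> (recurrence_set K T \<psi>) = 0"
        if "(\<Sum>n. ennreal (\<psi> (real (Suc n)) powr \<tau>)) < \<infinity>"
      proof -
        have "\<not> (\<exists>\<^sub>\<infinity>n. 0 < \<psi> (real n))" using that sum by (rule iffD1[rotated])
        then show ?thesis by (simp only: R if_False emeasure_empty)
      qed
      show "emeasure \<mu> (recurrence_set K T \<psi>) = 1"
        if "(\<Sum>n. ennreal (\<psi> (real (Suc n)) powr \<tau>)) = \<infinity>"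
      proof -
        have "\<exists>\<^sub>\<infinity>n. 0 < \<psi> (real n)" using that sum by (metis order_less_irrefl)
        then show ?thesis by (simp only: R if_True mass)
      qed
    qed
  next
    case 3
    interpret regular_ifs \<phi> m K Q c D \<kappa> a b v \<mu> \<tau> C
      by unfold_locales (rule \<mu> 3 C(1) | erule C(2) C(3))+
    have \<psi>: "\<And>t. 0 \<le> \<psi> t" using assms(4) by simp
    show ?thesis unfolding T by (intro conjI impI recurrence_dichotomy[OF \<psi>])
  qed
qed

end
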